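(* Let $n\ge2$. There exists a strictly convex compact $C^2$ hypersurface $\Sigma\subset\mathbb{R}^n$ such that for every $\varepsilon>0$ and all sufficiently large $R>0$ (depending on $\varepsilon$) there exist $f\in L^2(\Sigma)$ and $w:\mathbb{R}^n\to[0,1]$ supported in $B_R$ with \[\int_{B_R}|\mathcal{E}_\Sigma f(x)|^2w(x)\,dx\ge R^{\frac{n-1}{n+1}-\varepsilon}\|f\|_{L^2(\Sigma)}^2\|\mathcal{M}w\|_{L^\infty(\mathbb{S}^{n-1})}.\]
   Context: $\mathcal{E}_\Sigma f(x)=\int_\Sigma f(\sigma)e^{2\pi ix\cdot\sigma}d\sigma(\sigma)$ with $d\sigma$ surface measure. For $\nu\in\mathbb{S}^{n-1}$, $\mathcal{M}w(\nu)=\sup_T\int_Tw$, over all infinite tubes $T$ of radius $1$ parallel to $\nu$. $B_R$ is the ball of radius $R$ centered at $0$. *)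

theory Defs
  imports "HOL-Analysis.Analysis"
begin

text \<open>s-dimensional Hausdorff measure (normalised so that it agrees with
  surface area on C1 hypersurfaces when s = n - 1).\<close>

definition hausdorff_approx :: "real \<Rightarrow> real \<Rightarrow> 'a::metric_space set \<Rightarrow> ennreal" where
  "hausdorff_approx s \<delta> A =
     (INF C \<in> {C :: nat \<Rightarrow> 'a set. A \<subseteq> (\<Union>i. C i) \<and> (\<forall>i. bounded (C i) \<and> diameter (C i) \<le> \<delta>)}.
        (\<Sum>i. ennreal (unit_ball_vol s * (diameter (C i) / 2) powr s)))"

definition hausdorff_outer :: "real \<Rightarrow> 'a::metric_space set \<Rightarrow> ennreal" where
  "hausdorff_outer s A = (SUP \<delta> \<in> {0<..}. hausdorff_approx s \<delta> A)"

definition surface_measure :: "'a::euclidean_space set \<Rightarrow> 'a measure" where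
  "surface_measure S =
     measure_of S (sets (restrict_space borel S)) (hausdorff_outer (real (DIM('a) - 1)))"

text \<open>Strictly convex compact C2 hypersurface: zero set of a C2 defining function rho
  (gradient g, Hessian H, continuous), with nonvanishing gradient on the surface, bounding the
  compact convex body rho le 0, and with positive definite second fundamental form.\<close>

definition strictly_convex_compact_C2_hypersurface :: "'a::euclidean_space set \<Rightarrow> bool" where
  "strictly_convex_compact_C2_hypersurface \<Sigma> \<longleftrightarrow>
     (\<exists>(\<rho>::'a \<Rightarrow> real) (g::'a \<Rightarrow> 'a) (H::'a \<Rightarrow> 'a \<Rightarrow> 'a).
        (\<forall>x. (\<rho> has_derivative (\<lambda>h. g x \<bullet> h)) (at x)) \<and>
        (\<forall>x. (g has_derivative H x) (at x)) \<and>
        (\<forall>v. continuous_on UNIV (\<lambda>x. H x v)) \<and>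
        \<Sigma> = {x. \<rho> x = 0} \<and> \<Sigma> \<noteq> {} \<and>
        compact {x. \<rho> x \<le> 0} \<and> convex {x. \<rho> x \<le> 0} \<and>
        (\<forall>x\<in>\<Sigma>. g x \<noteq> 0) \<and>
        (\<forall>x\<in>\<Sigma>. \<forall>v. v \<noteq> 0 \<and> g x \<bullet> v = 0 \<longrightarrow> H x v \<bullet> v > 0))"

definition extension_op :: "'a::euclidean_space set \<Rightarrow> ('a \<Rightarrow> complex) \<Rightarrow> 'a \<Rightarrow> complex" where
  "extension_op \<Sigma> f x = (LINT s|surface_measure \<Sigma>. f s * cis (2 * pi * (x \<bullet> s)))"

definition L2_on :: "'a measure \<Rightarrow> ('a \<Rightarrow> complex) \<Rightarrow> bool" where
  "L2_on M f \<longleftrightarrow> f \<in> borel_measurable M \<and> integrable M (\<lambda>s. (cmod (f s))\<^sup>2)"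

definition L2_norm_sq :: "'a measure \<Rightarrow> ('a \<Rightarrow> complex) \<Rightarrow> real" where
  "L2_norm_sq M f = (LINT s|M. (cmod (f s))\<^sup>2)"

definition tube :: "'a::euclidean_space \<Rightarrow> 'a \<Rightarrow> 'a set" where
  "tube a \<nu> = {x. norm ((x - a) - ((x - a) \<bullet> \<nu>) *\<^sub>R \<nu>) < 1}"

definition MT_max :: "('a::euclidean_space \<Rightarrow> real) \<Rightarrow> 'a \<Rightarrow> real" where
  "MT_max w \<nu> = (SUP a. (LINT x:tube a \<nu>|lborel. w x))"

text \<open>L-infinity norm of MT_max w over the unit sphere (sup; MT_max w is lower semicontinuous,
  so this equals the essential sup).\<close>

definition MT_norm :: "('a::euclidean_space \<Rightarrow> real) \<Rightarrow> real" where
  "MT_norm w = (SUP \<nu> \<in> sphere 0 1. MT_max w \<nu>)"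

end

theory Submission
  imports Defs "HOL-Probability.Probability" "HOL-Computational_Algebra.Primes" "HOL-Real_Asymp.Real_Asymp"
begin

text \<open>
  At scale R take \<open>m\<close> random vectors \<open>u\<^sub>j\<close> in the torus and the generalised arithmetic progression of
  all \<open>\<Sum>\<^sub>j a\<^sub>j u\<^sub>j\<close> modulo integer vectors, with \<open>0 \<le> a\<^sub>j < L\<close> and \<open>L\<^sup>m\<close> roughly \<open>R\<close>. It behaves like
  a random set of about R points, so (second moment method) about \<open>R powr ((n - 1) / (n + 1))\<close> caps of
  radius \<open>\<delta> = R powr (- 1 / (n + 1))\<close> and thickness \<open>\<delta>\<^sup>2\<close> of the unit sphere contain one of its points.
  Bumps of height \<open>\<delta>\<^sup>2\<close> and width \<open>\<delta>\<close>, which are bounded in \<open>C\<^sup>2\<close>, move the sphere onto these points;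
  the scales use disjoint parts of the sphere and summable bump sizes, so a single surface serves
  all of them.

  With \<open>f\<close> the indicator of the \<open>1/R\<close>-caps around the chosen points, all phases agree on the Bohr
  set \<open>X\<close> where every \<open>x \<bullet> u\<^sub>j\<close> and every coordinate of \<open>x\<close> is nearly an integer; \<open>w\<close> is the indicator
  of \<open>X\<close> in the ball. By pigeonhole \<open>X\<close> has density about \<open>1/R\<close>. A tube meets \<open>X\<close> in small measure:
  majorise \<open>X\<close> by a Fejer kernel, whose integral along a line in direction \<open>\<nu>\<close> counts the resonances
  \<open>\<nu> \<bullet> (\<Sum>\<^sub>j a\<^sub>j u\<^sub>j + b) = O(1/R)\<close>; a union bound over \<open>\<nu>\<close> and over tuples of vectors in echelon
  form shows that for typical \<open>u\<^sub>j\<close> these are few for all \<open>\<nu>\<close> at once.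
\<close>

section \<open>Hausdorff measure is a Borel measure\<close>

text \<open>The exponent: a cap of radius \<open>\<delta>\<close> and thickness
  \<open>\<delta>^2\<close> has volume about \<open>\<delta>^(n+1) = 1/R\<close>, so R random points
  hit a typical cap, and there are about \<open>\<delta>^(-(n-1)) = R^((n-1)/(n+1))\<close> caps. If
  N caps are hit, the mass S of f (also its squared norm) is about \<open>N * R^(-(n-1))\<close>,
  the extension has modulus at least S/2 on X, X has volume about \<open>R^(n-1)\<close>, and tubes
  carry O(1) up to small powers; the quotient is about N. Two demands pull apart: aligned phases on
  a large X require frequencies spanned by few generators, while small tube mass forbids many
  frequencies in a thin slab. A progression of slowly growing rank meets both at the price of small
  powers of R. Height \<open>\<delta>^2\<close> over width \<open>\<delta>\<close> is the most that
  keeps second derivatives bounded; a further factor \<open>2^-k / 120\<close> makes them small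
  enough for convexity. The generators live on the grid of mesh 1/q with q prime: probabilities
  become cardinalities, and distinct points of the translated progression are pairwise independent
  modulo q. The size of q is free and disappears from the estimates at a single scale.\<close>

lemma hausdorff_approx_le:
  fixes A :: "'a::metric_space set"
  assumes "A \<subseteq> (\<Union>i. C i)" "\<And>i. bounded (C i)" "\<And>i. diameter (C i) \<le> \<delta>"
  shows "hausdorff_approx s \<delta> A \<le> (\<Sum>i. ennreal (unit_ball_vol s * (diameter (C i) / 2) powr s))"
  unfolding hausdorff_approx_def using assms by (intro INF_lower) auto

lemma hausdorff_approx_antimono:
  fixes A :: "'a::metric_space set"
  assumes "\<delta> \<le> \<delta>'"
  shows "hausdorff_approx s \<delta>' A \<le> hausdorff_approx s \<delta> A"
  unfolding hausdorff_approx_def using assms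
  by (intro INF_superset_mono) (auto intro: order_trans)

lemma hausdorff_approx_mono:
  fixes A :: "'a::metric_space set"
  assumes "A \<subseteq> B"
  shows "hausdorff_approx s \<delta> A \<le> hausdorff_approx s \<delta> B"
  unfolding hausdorff_approx_def using assms
  by (intro INF_superset_mono) auto

lemma hausdorff_approx_empty:
  assumes "\<delta> > 0"
  shows "hausdorff_approx s \<delta> ({} :: 'a::metric_space set) = 0"
proof -
  have "hausdorff_approx s \<delta> ({} :: 'a set) \<le> (\<Sum>i::nat. ennreal (unit_ball_vol s * (diameter ({} :: 'a set) / 2) powr s))"
    using assms by (intro hausdorff_approx_le) auto
  then show ?thesis by simp
qed

lemma hausdorff_approx_le_outer:
  assumes "\<delta> > 0"
  shows "hausdorff_approx s \<delta> A \<le> hausdorff_outer s A"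
  unfolding hausdorff_outer_def using assms by (intro SUP_upper) auto

lemma hausdorff_outer_empty: "hausdorff_outer s ({} :: 'a::metric_space set) = 0"
  unfolding hausdorff_outer_def by (simp add: hausdorff_approx_empty cong: SUP_cong_simp)

lemma hausdorff_outer_mono:
  fixes A :: "'a::metric_space set"
  assumes "A \<subseteq> B"
  shows "hausdorff_outer s A \<le> hausdorff_outer s B"
  unfolding hausdorff_outer_def using assms
  by (intro SUP_mono) (auto intro: hausdorff_approx_mono)

lemma hausdorff_approx_countably_subadditive:
  fixes A :: "nat \<Rightarrow> 'a::metric_space set"
  shows "hausdorff_approx s \<delta> (\<Union>i. A i) \<le> (\<Sum>i. hausdorff_approx s \<delta> (A i))"
proof (rule ennreal_le_epsilon)
  fix e :: real assume e: "0 < e" and fin: "(\<Sum>i. hausdorff_approx s \<delta> (A i)) < top"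
  have finA: "hausdorff_approx s \<delta> (A i) < top" for i
    using fin ennreal_suminf_lessD[of "\<lambda>i. hausdorff_approx s \<delta> (A i)" top i] by (simp add: less_top)
  define h where "h = (\<lambda>X::'a set. ennreal (unit_ball_vol s * (diameter X / 2) powr s))"
  have ex: "\<exists>C :: nat \<Rightarrow> 'a set. A i \<subseteq> (\<Union>j. C j) \<and> (\<forall>j. bounded (C j) \<and> diameter (C j) \<le> \<delta>) \<and>
      (\<Sum>j. h (C j)) \<le> hausdorff_approx s \<delta> (A i) + ennreal (e * (1/2)^Suc i)" for i
  proof -
    have "hausdorff_approx s \<delta> (A i) < hausdorff_approx s \<delta> (A i) + ennreal (e * (1/2)^Suc i)"
    proof -
      obtain r where r: "hausdorff_approx s \<delta> (A i) = ennreal r" "0 \<le> r"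
        using finA[of i] by (cases "hausdorff_approx s \<delta> (A i)") auto
      have "0 < e * (1/2)^Suc i" using e by simp
      then show ?thesis unfolding r(1) by (subst ennreal_plus[symmetric]) (use r(2) in \<open>auto intro!: ennreal_lessI\<close>)
    qed
    then show ?thesis
      unfolding hausdorff_approx_def INF_less_iff h_def by (auto intro: less_imp_le)
  qed
  then obtain C :: "nat \<Rightarrow> nat \<Rightarrow> 'a set" where C: "\<And>i. A i \<subseteq> (\<Union>j. C i j)" "\<And>i j. bounded (C i j)"
    "\<And>i j. diameter (C i j) \<le> \<delta>"
    "\<And>i. (\<Sum>j. h (C i j)) \<le> hausdorff_approx s \<delta> (A i) + ennreal (e * (1/2)^Suc i)"
    by metis
  define D where "D = (\<lambda>l. case prod_decode l of (i, j) \<Rightarrow> C i j)"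
  have "hausdorff_approx s \<delta> (\<Union>i. A i) \<le> (\<Sum>l. h (D l))"
    unfolding h_def
  proof (rule hausdorff_approx_le)
    show "(\<Union>i. A i) \<subseteq> (\<Union>l. D l)"
    proof
      fix x assume "x \<in> (\<Union>i. A i)"
      then obtain i j where "x \<in> C i j" using C(1) by blast
      then have "x \<in> D (prod_encode (i, j))" by (simp add: D_def)
      then show "x \<in> (\<Union>l. D l)" by blast
    qed
  qed (auto simp: D_def C split: prod.splits)
  also have "\<dots> = (\<Sum>i. \<Sum>j. h (C i j))"
    using suminf_ennreal_2dimen[of "\<lambda>i. (\<Sum>j. h (C i j))" "\<lambda>(i, j). h (C i j)"]
    by (simp add: D_def case_prod_beta)
  also have "\<dots> \<le> (\<Sum>i. hausdorff_approx s \<delta> (A i) + ennreal (e * (1/2)^Suc i))"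
    by (intro suminf_le C) auto
  also have "\<dots> = (\<Sum>i. hausdorff_approx s \<delta> (A i)) + (\<Sum>i. ennreal (e * (1/2)^Suc i))"
    by (intro suminf_add[symmetric]) auto
  also have "(\<Sum>i. ennreal (e * (1/2)^Suc i)) = ennreal e"
  proof (rule suminf_ennreal_eq)
    show "(\<lambda>i. e * (1/2)^Suc i) sums e"
      using sums_mult[OF power_half_series, of e] by simp
  qed (use e in auto)
  finally show "hausdorff_approx s \<delta> (\<Union>i. A i) \<le> (\<Sum>i. hausdorff_approx s \<delta> (A i)) + ennreal e" .
qed

lemma hausdorff_outer_countably_subadditive:
  fixes A :: "nat \<Rightarrow> 'a::metric_space set"
  shows "hausdorff_outer s (\<Union>i. A i) \<le> (\<Sum>i. hausdorff_outer s (A i))"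
  unfolding hausdorff_outer_def[of s "\<Union>i. A i"]
proof (rule SUP_least)
  fix \<delta> :: real assume "\<delta> \<in> {0<..}"
  then have "(\<Sum>i. hausdorff_approx s \<delta> (A i)) \<le> (\<Sum>i. hausdorff_outer s (A i))"
    by (intro suminf_le hausdorff_approx_le_outer) auto
  then show "hausdorff_approx s \<delta> (\<Union>i. A i) \<le> (\<Sum>i. hausdorff_outer s (A i))"
    using hausdorff_approx_countably_subadditive[of s \<delta> A] by (rule order_trans[rotated])
qed

lemma hausdorff_outer_Un:
  fixes A B :: "'a::metric_space set"
  shows "hausdorff_outer s (A \<union> B) \<le> hausdorff_outer s A + hausdorff_outer s B"
proof -
  have "hausdorff_outer s (\<Union>i. binaryset A B i) \<le> (\<Sum>i. hausdorff_outer s (binaryset A B i))"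
    by (rule hausdorff_outer_countably_subadditive)
  also have "\<dots> = hausdorff_outer s A + hausdorff_outer s B"
    by (intro suminf_binaryset_eq hausdorff_outer_empty)
  finally show ?thesis by (simp add: UN_binaryset_eq)
qed

text \<open>A set of diameter below the distance of A and B meets at most one of them, so a fine cover
  of the union splits.\<close>

lemma hausdorff_outer_separated:
  fixes A B :: "'a::metric_space set"
  assumes e: "e > 0" and sep: "\<And>x y. x \<in> A \<Longrightarrow> y \<in> B \<Longrightarrow> e \<le> dist x y"
  shows "hausdorff_outer s A + hausdorff_outer s B \<le> hausdorff_outer s (A \<union> B)"
proof -
  define h where "h = (\<lambda>X::'a set. ennreal (unit_ball_vol s * (diameter X / 2) powr s))"
  have main: "hausdorff_approx s \<delta> A + hausdorff_approx s \<delta> B \<le> hausdorff_approx s \<delta> (A \<union> B)"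
    if \<delta>: "0 < \<delta>" "\<delta> < e" for \<delta>
    unfolding hausdorff_approx_def[of s \<delta> "A \<union> B"]
  proof (rule INF_greatest)
    fix C :: "nat \<Rightarrow> 'a set"
    assume "C \<in> {C. A \<union> B \<subseteq> (\<Union>i. C i) \<and> (\<forall>i. bounded (C i) \<and> diameter (C i) \<le> \<delta>)}"
    then have C: "A \<union> B \<subseteq> (\<Union>i. C i)" "\<And>i. bounded (C i)" "\<And>i. diameter (C i) \<le> \<delta>" by auto
    define CA where "CA = (\<lambda>i. if C i \<inter> A = {} then {} else C i)"
    define CB where "CB = (\<lambda>i. if C i \<inter> A = {} then C i else {})"
    have "hausdorff_approx s \<delta> A \<le> (\<Sum>i. h (CA i))"
      unfolding h_def
    proof (rule hausdorff_approx_le)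
      show "A \<subseteq> (\<Union>i. CA i)"
      proof
        fix x assume x: "x \<in> A"
        then obtain i where i: "x \<in> C i" using C(1) by blast
        with x have "x \<in> CA i" by (auto simp: CA_def)
        then show "x \<in> (\<Union>i. CA i)" by blast
      qed
    qed (use C \<delta> in \<open>auto simp: CA_def\<close>)
    moreover have "hausdorff_approx s \<delta> B \<le> (\<Sum>i. h (CB i))"
      unfolding h_def
    proof (rule hausdorff_approx_le)
      show "B \<subseteq> (\<Union>i. CB i)"
      proof
        fix y assume y: "y \<in> B"
        then obtain i where i: "y \<in> C i" using C(1) by blast
        have "C i \<inter> A = {}"
        proof (rule ccontr)
          assume "C i \<inter> A \<noteq> {}"
          then obtain x where x: "x \<in> C i" "x \<in> A" by blast
          have "dist x y \<le> \<delta>" using diameter_bounded_bound[OF C(2)[of i] x(1) i] C(3)[of i] by simp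
          with sep[OF x(2) y] \<delta> show False by simp
        qed
        with i have "y \<in> CB i" by (simp add: CB_def)
        then show "y \<in> (\<Union>i. CB i)" by blast
      qed
    qed (use C \<delta> in \<open>auto simp: CB_def\<close>)
    ultimately have "hausdorff_approx s \<delta> A + hausdorff_approx s \<delta> B \<le> (\<Sum>i. h (CA i)) + (\<Sum>i. h (CB i))"
      by (rule add_mono)
    also have "\<dots> = (\<Sum>i. h (CA i) + h (CB i))" by (intro suminf_add) auto
    also have "\<dots> = (\<Sum>i. h (C i))"
      by (intro suminf_cong) (auto simp: CA_def CB_def h_def)
    finally show "hausdorff_approx s \<delta> A + hausdorff_approx s \<delta> B
        \<le> (\<Sum>i. ennreal (unit_ball_vol s * (diameter (C i) / 2) powr s))" by (simp add: h_def)
  qed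
  have "hausdorff_outer s A + hausdorff_outer s B =
      (SUP \<delta>\<in>{0<..}. hausdorff_approx s \<delta> A + hausdorff_outer s B)"
    unfolding hausdorff_outer_def[of s A] by (intro ennreal_SUP_add_left[symmetric]) auto
  also have "\<dots> \<le> hausdorff_outer s (A \<union> B)"
  proof (rule SUP_least)
    fix \<delta> :: real assume \<delta>: "\<delta> \<in> {0<..}"
    have "hausdorff_approx s \<delta> A + hausdorff_outer s B =
        (SUP \<delta>'\<in>{0<..}. hausdorff_approx s \<delta> A + hausdorff_approx s \<delta>' B)"
      unfolding hausdorff_outer_def[of s B]
      by (subst (1 2) add.commute, intro ennreal_SUP_add_left[symmetric]) auto
    also have "\<dots> \<le> hausdorff_outer s (A \<union> B)"
    proof (rule SUP_least)
      fix \<delta>' :: real assume \<delta>': "\<delta>' \<in> {0<..}"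
      define d where "d = min (min \<delta> \<delta>') (e/2)"
      have d: "0 < d" "d < e" "d \<le> \<delta>" "d \<le> \<delta>'" using \<delta> \<delta>' e by (auto simp: d_def)
      have "hausdorff_approx s \<delta> A + hausdorff_approx s \<delta>' B \<le> hausdorff_approx s d A + hausdorff_approx s d B"
        by (intro add_mono hausdorff_approx_antimono d)
      also have "\<dots> \<le> hausdorff_approx s d (A \<union> B)" by (rule main[OF d(1,2)])
      also have "\<dots> \<le> hausdorff_outer s (A \<union> B)" by (rule hausdorff_approx_le_outer[OF d(1)])
      finally show "hausdorff_approx s \<delta> A + hausdorff_approx s \<delta>' B \<le> hausdorff_outer s (A \<union> B)" .
    qed
    finally show "hausdorff_approx s \<delta> A + hausdorff_outer s B \<le> hausdorff_outer s (A \<union> B)" .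
  qed
  finally show ?thesis .
qed

text \<open>Caratheodory's argument for metric outer measures. The part \<open>G i\<close> of
  \<open>A\<close> at distance at least 1/(i+1) from \<open>F\<close> is separated from
  \<open>F\<close>, so the inequality holds with \<open>G i\<close> in place of
  \<open>A - F\<close>. The error is a tail of the series over the shells \<open>Sh i\<close>;
  shells of equal parity have positive distance from each other, so the series is at most twice the
  measure of \<open>A\<close> and its tails vanish.\<close>

lemma hausdorff_outer_caratheodory_closed:
  fixes F A :: "'a::metric_space set"
  assumes F: "closed F"
  shows "hausdorff_outer s (A \<inter> F) + hausdorff_outer s (A - F) \<le> hausdorff_outer s A"
proof (cases "hausdorff_outer s A = top \<or> F = {}")
  case True
  then show ?thesis by (auto simp: hausdorff_outer_empty)
next
  case False
  then have fin: "hausdorff_outer s A < top" and Fne: "F \<noteq> {}" by (auto simp: less_top)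
  define G where "G = (\<lambda>i::nat. {x \<in> A. 1 / real (Suc i) \<le> infdist x F})"
  define Sh where "Sh = (\<lambda>i::nat. {x \<in> A. 1 / real (Suc (Suc i)) \<le> infdist x F \<and> infdist x F < 1 / real (Suc i)})"
  have sepG: "hausdorff_outer s (A \<inter> F) + hausdorff_outer s (G i) \<le> hausdorff_outer s A" for i
  proof -
    have "hausdorff_outer s (A \<inter> F) + hausdorff_outer s (G i) \<le> hausdorff_outer s ((A \<inter> F) \<union> G i)"
    proof (rule hausdorff_outer_separated[of "1 / real (Suc i)"])
      fix x y assume "x \<in> A \<inter> F" "y \<in> G i"
      then show "1 / real (Suc i) \<le> dist x y"
        using infdist_le[of x F y] by (auto simp: G_def dist_commute)
    qed simp
    also have "\<dots> \<le> hausdorff_outer s A" by (intro hausdorff_outer_mono) (auto simp: G_def)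
    finally show ?thesis .
  qed
  have sepSh: "1 / real (Suc (Suc i)) - 1 / real (Suc j) \<le> dist x y"
    if "x \<in> Sh i" "y \<in> Sh j" for i j x y
  proof -
    have "infdist x F \<le> infdist y F + dist x y" by (rule infdist_triangle)
    then show ?thesis using that by (auto simp: Sh_def)
  qed
  have parity: "(\<Sum>i<m. hausdorff_outer s (Sh (2 * i + c))) \<le> hausdorff_outer s (\<Union>i<m. Sh (2 * i + c))" for m c
  proof (induction m)
    case 0 then show ?case by simp
  next
    case (Suc m)
    show ?case
    proof (cases "m = 0")
      case True
      then show ?thesis by (simp add: lessThan_Suc)
    next
      case False
      have "(\<Sum>i<Suc m. hausdorff_outer s (Sh (2 * i + c)))
          \<le> hausdorff_outer s (\<Union>i<m. Sh (2 * i + c)) + hausdorff_outer s (Sh (2 * m + c))"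
        using Suc.IH by (simp add: add_mono)
      \<comment> \<open>The earlier shells keep distance at least 1/(2m+c) from \<open>F\<close>,
        the new one is closer than 1/(2m+c+1). The case m = 0 was split off because 2m+c may then be
        zero.\<close>
      also have "\<dots> \<le> hausdorff_outer s ((\<Union>i<m. Sh (2 * i + c)) \<union> Sh (2 * m + c))"
      proof (rule hausdorff_outer_separated[of "1 / real (2 * m + c) - 1 / real (Suc (2 * m + c))"])
        fix x y assume x: "x \<in> (\<Union>i<m. Sh (2 * i + c))" and y: "y \<in> Sh (2 * m + c)"
        then obtain i where i: "i < m" "x \<in> Sh (2 * i + c)" by auto
        have "1 / real (2 * m + c) \<le> 1 / real (Suc (Suc (2 * i + c)))"
          using i(1) by (intro divide_left_mono) auto
        with sepSh[OF i(2) y] show "1 / real (2 * m + c) - 1 / real (Suc (2 * m + c)) \<le> dist x y" by linarith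
      next
        show "0 < 1 / real (2 * m + c) - 1 / real (Suc (2 * m + c))"
          using False by (simp only: diff_gt_0_iff_gt, intro divide_strict_left_mono) auto
      qed
      finally show ?thesis by (simp add: lessThan_Suc Un_commute)
    qed
  qed
  have tail: "hausdorff_outer s (A - F) \<le> hausdorff_outer s (G m) + (\<Sum>i. hausdorff_outer s (Sh (i + m)))" for m
  proof -
    have "A - F \<subseteq> G m \<union> (\<Union>i. Sh (i + m))"
    proof
      fix x assume x: "x \<in> A - F"
      then have pos: "infdist x F > 0"
        using in_closed_iff_infdist_zero[OF F Fne] infdist_nonneg[of x F] by (metis DiffD2 less_eq_real_def)
      show "x \<in> G m \<union> (\<Union>i. Sh (i + m))"
      proof (cases "1 / real (Suc m) \<le> infdist x F")
        case True then show ?thesis using x by (simp add: G_def)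
      next
        case False
        obtain j where j: "1 / real (Suc j) < infdist x F"
          using nat_approx_posE[OF pos] by blast
        \<comment> \<open>The shell containing x has index \<open>l - 1\<close>: the bound fails at
          \<open>l - 1\<close> and holds at \<open>l\<close>.\<close>
        define l where "l = (LEAST j. 1 / real (Suc j) \<le> infdist x F)"
        have l: "1 / real (Suc l) \<le> infdist x F" unfolding l_def
          using j by (intro LeastI[of "\<lambda>j. 1 / real (Suc j) \<le> infdist x F" j]) simp
        have lm: "l > m"
        proof (rule ccontr)
          assume "\<not> l > m"
          then have "1 / real (Suc m) \<le> 1 / real (Suc l)" by (intro divide_left_mono) auto
          with l False show False by simp
        qed
        have "\<not> 1 / real (Suc (l - 1)) \<le> infdist x F"
          unfolding l_def by (rule not_less_Least) (use lm in \<open>simp add: l_def\<close>)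
        then have "x \<in> Sh (l - 1)" using l lm x by (simp add: Sh_def)
        moreover have "l - 1 = (l - 1 - m) + m" using lm by simp
        ultimately show ?thesis by (metis UN_I UNIV_I UnCI)
      qed
    qed
    then have "hausdorff_outer s (A - F) \<le> hausdorff_outer s (G m \<union> (\<Union>i. Sh (i + m)))"
      by (rule hausdorff_outer_mono)
    also have "\<dots> \<le> hausdorff_outer s (G m) + hausdorff_outer s (\<Union>i. Sh (i + m))"
      by (rule hausdorff_outer_Un)
    also have "\<dots> \<le> hausdorff_outer s (G m) + (\<Sum>i. hausdorff_outer s (Sh (i + m)))"
      by (intro add_left_mono hausdorff_outer_countably_subadditive)
    finally show ?thesis .
  qed
  have le2: "(\<Sum>i<m. hausdorff_outer s (Sh i)) \<le> 2 * hausdorff_outer s A" for m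
  proof -
    have "(\<Sum>i<m. hausdorff_outer s (Sh i)) \<le> (\<Sum>i<2*m. hausdorff_outer s (Sh i))"
      by (intro sum_mono2) auto
    also have "\<dots> = (\<Sum>i<m. hausdorff_outer s (Sh (2 * i + 0))) + (\<Sum>i<m. hausdorff_outer s (Sh (2 * i + 1)))"
      by (induction m) (simp_all add: algebra_simps)
    also have "\<dots> \<le> hausdorff_outer s A + hausdorff_outer s A"
      by (intro add_mono order_trans[OF parity] hausdorff_outer_mono) (auto simp: Sh_def)
    finally show ?thesis by (simp add: mult_2)
  qed
  have sumfin: "(\<Sum>i. hausdorff_outer s (Sh i)) < top"
  proof -
    have "(\<Sum>i. hausdorff_outer s (Sh i)) \<le> 2 * hausdorff_outer s A"
      unfolding suminf_eq_SUP by (intro SUP_least le2)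
    also have "\<dots> < top" using fin by (simp add: ennreal_mult_less_top)
    finally show ?thesis .
  qed
  have lim: "(\<lambda>m. \<Sum>i. hausdorff_outer s (Sh (i + m))) \<longlonglongrightarrow> 0"
  proof -
    define a where "a = (\<lambda>i. enn2real (hausdorff_outer s (Sh i)))"
    have ai: "hausdorff_outer s (Sh i) = ennreal (a i)" for i
    proof -
      have "hausdorff_outer s (Sh i) \<noteq> top"
        using ennreal_suminf_lessD[OF sumfin, of i] by simp
      then show ?thesis by (simp add: a_def less_top)
    qed
    have a0: "0 \<le> a i" for i by (simp add: a_def)
    have sm: "summable a"
      using sumfin by (intro summable_suminf_not_top) (auto simp: a0 ai)
    have "(\<lambda>m. \<Sum>i. a (i + m)) \<longlonglongrightarrow> 0"
      using suminf_exist_split2[OF sm] .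
    then have "(\<lambda>m. ennreal (\<Sum>i. a (i + m))) \<longlonglongrightarrow> ennreal 0" by (rule tendsto_ennrealI)
    moreover have "(\<Sum>i. hausdorff_outer s (Sh (i + m))) = ennreal (\<Sum>i. a (i + m))" for m
      unfolding ai using sm a0 by (intro suminf_ennreal2) (auto simp: summable_iff_shift)
    ultimately show ?thesis by simp
  qed
  have "hausdorff_outer s (A \<inter> F) + hausdorff_outer s (A - F)
      \<le> hausdorff_outer s A + (\<Sum>i. hausdorff_outer s (Sh (i + m)))" for m
  proof -
    have "hausdorff_outer s (A \<inter> F) + hausdorff_outer s (A - F)
        \<le> hausdorff_outer s (A \<inter> F) + (hausdorff_outer s (G m) + (\<Sum>i. hausdorff_outer s (Sh (i + m))))"
      by (intro add_left_mono tail)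
    also have "\<dots> \<le> hausdorff_outer s A + (\<Sum>i. hausdorff_outer s (Sh (i + m)))"
      unfolding add.assoc[symmetric] by (intro add_right_mono sepG)
    finally show ?thesis .
  qed
  moreover have "(\<lambda>m. hausdorff_outer s A + (\<Sum>i. hausdorff_outer s (Sh (i + m)))) \<longlonglongrightarrow> hausdorff_outer s A + 0"
    by (intro tendsto_add tendsto_const lim)
  ultimately show ?thesis
    by (intro LIMSEQ_le_const[where X="\<lambda>m. hausdorff_outer s A + (\<Sum>i. hausdorff_outer s (Sh (i + m)))"]) auto
qed

text \<open>\<open>measure_of\<close> silently yields the zero measure unless its set function is
  countably additive, so this has to be known before \<open>surface_measure\<close> says anything.
  Caratheodory's theorem runs on all subsets of S; the measurable ones form a sigma algebra
  containing the traces of closed sets, hence of Borel sets.\<close>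

lemma hausdorff_measure_space:
  fixes S :: "'a::metric_space set"
  shows "measure_space S (sets (restrict_space borel S)) (hausdorff_outer s)"
proof -
  let ?L = "lambda_system S (Pow S) (hausdorff_outer s)"
  interpret P: sigma_algebra S "Pow S" by (rule sigma_algebra_Pow)
  have oms: "outer_measure_space (Pow S) (hausdorff_outer s)"
    unfolding outer_measure_space_def positive_def increasing_def countably_subadditive_def
    by (auto simp: hausdorff_outer_empty intro: hausdorff_outer_mono hausdorff_outer_countably_subadditive)
  have ms: "measure_space S ?L (hausdorff_outer s)"
    by (rule P.caratheodory_lemma[OF oms])
  then interpret L: sigma_algebra S ?L by (simp add: measure_space_def)
  have closed_in: "S \<inter> F \<in> ?L" if "closed F" for F
  proof -
    have "hausdorff_outer s (A \<inter> (S \<inter> F)) + hausdorff_outer s (A - (S \<inter> F)) = hausdorff_outer s A"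
      if A: "A \<subseteq> S" for A
    proof (rule antisym)
      have "A \<inter> (S \<inter> F) = A \<inter> F" "A - (S \<inter> F) = A - F" using A by auto
      then show "hausdorff_outer s (A \<inter> (S \<inter> F)) + hausdorff_outer s (A - (S \<inter> F)) \<le> hausdorff_outer s A"
        using hausdorff_outer_caratheodory_closed[OF \<open>closed F\<close>] by simp
      show "hausdorff_outer s A \<le> hausdorff_outer s (A \<inter> (S \<inter> F)) + hausdorff_outer s (A - (S \<inter> F))"
        using hausdorff_outer_Un[of s "A \<inter> (S \<inter> F)" "A - (S \<inter> F)"] by (simp add: Int_Diff_Un)
    qed
    then show ?thesis unfolding P.lambda_system_eq by auto
  qed
  have "S \<inter> B \<in> ?L" if "B \<in> sets borel" for B
  proof -
    have "B \<in> sigma_sets UNIV {F::'a set. closed F}"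
      using that by (simp add: borel_eq_closed)
    then show ?thesis
    proof (induction B rule: sigma_sets.induct)
      case (Basic a) then show ?case using closed_in by simp
    next
      case Empty then show ?case using L.empty_sets by simp
    next
      case (Compl a)
      have "S \<inter> (UNIV - a) = S - (S \<inter> a)" by auto
      then show ?case using L.compl_sets[OF Compl.IH] by simp
    next
      case (Union a)
      have "S \<inter> (\<Union>i. a i) = (\<Union>i. S \<inter> a i)" by auto
      then show ?case using L.countable_UN[of "\<lambda>i. S \<inter> a i" UNIV] Union.IH by auto
    qed
  qed
  then have sub: "sets (restrict_space borel S) \<subseteq> ?L"
    by (auto simp: sets_restrict_space)
  have sa: "sigma_algebra S (sets (restrict_space borel S))"
    using sets.sigma_algebra_axioms[of "restrict_space borel S"] by (simp add: space_restrict_space)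
  have "countably_additive (sets (restrict_space borel S)) (hausdorff_outer s)"
    using ms sub unfolding measure_space_def countably_additive_def by blast
  then show ?thesis
    unfolding measure_space_def positive_def using sa by (simp add: hausdorff_outer_empty)
qed

section \<open>Surface measure in terms of Hausdorff measure\<close>

lemma sets_surface_measure: "sets (surface_measure S) = sets (restrict_space borel S)"
proof -
  have "sigma_sets S (sets (restrict_space borel S)) = sets (restrict_space borel S)"
    using sets.sigma_sets_eq[of "restrict_space borel S"] by (simp add: space_restrict_space)
  moreover have "sets (restrict_space borel S) \<subseteq> Pow S"
    using sets.space_closed[of "restrict_space borel S"] by (simp add: space_restrict_space)
  ultimately show ?thesis unfolding surface_measure_def by (simp add: sets_measure_of)
qed

lemma space_surface_measure: "space (surface_measure S) = S"
  using sets_eq_imp_space_eq[OF sets_surface_measure, of S] by (simp add: space_restrict_space)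

lemma emeasure_surface_measure:
  fixes S :: "'a::euclidean_space set"
  assumes "A \<in> sets (restrict_space borel S)"
  shows "emeasure (surface_measure S) A = hausdorff_outer (real (DIM('a) - 1)) A"
  unfolding surface_measure_def
proof (rule emeasure_measure_of_sigma)
  show "sigma_algebra S (sets (restrict_space borel S))"
    "positive (sets (restrict_space borel S)) (hausdorff_outer (real (DIM('a) - 1)))"
    "countably_additive (sets (restrict_space borel S)) (hausdorff_outer (real (DIM('a) - 1)))"
    using hausdorff_measure_space[of S "real (DIM('a) - 1)"] by (auto simp: measure_space_def)
qed (fact assms)

section \<open>Upper and lower bounds for Hausdorff measure\<close>

lemma powr_of_nat_eq_power:
  fixes x :: real
  assumes "0 \<le> x" "0 < n"
  shows "x powr real n = x ^ n"
  using assms by (cases "x = 0") (auto simp: powr_realpow zero_power)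

lemma emeasure_lborel_axis_box:
  fixes p e :: "'a::euclidean_space"
  assumes e: "e \<in> Basis" and "0 \<le> h" "0 \<le> r"
  defines "w \<equiv> (\<Sum>b\<in>Basis. (if b = e then r else h) *\<^sub>R b)"
  shows "emeasure lborel (cbox (p - w) (p + w)) = ennreal ((2 * h) ^ (DIM('a) - 1) * (2 * r))"
proof -
  have w: "w \<bullet> b = (if b = e then r else h)" if "b \<in> Basis" for b
    using that by (simp add: w_def inner_sum_left_Basis)
  have "emeasure lborel (cbox (p - w) (p + w)) = ennreal (\<Prod>b\<in>Basis. ((p + w) - (p - w)) \<bullet> b)"
    using assms by (intro emeasure_lborel_cbox) (auto simp: inner_diff_left inner_add_left w)
  also have "(\<Prod>b\<in>Basis. ((p + w) - (p - w)) \<bullet> b) = (\<Prod>b\<in>Basis. if b = e then 2 * r else 2 * h)"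
    by (intro prod.cong) (auto simp: inner_diff_left inner_add_left w)
  also have "\<dots> = (2 * h) ^ (DIM('a) - 1) * (2 * r)"
    using e by (simp add: prod.remove[of _ e] card_Diff_singleton)
  finally show ?thesis .
qed

text \<open>Thickening a cover of the graph in direction e turns it into a cover of a box of full
  dimension, whose volume is known.\<close>

lemma hausdorff_outer_graph_ge:
  fixes Y :: "'a::euclidean_space set" and p e :: 'a
  assumes e: "e \<in> Basis" and h: "0 \<le> h" and dim: "2 \<le> DIM('a)"
    and graph: "\<And>z. (\<And>b. b \<in> Basis - {e} \<Longrightarrow> \<bar>(z - p) \<bullet> b\<bar> \<le> h) \<Longrightarrow>
      \<exists>y\<in>Y. \<forall>b\<in>Basis - {e}. y \<bullet> b = z \<bullet> b"
  shows "ennreal (unit_ball_vol (real (DIM('a) - 1)) * (h / 2) ^ (DIM('a) - 1))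
    \<le> hausdorff_outer (real (DIM('a) - 1)) Y"
proof -
  let ?n = "DIM('a) - 1" and ?u = "unit_ball_vol (real (DIM('a) - 1))"
  have u0: "0 \<le> ?u" by simp
  define w where "w = (\<lambda>d. \<Sum>b\<in>Basis. (if b = e then (1/2::real) else d) *\<^sub>R (b::'a))"
  have w: "w d \<bullet> b = (if b = e then 1/2 else d)" if "b \<in> Basis" for b d
    using that by (simp add: w_def inner_sum_left_Basis)
  \<comment> \<open>Converts the Hausdorff weight of a set of diameter d into the volume of a box of
    side 2d and height 1.\<close>
  have quarter: "?u * (d / 2) ^ ?n = ?u / 4 ^ ?n * (2 * d) ^ ?n" for d :: real
  proof -
    have "(2 * d) ^ ?n = (4 * (d / 2)) ^ ?n" by simp
    also have "\<dots> = 4 ^ ?n * (d / 2) ^ ?n" by (rule power_mult_distrib)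
    finally show ?thesis by simp
  qed
  have "ennreal (?u * (h / 2) ^ ?n) \<le> hausdorff_approx (real ?n) 1 Y"
    unfolding hausdorff_approx_def
  proof (rule INF_greatest)
    fix C :: "nat \<Rightarrow> 'a set"
    assume "C \<in> {C. Y \<subseteq> (\<Union>i. C i) \<and> (\<forall>i. bounded (C i) \<and> diameter (C i) \<le> 1)}"
    then have C: "Y \<subseteq> (\<Union>i. C i)" "\<And>i. bounded (C i)" by auto
    define y where "y = (\<lambda>i. SOME y. y \<in> C i)"
    \<comment> \<open>Only the shadow of \<open>C i\<close> along e matters. Its box has half side
      \<open>diameter (C i)\<close> around the shadow of a sample point and is placed at the height
      of p, with half side 1/2 in direction e.\<close>
    define c where "c = (\<lambda>i. \<Sum>b\<in>Basis. (if b = e then p \<bullet> e else y i \<bullet> b) *\<^sub>R b)"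
    have c: "c i \<bullet> b = (if b = e then p \<bullet> e else y i \<bullet> b)" if "b \<in> Basis" for b i
      using that by (simp add: c_def inner_sum_left_Basis)
    have d0: "0 \<le> diameter (C i)" for i by (intro diameter_ge_0 C)
    have sub: "cbox (p - w h) (p + w h) \<subseteq> (\<Union>i. cbox (c i - w (diameter (C i))) (c i + w (diameter (C i))))"
    proof
      fix z assume z: "z \<in> cbox (p - w h) (p + w h)"
      have zb: "\<bar>(z - p) \<bullet> b\<bar> \<le> (if b = e then 1/2 else h)" if "b \<in> Basis" for b
        using z that by (force simp: mem_box inner_diff_left inner_add_left w abs_le_iff)
      obtain y' where y': "y' \<in> Y" "\<And>b. b \<in> Basis - {e} \<Longrightarrow> y' \<bullet> b = z \<bullet> b"
      proof -
        have "\<bar>(z - p) \<bullet> b\<bar> \<le> h" if "b \<in> Basis - {e}" for b using zb[of b] that by auto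
        then show ?thesis using graph[of z] that by blast
      qed
      obtain i where i: "y' \<in> C i" using y' C by blast
      have yi: "y i \<in> C i" unfolding y_def using i by (rule someI)
      have "z \<in> cbox (c i - w (diameter (C i))) (c i + w (diameter (C i)))"
        unfolding mem_box
      proof
        fix b :: 'a assume b: "b \<in> Basis"
        have "\<bar>(z - c i) \<bullet> b\<bar> \<le> w (diameter (C i)) \<bullet> b"
        proof (cases "b = e")
          case True
          then show ?thesis using zb[OF b] b by (simp add: inner_diff_left c w)
        next
          case False
          have "\<bar>(y' - y i) \<bullet> b\<bar> \<le> norm (y' - y i)" by (rule Basis_le_norm[OF b])
          also have "\<dots> \<le> diameter (C i)"
            using diameter_bounded_bound[OF C(2) i yi] by (simp add: dist_norm)
          finally have "\<bar>z \<bullet> b - y i \<bullet> b\<bar> \<le> diameter (C i)" using False b y'(2) by (simp add: inner_diff_left)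
          then show ?thesis using False b by (simp add: inner_diff_left c w)
        qed
        then show "(c i - w (diameter (C i))) \<bullet> b \<le> z \<bullet> b \<and> z \<bullet> b \<le> (c i + w (diameter (C i))) \<bullet> b"
          by (simp add: inner_diff_left inner_add_left abs_le_iff)
      qed
      then show "z \<in> (\<Union>i. cbox (c i - w (diameter (C i))) (c i + w (diameter (C i))))" by blast
    qed
    have vol: "emeasure lborel (cbox (q - w d) (q + w d)) = ennreal ((2 * d) ^ ?n)" if "0 \<le> d" for q :: 'a and d
      using emeasure_lborel_axis_box[OF e that, of "1/2" q] by (simp add: w_def)
    have "ennreal ((2 * h) ^ ?n) \<le> emeasure lborel (\<Union>i. cbox (c i - w (diameter (C i))) (c i + w (diameter (C i))))"
      unfolding vol[OF h, of p, symmetric] by (intro emeasure_mono sub) auto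
    also have "\<dots> \<le> (\<Sum>i. emeasure lborel (cbox (c i - w (diameter (C i))) (c i + w (diameter (C i)))))"
      by (intro emeasure_subadditive_countably) auto
    also have "\<dots> = (\<Sum>i. ennreal ((2 * diameter (C i)) ^ ?n))" by (simp add: vol d0)
    finally have key: "ennreal ((2 * h) ^ ?n) \<le> (\<Sum>i. ennreal ((2 * diameter (C i)) ^ ?n))" .
    have "ennreal (?u * (h / 2) ^ ?n) = ennreal (?u / 4 ^ ?n) * ennreal ((2 * h) ^ ?n)"
      using h u0 quarter[of h] by (subst ennreal_mult[symmetric]) auto
    also have "\<dots> \<le> ennreal (?u / 4 ^ ?n) * (\<Sum>i. ennreal ((2 * diameter (C i)) ^ ?n))"
      by (intro mult_left_mono key) auto
    also have "\<dots> = (\<Sum>i. ennreal (?u / 4 ^ ?n) * ennreal ((2 * diameter (C i)) ^ ?n))"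
      by simp
    also have "\<dots> = (\<Sum>i. ennreal (?u * (diameter (C i) / 2) powr real ?n))"
    proof (intro suminf_cong)
      fix i
      have "ennreal (?u / 4 ^ ?n) * ennreal ((2 * diameter (C i)) ^ ?n) = ennreal (?u * (diameter (C i) / 2) ^ ?n)"
        using d0[of i] u0 quarter[of "diameter (C i)"] by (subst ennreal_mult[symmetric]) auto
      also have "(diameter (C i) / 2) ^ ?n = (diameter (C i) / 2) powr real ?n"
        using d0[of i] dim by (intro powr_of_nat_eq_power[symmetric]) auto
      finally show "ennreal (?u / 4 ^ ?n) * ennreal ((2 * diameter (C i)) ^ ?n)
          = ennreal (?u * (diameter (C i) / 2) powr real ?n)" .
    qed
    finally show "ennreal (?u * (h / 2) ^ ?n) \<le> (\<Sum>i. ennreal (?u * (diameter (C i) / 2) powr real ?n))" .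
  qed
  also have "\<dots> \<le> hausdorff_outer (real ?n) Y" by (rule hausdorff_approx_le_outer) simp
  finally show ?thesis .
qed

section \<open>Finite surface measure of convex boundaries\<close>

lemma hausdorff_approx_le_finite:
  fixes A :: "'a::metric_space set" and C :: "'i \<Rightarrow> 'a set"
  assumes I: "finite I" and A: "A \<subseteq> (\<Union>i\<in>I. C i)" and d: "\<And>i. i \<in> I \<Longrightarrow> bounded (C i)"
    "\<And>i. i \<in> I \<Longrightarrow> diameter (C i) \<le> d" and d0: "0 \<le> d" "d \<le> \<delta>" and s: "0 \<le> s"
  shows "hausdorff_approx s \<delta> A \<le> ennreal (real (card I) * (unit_ball_vol s * (d / 2) powr s))"
proof -
  obtain f where f: "bij_betw f {..<card I} I"
    using ex_bij_betw_nat_finite[OF I] by (auto simp: atLeast0LessThan)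
  \<comment> \<open>Padding with empty sets costs nothing: their diameter is 0, and
    \<open>0 powr s = 0\<close> even for s = 0.\<close>
  define D where "D = (\<lambda>j. if j < card I then C (f j) else {})"
  have fI: "f j \<in> I" if "j < card I" for j using f that by (auto simp: bij_betw_def)
  have "hausdorff_approx s \<delta> A \<le> (\<Sum>j. ennreal (unit_ball_vol s * (diameter (D j) / 2) powr s))"
  proof (rule hausdorff_approx_le)
    show "A \<subseteq> (\<Union>j. D j)"
    proof
      fix x assume "x \<in> A"
      then obtain i where i: "i \<in> I" "x \<in> C i" using A by blast
      then have "i \<in> f ` {..<card I}" by (simp only: bij_betw_imp_surj_on[OF f])
      then obtain j where "j < card I" "f j = i" by auto
      then have "x \<in> D j" using i by (simp add: D_def)
      then show "x \<in> (\<Union>j. D j)" by blast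
    qed
    show "bounded (D j)" "diameter (D j) \<le> \<delta>" for j
      using d fI d0 by (auto simp: D_def intro: order_trans)
  qed
  also have "\<dots> = (\<Sum>j<card I. ennreal (unit_ball_vol s * (diameter (D j) / 2) powr s))"
    by (rule suminf_finite) (auto simp: D_def)
  also have "\<dots> \<le> (\<Sum>j<card I. ennreal (unit_ball_vol s * (d / 2) powr s))"
    using d fI s by (intro sum_mono ennreal_leI mult_left_mono powr_mono2 divide_right_mono)
      (auto simp: D_def diameter_ge_0)
  also have "\<dots> = ennreal (real (card I) * (unit_ball_vol s * (d / 2) powr s))"
    using s by (simp add: ennreal_of_nat_eq_real_of_nat ennreal_mult')
  finally show ?thesis .
qed

text \<open>The whole outward ray at a boundary point projects back to that point. This is what
  makes the projection from a surrounding cube surjective onto the surface.\<close>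

lemma closest_point_outer_normal:
  fixes y g :: "'a::euclidean_space"
  assumes K: "convex K" "closed K" "y \<in> K" and g: "\<And>z. z \<in> K \<Longrightarrow> g \<bullet> (z - y) \<le> 0" and t: "0 \<le> t"
  shows "closest_point K (y + t *\<^sub>R g) = y"
proof -
  have "dist (y + t *\<^sub>R g) y \<le> dist (y + t *\<^sub>R g) z" if z: "z \<in> K" for z
  proof -
    have "(norm (t *\<^sub>R g))\<^sup>2 \<le> (norm (t *\<^sub>R g))\<^sup>2 - 2 * (t * (g \<bullet> (z - y))) + (norm (y - z))\<^sup>2"
      using mult_nonneg_nonpos[OF t g[OF z]] zero_le_power2[of "norm (y - z)"] by linarith
    also have "\<dots> = (norm (y + t *\<^sub>R g - z))\<^sup>2"
      unfolding power2_norm_eq_inner by (simp add: inner_simps algebra_simps inner_commute)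
    finally have "norm (t *\<^sub>R g) \<le> norm (y + t *\<^sub>R g - z)" by (rule power2_le_imp_le) simp
    then show ?thesis by (simp add: dist_norm)
  qed
  then show ?thesis using closest_point_unique[OF K, of "y + t *\<^sub>R g"] by auto
qed

text \<open>The nearest point projection is a contraction from the boundary of a cube onto S.\<close>

lemma hausdorff_outer_convex_boundary_finite:
  fixes K S :: "'a::euclidean_space set"
  assumes K: "convex K" "compact K" and SK: "S \<subseteq> K"
    and normal: "\<And>y. y \<in> S \<Longrightarrow> \<exists>g. g \<noteq> 0 \<and> (\<forall>z\<in>K. g \<bullet> (z - y) \<le> 0)"
  shows "hausdorff_outer (real (DIM('a) - 1)) S < top"
proof (cases "K = {}")
  case True then show ?thesis using SK by (simp add: hausdorff_outer_empty)
next
  case False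
  let ?n = "DIM('a) - 1"
  obtain a where a: "0 < a" "\<And>x. x \<in> K \<Longrightarrow> norm x < a"
    using compact_imp_bounded[OF K(2)] unfolding bounded_pos_less by blast
  define Q where "Q = cbox (- a *\<^sub>R One) (a *\<^sub>R One :: 'a)"
  have KQ: "K \<subseteq> Q"
  proof
    fix x assume x: "x \<in> K"
    have "- a \<le> x \<bullet> b \<and> x \<bullet> b \<le> a" if "b \<in> Basis" for b
      using Basis_le_norm[OF that, of x] a(2)[OF x] by linarith
    then show "x \<in> Q" by (simp add: Q_def mem_box)
  qed
  have closedK: "closed K" using K by (simp add: compact_imp_closed)
  have bound: "hausdorff_approx (real ?n) \<delta> S
      \<le> ennreal (2 * real DIM('a) * (unit_ball_vol (real ?n) * (a * real DIM('a)) powr real ?n))"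
    if \<delta>: "\<delta> > 0" for \<delta>
  proof -
    obtain N :: nat where N2: "2 * a * real DIM('a) / \<delta> < real N" using reals_Archimedean2 by blast
    have "0 < 2 * a * real DIM('a) / \<delta>" using a(1) \<delta> by simp
    with N2 have N: "0 < N" "2 * a * real DIM('a) / \<delta> \<le> real N"
      by (simp_all del: of_nat_0_less_iff add: of_nat_0_less_iff[symmetric, where 'a=real])
    have dN: "2 * a * real DIM('a) / real N \<le> \<delta>"
      using N \<delta> by (simp add: field_simps)
    \<comment> \<open>A face of the cube is given by its normal b and the value s of that
      coordinate, a cell of the face by one index below N for every other coordinate.\<close>
    define I where "I = (SIGMA bs : (Basis :: 'a set) \<times> {a, -a}. PiE (Basis - {fst bs}) (\<lambda>_. {..<N}))"
    define F where "F = (\<lambda>((b, s), j). {x::'a. x \<bullet> b = s \<and>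
      (\<forall>c\<in>Basis - {b}. - a + 2 * a * real (j c) / real N \<le> x \<bullet> c \<and> x \<bullet> c \<le> - a + 2 * a * (real (j c) + 1) / real N)})"
    have finI: "finite I" unfolding I_def by (intro finite_SigmaI finite_PiE) auto
    have cardI: "card I = 2 * DIM('a) * N ^ ?n"
    proof -
      have "card I = (\<Sum>bs\<in>(Basis :: 'a set) \<times> {a, -a}. card (PiE (Basis - {fst bs}) (\<lambda>_. {..<N})))"
        unfolding I_def by (intro card_SigmaI) (auto intro: finite_PiE)
      also have "\<dots> = (\<Sum>bs\<in>(Basis :: 'a set) \<times> {a, -a}. N ^ ?n)"
        by (intro sum.cong) (auto simp: card_PiE card_Diff_singleton)
      also have "\<dots> = 2 * DIM('a) * N ^ ?n" using a(1) by (simp add: card_cartesian_product)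
      finally show ?thesis .
    qed
    have diamF: "norm (x - y) \<le> 2 * a * real DIM('a) / real N" if i: "i \<in> I" and xy: "x \<in> F i" "y \<in> F i" for i x y
    proof -
      obtain b s j where ij: "i = ((b, s), j)" by (metis surj_pair)
      have "\<bar>(x - y) \<bullet> c\<bar> \<le> 2 * a / real N" if c: "c \<in> Basis" for c
      proof (cases "c = b")
        case True
        then show ?thesis using xy ij a(1) by (simp add: F_def inner_diff_left)
      next
        case False
        then have "- a + 2 * a * real (j c) / real N \<le> x \<bullet> c" "x \<bullet> c \<le> - a + 2 * a * (real (j c) + 1) / real N"
          "- a + 2 * a * real (j c) / real N \<le> y \<bullet> c" "y \<bullet> c \<le> - a + 2 * a * (real (j c) + 1) / real N"
          using xy ij c by (auto simp: F_def)
        moreover have "2 * a * (real (j c) + 1) / real N = 2 * a * real (j c) / real N + 2 * a / real N"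
          by (simp add: distrib_left add_divide_distrib)
        ultimately show ?thesis by (simp add: inner_diff_left abs_le_iff)
      qed
      then have "(\<Sum>c\<in>Basis. \<bar>(x - y) \<bullet> c\<bar>) \<le> real DIM('a) * (2 * a / real N)"
        by (intro sum_bounded_above) auto
      then show ?thesis using norm_le_l1[of "x - y"] by (simp add: mult.commute)
    qed
    define C where "C = (\<lambda>i. closest_point K ` F i)"
    have distC: "norm (x - y) \<le> 2 * a * real DIM('a) / real N" if "i \<in> I" "x \<in> C i" "y \<in> C i" for i x y
    proof -
      obtain x' y' where *: "x' \<in> F i" "y' \<in> F i" "x = closest_point K x'" "y = closest_point K y'"
        using \<open>x \<in> C i\<close> \<open>y \<in> C i\<close> by (auto simp: C_def)
      have "dist x y \<le> dist x' y'"
        unfolding * by (rule closest_point_lipschitz[OF K(1) closedK False])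
      then show ?thesis using diamF[OF that(1) *(1,2)] by (simp add: dist_norm)
    qed
    have "hausdorff_approx (real ?n) \<delta> S \<le>
        ennreal (real (card I) * (unit_ball_vol (real ?n) * ((2 * a * real DIM('a) / real N) / 2) powr real ?n))"
    proof (rule hausdorff_approx_le_finite[OF finI, where C = C])
      show "S \<subseteq> (\<Union>i\<in>I. C i)"
      proof
        fix y assume y: "y \<in> S"
        then obtain g where g: "g \<noteq> 0" "\<And>z. z \<in> K \<Longrightarrow> g \<bullet> (z - y) \<le> 0" using normal by blast
        have yK: "y \<in> K" using y SK by blast
        obtain b0 where b0: "b0 \<in> Basis" "g \<bullet> b0 \<noteq> 0"
          using g(1) by (meson euclidean_all_zero_iff)
        \<comment> \<open>Moves coordinate b0 by 3a, more than the side 2a of the cube, so the ray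
          leaves the cube and crosses its boundary.\<close>
        define T where "T = 3 * a / \<bar>g \<bullet> b0\<bar>"
        have out: "y + T *\<^sub>R g \<notin> Q"
        proof
          assume "y + T *\<^sub>R g \<in> Q"
          then have "- a \<le> y \<bullet> b0 + T * (g \<bullet> b0) \<and> y \<bullet> b0 + T * (g \<bullet> b0) \<le> a"
            using b0(1) by (simp add: Q_def mem_box inner_add_left)
          moreover have "\<bar>T * (g \<bullet> b0)\<bar> = 3 * a" using b0 a(1) by (simp add: T_def abs_mult)
          moreover have "\<bar>y \<bullet> b0\<bar> \<le> a" using Basis_le_norm[OF b0(1), of y] a(2)[OF yK] by simp
          ultimately show False using a(1) by linarith
        qed
        have "closed_segment y (y + T *\<^sub>R g) \<inter> frontier Q \<noteq> {}"
        proof (rule connected_Int_frontier)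
          show "closed_segment y (y + T *\<^sub>R g) \<inter> Q \<noteq> {}" using yK KQ by auto
          show "closed_segment y (y + T *\<^sub>R g) - Q \<noteq> {}" using out by auto
        qed simp
        then obtain x where x: "x \<in> closed_segment y (y + T *\<^sub>R g)" "x \<in> frontier Q" by blast
        then obtain v where v: "0 \<le> v" "v \<le> 1" "x = (1 - v) *\<^sub>R y + v *\<^sub>R (y + T *\<^sub>R g)"
          by (auto simp: in_segment)
        have xg: "x = y + (v * T) *\<^sub>R g" unfolding v(3) by (simp add: algebra_simps)
        have "0 \<le> v * T" using v(1) a(1) by (simp add: T_def)
        then have cp: "closest_point K x = y"
          unfolding xg by (intro closest_point_outer_normal K(1) closedK yK g(2))
        have xQ: "x \<in> cbox (- a *\<^sub>R One) (a *\<^sub>R One)" "x \<notin> box (- a *\<^sub>R One) (a *\<^sub>R One)"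
          using x(2) by (auto simp: Q_def frontier_cbox)
        have xr: "- a \<le> x \<bullet> c" "x \<bullet> c \<le> a" if "c \<in> Basis" for c
          using xQ(1) that by (auto simp: mem_box)
        from xQ(2) obtain b where b: "b \<in> Basis" "\<not> (- a < x \<bullet> b \<and> x \<bullet> b < a)"
          by (auto simp: mem_box)
        then have xb: "x \<bullet> b \<in> {a, -a}" using xr[OF b(1)] by auto
        \<comment> \<open>The far face of the cube is assigned to the last cell, since the floor
          would give the index N there.\<close>
        define j where "j = (\<lambda>c\<in>Basis - {b}. if x \<bullet> c = a then N - 1 else nat \<lfloor>(x \<bullet> c + a) * real N / (2 * a)\<rfloor>)"
        have jc: "j c < N \<and> - a + 2 * a * real (j c) / real N \<le> x \<bullet> c \<and> x \<bullet> c \<le> - a + 2 * a * (real (j c) + 1) / real N"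
          if c: "c \<in> Basis - {b}" for c
        proof (cases "x \<bullet> c = a")
          case True
          then have "j c = N - 1" using c by (simp add: j_def)
          moreover have "real (N - 1) = real N - 1" using N by simp
          ultimately show ?thesis using True N a(1) by (simp add: field_simps)
        next
          case False
          define \<theta> where "\<theta> = (x \<bullet> c + a) * real N / (2 * a)"
          have th0: "0 \<le> \<theta>" using xr[of c] c a(1) by (simp add: \<theta>_def)
          have "x \<bullet> c < a" using False xr[of c] c by auto
          then have "(x \<bullet> c + a) * real N < 2 * a * real N" using N by simp
          then have thN: "\<theta> < real N" using a(1) by (simp add: \<theta>_def field_simps)
          have jt: "j c = nat \<lfloor>\<theta>\<rfloor>" using c False by (simp add: j_def \<theta>_def)
          have r1: "real (j c) \<le> \<theta>" "\<theta> \<le> real (j c) + 1" unfolding jt using th0 by (linarith, linarith)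
          have xc: "x \<bullet> c = - a + 2 * a * \<theta> / real N" using a(1) N by (simp add: \<theta>_def)
          have "real (j c) < real N" using r1 thN by linarith
          moreover have "2 * a * real (j c) / real N \<le> 2 * a * \<theta> / real N"
            using r1 a(1) by (intro divide_right_mono mult_left_mono) auto
          moreover have "2 * a * \<theta> / real N \<le> 2 * a * (real (j c) + 1) / real N"
            using r1 a(1) by (intro divide_right_mono mult_left_mono) auto
          ultimately show ?thesis unfolding xc by simp
        qed
        have "((b, x \<bullet> b), j) \<in> I" using b(1) xb jc by (auto simp: I_def j_def)
        moreover have "x \<in> F ((b, x \<bullet> b), j)" using jc by (auto simp: F_def)
        ultimately show "y \<in> (\<Union>i\<in>I. C i)" using cp by (auto simp: C_def)
      qed
    next
      fix i assume i: "i \<in> I"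
      show "bounded (C i)"
      proof (rule bounded_subset[OF compact_imp_bounded[OF K(2)]])
        show "C i \<subseteq> K" using closest_point_in_set[OF closedK False] by (auto simp: C_def)
      qed
      show "diameter (C i) \<le> 2 * a * real DIM('a) / real N"
        using distC[OF i] a(1) by (intro diameter_le) auto
    next
      show "0 \<le> 2 * a * real DIM('a) / real N" using a(1) by simp
      show "2 * a * real DIM('a) / real N \<le> \<delta>" by (rule dN)
      show "0 \<le> real (DIM('a) - 1)" by simp
    qed
    \<comment> \<open>The number \<open>N^(n-1)\<close> of cells per face cancels the power of N in
      the diameters, so the bound does not depend on \<open>\<delta>\<close>.\<close>
    also have "\<dots> \<le> ennreal (2 * real DIM('a) * (unit_ball_vol (real ?n) * (a * real DIM('a)) powr real ?n))"
    proof (rule ennreal_leI)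
      have "((2 * a * real DIM('a) / real N) / 2) powr real ?n = (a * real DIM('a)) powr real ?n / real N powr real ?n"
        using a(1) by (simp add: powr_divide)
      moreover have "real N powr real ?n = real N ^ ?n" using N by (subst powr_realpow) auto
      ultimately show "real (card I) * (unit_ball_vol (real ?n) * ((2 * a * real DIM('a) / real N) / 2) powr real ?n)
        \<le> 2 * real DIM('a) * (unit_ball_vol (real ?n) * (a * real DIM('a)) powr real ?n)"
        unfolding cardI using N by simp
    qed
    finally show ?thesis .
  qed
  have "hausdorff_outer (real ?n) S
      \<le> ennreal (2 * real DIM('a) * (unit_ball_vol (real ?n) * (a * real DIM('a)) powr real ?n))"
    unfolding hausdorff_outer_def by (intro SUP_least bound) auto
  also have "\<dots> < top" by simp
  finally show ?thesis .
qed

section \<open>Small perturbations of the sphere\<close>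

text \<open>Stated for exponents j + 2, so that the cube in the bump (j = 1) and the square in its
  gradient (j = 0) are both instances. At t = 0 the difference quotient is itself a positive power
  of the positive part.\<close>

lemma max0_power_has_real_derivative:
  "((\<lambda>t::real. (max 0 t) ^ Suc (Suc j)) has_real_derivative real (Suc (Suc j)) * (max 0 t) ^ Suc j) (at t)"
proof -
  consider "t > 0" | "t < 0" | "t = 0" by linarith
  then show ?thesis
  proof cases
    case 1
    have "((\<lambda>t::real. t ^ Suc (Suc j)) has_real_derivative real (Suc (Suc j)) * t ^ Suc j) (at t)"
      using DERIV_pow[of "Suc (Suc j)" t UNIV] by simp
    then have "((\<lambda>t::real. (max 0 t) ^ Suc (Suc j)) has_real_derivative real (Suc (Suc j)) * t ^ Suc j) (at t)"
    proof (rule has_field_derivative_transform_within_open)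
      show "open {0::real<..}" "t \<in> {0<..}" using 1 by auto
    qed auto
    then show ?thesis using 1 by simp
  next
    case 2
    have "((\<lambda>t::real. 0) has_real_derivative 0) (at t)" by simp
    then have "((\<lambda>t::real. (max 0 t) ^ Suc (Suc j)) has_real_derivative 0) (at t)"
    proof (rule has_field_derivative_transform_within_open)
      show "open {..<0::real}" "t \<in> {..<0}" using 2 by auto
    qed auto
    then show ?thesis using 2 by simp
  next
    case 3
    have "((\<lambda>h::real. (max 0 h) ^ Suc j) \<longlongrightarrow> (max 0 0) ^ Suc j) (at 0)"
      by (intro tendsto_intros)
    then have "((\<lambda>h::real. (max 0 h) ^ Suc j) \<longlongrightarrow> 0) (at 0)" by simp
    then have "((\<lambda>h::real. (max 0 h ^ Suc (Suc j) - max 0 0 ^ Suc (Suc j)) / (h - 0)) \<longlongrightarrow> 0) (at 0)"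
    proof (rule Lim_transform_eventually)
      have "max 0 h ^ Suc j = (max 0 h ^ Suc (Suc j) - max 0 0 ^ Suc (Suc j)) / (h - 0)" if "h \<noteq> 0" for h :: real
        using that by (cases "h > 0") (auto simp: max_def)
      then show "\<forall>\<^sub>F h in at (0::real). max 0 h ^ Suc j = (max 0 h ^ Suc (Suc j) - max 0 0 ^ Suc (Suc j)) / (h - 0)"
        by (simp only: eventually_at_filter) (rule always_eventually, blast)
    qed
    then show ?thesis using 3 by (simp add: has_field_derivative_iff)
  qed
qed

text \<open>One constant controls value, gradient and Hessian together, so that a summable sequence
  of such constants suffices to sum perturbations in C^2.\<close>

definition C2_bounded ::
  "('a::euclidean_space \<Rightarrow> real) \<Rightarrow> ('a \<Rightarrow> 'a) \<Rightarrow> ('a \<Rightarrow> 'a \<Rightarrow> 'a) \<Rightarrow> real \<Rightarrow> bool" where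
  "C2_bounded f g H B \<longleftrightarrow>
     (\<forall>x. (f has_derivative (\<lambda>h. g x \<bullet> h)) (at x)) \<and>
     (\<forall>x. (g has_derivative H x) (at x)) \<and>
     (\<forall>v. continuous_on UNIV (\<lambda>x. H x v)) \<and>
     (\<forall>x. \<bar>f x\<bar> \<le> B \<and> norm (g x) \<le> B \<and> (\<forall>v. norm (H x v) \<le> B * norm v))"

text \<open>The third power is the smallest integer power of the truncated paraboloid that is twice
  continuously differentiable across the sphere of radius \<open>\<delta>\<close>.\<close>

definition bump :: "real \<Rightarrow> 'a::euclidean_space \<Rightarrow> 'a \<Rightarrow> real" where
  "bump \<delta> p x = (max 0 (1 - ((x - p) \<bullet> (x - p)) / \<delta>\<^sup>2)) ^ 3"

definition bump_grad :: "real \<Rightarrow> 'a::euclidean_space \<Rightarrow> 'a \<Rightarrow> 'a" where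
  "bump_grad \<delta> p x = (- 6 / \<delta>\<^sup>2 * (max 0 (1 - ((x - p) \<bullet> (x - p)) / \<delta>\<^sup>2))\<^sup>2) *\<^sub>R (x - p)"

definition bump_hess :: "real \<Rightarrow> 'a::euclidean_space \<Rightarrow> 'a \<Rightarrow> 'a \<Rightarrow> 'a" where
  "bump_hess \<delta> p x v = (- 6 / \<delta>\<^sup>2 * (max 0 (1 - ((x - p) \<bullet> (x - p)) / \<delta>\<^sup>2))\<^sup>2) *\<^sub>R v +
     (24 / \<delta> ^ 4 * max 0 (1 - ((x - p) \<bullet> (x - p)) / \<delta>\<^sup>2) * ((x - p) \<bullet> v)) *\<^sub>R (x - p)"

lemma max0_bump_has_derivative:
  fixes p x :: "'a::euclidean_space"
  shows "((\<lambda>x. (max 0 (1 - ((x - p) \<bullet> (x - p)) / \<delta>\<^sup>2)) ^ Suc (Suc j)) has_derivative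
    (\<lambda>v. real (Suc (Suc j)) * (max 0 (1 - ((x - p) \<bullet> (x - p)) / \<delta>\<^sup>2)) ^ Suc j * (- 2 / \<delta>\<^sup>2 * ((x - p) \<bullet> v)))) (at x)"
proof -
  have q: "((\<lambda>x. 1 - ((x - p) \<bullet> (x - p)) / \<delta>\<^sup>2) has_derivative (\<lambda>v. - 2 / \<delta>\<^sup>2 * ((x - p) \<bullet> v))) (at x)"
  proof -
    have "((\<lambda>x. (x - p) \<bullet> (x - p)) has_derivative (\<lambda>v. (x - p) \<bullet> v + v \<bullet> (x - p))) (at x)"
      by (auto intro!: derivative_eq_intros)
    then have "((\<lambda>x. (x - p) \<bullet> (x - p) / \<delta>\<^sup>2) has_derivative (\<lambda>v. ((x - p) \<bullet> v + v \<bullet> (x - p)) / \<delta>\<^sup>2)) (at x)"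
      by (rule bounded_linear.has_derivative[OF bounded_linear_divide])
    from has_derivative_diff[OF has_derivative_const this, of 1]
    show ?thesis by (simp add: inner_commute)
  qed
  show ?thesis
    using has_derivative_compose[OF q max0_power_has_real_derivative[unfolded has_field_derivative_def]]
    by simp
qed

lemma bump_has_derivative: "(bump \<delta> p has_derivative (\<lambda>v. bump_grad \<delta> p x \<bullet> v)) (at x)"
proof -
  have "(\<lambda>v. bump_grad \<delta> p x \<bullet> v) = (\<lambda>v. real (Suc (Suc 1)) *
      (max 0 (1 - ((x - p) \<bullet> (x - p)) / \<delta>\<^sup>2)) ^ Suc 1 * (- 2 / \<delta>\<^sup>2 * ((x - p) \<bullet> v)))"
    by (auto simp: bump_grad_def power2_eq_square)
  then show ?thesis
    using max0_bump_has_derivative[of p \<delta> 1 x] by (simp add: bump_def[abs_def] numeral_3_eq_3)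
qed

lemma bump_grad_has_derivative: "(bump_grad \<delta> p has_derivative bump_hess \<delta> p x) (at x)"
proof -
  let ?m = "\<lambda>x. max 0 (1 - ((x - p) \<bullet> (x - p)) / \<delta>\<^sup>2)"
  have "((\<lambda>x. (- 6 / \<delta>\<^sup>2 * (?m x)\<^sup>2)) has_derivative (\<lambda>v. 24 / \<delta> ^ 4 * ?m x * ((x - p) \<bullet> v))) (at x)"
  proof -
    have "(\<lambda>v. 24 / \<delta> ^ 4 * ?m x * ((x - p) \<bullet> v)) =
        (\<lambda>v. - 6 / \<delta>\<^sup>2 * (real (Suc (Suc 0)) * ?m x ^ Suc 0 * (- 2 / \<delta>\<^sup>2 * ((x - p) \<bullet> v))))"
      by (simp add: fun_eq_iff power4_eq_xxxx power2_eq_square)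
    then show ?thesis
      using has_derivative_mult_right[OF max0_bump_has_derivative[of p \<delta> 0 x], of "- 6 / \<delta>\<^sup>2"]
      by (simp only: numeral_2_eq_2)
  qed
  moreover have "((\<lambda>x. x - p) has_derivative (\<lambda>v. v)) (at x)"
    by (auto intro!: derivative_eq_intros)
  ultimately have "((\<lambda>x. (- 6 / \<delta>\<^sup>2 * (?m x)\<^sup>2) *\<^sub>R (x - p)) has_derivative
      (\<lambda>v. (- 6 / \<delta>\<^sup>2 * (?m x)\<^sup>2) *\<^sub>R v + (24 / \<delta> ^ 4 * ?m x * ((x - p) \<bullet> v)) *\<^sub>R (x - p))) (at x)"
    by (rule has_derivative_scaleR)
  then show ?thesis by (simp add: bump_grad_def[abs_def] bump_hess_def[abs_def])
qed

lemma bump_hess_continuous: "\<delta> \<noteq> 0 \<Longrightarrow> continuous_on UNIV (\<lambda>x. bump_hess \<delta> p x v)"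
  unfolding bump_hess_def by (intro continuous_intros) auto

lemma bump_outside:
  assumes "0 < \<delta>" "\<delta> \<le> norm (x - p)"
  shows "bump \<delta> p x = 0" "bump_grad \<delta> p x = 0" "bump_hess \<delta> p x v = 0"
proof -
  have "\<delta>\<^sup>2 \<le> (norm (x - p))\<^sup>2" using assms by (intro power_mono) auto
  then have "max 0 (1 - ((x - p) \<bullet> (x - p)) / \<delta>\<^sup>2) = 0"
    using assms(1) by (simp add: power2_norm_eq_inner field_simps)
  then show "bump \<delta> p x = 0" "bump_grad \<delta> p x = 0" "bump_hess \<delta> p x v = 0"
    by (simp_all add: bump_def bump_grad_def bump_hess_def)
qed

lemma bump_center: "bump \<delta> p p = 1"
  by (simp add: bump_def)

text \<open>The Hessian decides: on the support its two terms are at most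
  \<open>6/\<delta>^2\<close> and \<open>24/\<delta>^2\<close> times the norm of v, which makes 30.
  Value and gradient are smaller because \<open>\<delta> \<le> 1\<close>.\<close>

lemma bump_bounds:
  assumes \<delta>: "0 < \<delta>" "\<delta> \<le> 1"
  shows "\<bar>bump \<delta> p x\<bar> \<le> 30 / \<delta>\<^sup>2" "norm (bump_grad \<delta> p x) \<le> 30 / \<delta>\<^sup>2"
    "norm (bump_hess \<delta> p x v) \<le> 30 / \<delta>\<^sup>2 * norm v"
proof -
  define m where "m = max 0 (1 - ((x - p) \<bullet> (x - p)) / \<delta>\<^sup>2)"
  have m: "0 \<le> m" "m \<le> 1" by (auto simp: m_def)
  have msq: "m\<^sup>2 \<le> 1" using power_le_one[OF m] by simp
  have d2: "\<delta>\<^sup>2 \<le> 1" "0 < \<delta>\<^sup>2" using \<delta> by (auto intro: power_le_one)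
  show "\<bar>bump \<delta> p x\<bar> \<le> 30 / \<delta>\<^sup>2"
  proof -
    have "\<bar>bump \<delta> p x\<bar> \<le> 1" using power_le_one[OF m, of 3] m by (simp add: bump_def m_def[symmetric])
    also have "1 \<le> 30 / \<delta>\<^sup>2" using d2 by (simp add: field_simps)
    finally show ?thesis .
  qed
  show "norm (bump_grad \<delta> p x) \<le> 30 / \<delta>\<^sup>2"
  proof (cases "\<delta> \<le> norm (x - p)")
    case True then show ?thesis using bump_outside(2)[OF \<delta>(1) True] by simp
  next
    case False
    have "norm (bump_grad \<delta> p x) = 6 / \<delta>\<^sup>2 * m\<^sup>2 * norm (x - p)"
      by (simp add: bump_grad_def m_def[symmetric] abs_mult)
    also have "\<dots> \<le> 6 / \<delta>\<^sup>2 * 1 * 1" using msq False \<delta> by (intro mult_mono) auto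
    also have "\<dots> \<le> 30 / \<delta>\<^sup>2" using d2 by (simp add: field_simps)
    finally show ?thesis .
  qed
  show "norm (bump_hess \<delta> p x v) \<le> 30 / \<delta>\<^sup>2 * norm v"
  proof (cases "\<delta> \<le> norm (x - p)")
    case True then show ?thesis using bump_outside(3)[OF \<delta>(1) True] \<delta> by simp
  next
    case False
    have "norm (bump_hess \<delta> p x v) \<le> norm ((- 6 / \<delta>\<^sup>2 * m\<^sup>2) *\<^sub>R v) + norm ((24 / \<delta> ^ 4 * m * ((x - p) \<bullet> v)) *\<^sub>R (x - p))"
      unfolding bump_hess_def m_def[symmetric] by (rule norm_triangle_ineq)
    also have "\<dots> = 6 / \<delta>\<^sup>2 * m\<^sup>2 * norm v + 24 / \<delta> ^ 4 * m * (\<bar>(x - p) \<bullet> v\<bar> * norm (x - p))"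
      using m by (simp add: abs_mult)
    also have "\<dots> \<le> 6 / \<delta>\<^sup>2 * 1 * norm v + 24 / \<delta> ^ 4 * 1 * ((\<delta> * norm v) * \<delta>)"
    proof -
      have "\<bar>(x - p) \<bullet> v\<bar> \<le> norm (x - p) * norm v" by (rule Cauchy_Schwarz_ineq2)
      also have "\<dots> \<le> \<delta> * norm v" using False by (intro mult_right_mono) auto
      finally have "\<bar>(x - p) \<bullet> v\<bar> \<le> \<delta> * norm v" .
      then show ?thesis using msq m False \<delta> by (intro add_mono mult_mono) auto
    qed
    also have "\<dots> = 30 / \<delta>\<^sup>2 * norm v"
      using \<delta>(1) by (simp add: field_simps power4_eq_xxxx power2_eq_square)
    finally show ?thesis .
  qed
qed

text \<open>Centres are \<open>2\<delta>\<close> apart, so at every point at most one bump is active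
  and the bound does not grow with the number of bumps.\<close>

lemma C2_bounded_bump_sum:
  fixes P :: "'a::euclidean_space set"
  assumes P: "finite P" and \<delta>: "0 < \<delta>" "\<delta> \<le> 1"
    and sep: "\<And>p p'. p \<in> P \<Longrightarrow> p' \<in> P \<Longrightarrow> p \<noteq> p' \<Longrightarrow> 2 * \<delta> \<le> norm (p - p')"
    and h: "\<And>p. p \<in> P \<Longrightarrow> \<bar>h p\<bar> \<le> \<tau>" and \<tau>: "0 \<le> \<tau>"
  shows "C2_bounded (\<lambda>x. \<Sum>p\<in>P. h p * bump \<delta> p x) (\<lambda>x. \<Sum>p\<in>P. h p *\<^sub>R bump_grad \<delta> p x)
    (\<lambda>x v. \<Sum>p\<in>P. h p *\<^sub>R bump_hess \<delta> p x v) (30 * \<tau> / \<delta>\<^sup>2)"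
proof -
  have single: "norm (\<Sum>p\<in>P. h p *\<^sub>R F p) \<le> 30 * \<tau> / \<delta>\<^sup>2 * c"
    if F: "\<And>p. norm (F p) \<le> 30 / \<delta>\<^sup>2 * c" "\<And>p. \<delta> \<le> norm (x - p) \<Longrightarrow> F p = 0" and c: "0 \<le> c"
    for F :: "'a \<Rightarrow> 'b::real_normed_vector" and x c
  proof (cases "\<exists>p\<in>P. norm (x - p) < \<delta>")
    case True
    then obtain p where p: "p \<in> P" "norm (x - p) < \<delta>" by blast
    have "F p' = 0" if p': "p' \<in> P - {p}" for p'
    proof (rule F(2))
      have "2 * \<delta> \<le> norm (p - p')" using sep p p' by auto
      also have "\<dots> \<le> norm (x - p) + norm (x - p')"
        using norm_triangle_ineq4[of "x - p'" "x - p"] by simp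
      finally show "\<delta> \<le> norm (x - p')" using p(2) by simp
    qed
    then have "(\<Sum>p\<in>P. h p *\<^sub>R F p) = h p *\<^sub>R F p"
      using P p(1) by (subst sum.remove[OF P p(1)]) simp
    also have "norm \<dots> \<le> \<tau> * (30 / \<delta>\<^sup>2 * c)"
      unfolding norm_scaleR using h[OF p(1)] F(1)[of p] \<tau> by (intro mult_mono) auto
    finally show ?thesis by (simp add: mult_ac)
  next
    case False
    then have "(\<Sum>p\<in>P. h p *\<^sub>R F p) = 0" using F(2) by (intro sum.neutral) (auto simp: not_less)
    then show ?thesis using \<tau> c by simp
  qed
  have "\<bar>\<Sum>p\<in>P. h p * bump \<delta> p x\<bar> \<le> 30 * \<tau> / \<delta>\<^sup>2" for x
  proof -
    have "norm (\<Sum>p\<in>P. h p *\<^sub>R bump \<delta> p x) \<le> 30 * \<tau> / \<delta>\<^sup>2 * 1"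
      by (rule single[of _ _ x]) (use bump_bounds(1)[OF \<delta>] bump_outside(1)[OF \<delta>(1)] in auto)
    then show ?thesis by simp
  qed
  moreover have "norm (\<Sum>p\<in>P. h p *\<^sub>R bump_grad \<delta> p x) \<le> 30 * \<tau> / \<delta>\<^sup>2" for x
  proof -
    have "norm (\<Sum>p\<in>P. h p *\<^sub>R bump_grad \<delta> p x) \<le> 30 * \<tau> / \<delta>\<^sup>2 * 1"
      by (rule single[of _ _ x]) (use bump_bounds(2)[OF \<delta>] bump_outside(2)[OF \<delta>(1)] in auto)
    then show ?thesis by simp
  qed
  moreover have "norm (\<Sum>p\<in>P. h p *\<^sub>R bump_hess \<delta> p x v) \<le> 30 * \<tau> / \<delta>\<^sup>2 * norm v" for x v
    by (rule single[of _ _ x]) (use bump_bounds(3)[OF \<delta>] bump_outside(3)[OF \<delta>(1)] in auto)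
  moreover have "((\<lambda>x. \<Sum>p\<in>P. h p * bump \<delta> p x) has_derivative
      (\<lambda>v. (\<Sum>p\<in>P. h p *\<^sub>R bump_grad \<delta> p x) \<bullet> v)) (at x)" for x
    unfolding inner_sum_left inner_scaleR_left
    by (intro has_derivative_sum has_derivative_mult_right bump_has_derivative)
  moreover have "((\<lambda>x. \<Sum>p\<in>P. h p *\<^sub>R bump_grad \<delta> p x) has_derivative
      (\<lambda>v. \<Sum>p\<in>P. h p *\<^sub>R bump_hess \<delta> p x v)) (at x)" for x
    by (intro has_derivative_sum has_derivative_scaleR_right bump_grad_has_derivative)
  moreover have "continuous_on UNIV (\<lambda>x. \<Sum>p\<in>P. h p *\<^sub>R bump_hess \<delta> p x v)" for v
    using \<delta>(1) by (intro continuous_on_sum continuous_on_scaleR continuous_on_const bump_hess_continuous) auto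
  ultimately show ?thesis unfolding C2_bounded_def by blast
qed

section \<open>Summing perturbations in C^2\<close>

lemma norm_partial_suminf_le:
  fixes a :: "nat \<Rightarrow> 'b::banach"
  assumes a: "\<And>k. norm (a k) \<le> B k * c" and B: "summable B" "\<And>k. 0 \<le> B k" and c: "0 \<le> c"
  shows "summable a" "norm (suminf a) \<le> suminf B * c"
    "norm ((\<Sum>i<n. a i) - suminf a) \<le> (\<Sum>i. B (i + n)) * c"
proof -
  have sBc: "summable (\<lambda>k. B k * c)" using B(1) by (rule summable_mult2)
  show sa: "summable a" using a sBc by (intro summable_comparison_test[OF _ sBc]) auto
  have tail: "norm (\<Sum>i. a (i + n)) \<le> (\<Sum>i. B (i + n)) * c" for n
  proof -
    have s: "summable (\<lambda>i. B (i + n))" using B(1) by (rule summable_ignore_initial_segment)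
    have "norm (\<Sum>i. a (i + n)) \<le> (\<Sum>i. B (i + n) * c)"
      by (rule norm_suminf_le) (use a s in \<open>auto intro: summable_mult2\<close>)
    then show ?thesis using suminf_mult2[OF s, of c] by simp
  qed
  show "norm (suminf a) \<le> suminf B * c" using tail[of 0] by simp
  have "(\<Sum>i<n. a i) - suminf a = - (\<Sum>i. a (i + n))"
    using suminf_split_initial_segment[OF sa, of n] by simp
  then show "norm ((\<Sum>i<n. a i) - suminf a) \<le> (\<Sum>i. B (i + n)) * c" using tail[of n] by simp
qed

text \<open>Term by term differentiation, twice. Since \<open>B\<close> majorises all three orders,
  the tails of \<open>B\<close> provide both uniform convergences required by
  \<open>has_derivative_series\<close>, and the Weierstrass test gives continuity of the
  Hessian.\<close>

lemma C2_bounded_suminf: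
  fixes f :: "nat \<Rightarrow> 'a::euclidean_space \<Rightarrow> real"
  assumes C2: "\<And>k. C2_bounded (f k) (g k) (H k) (B k)" and B: "summable B" "\<And>k. 0 \<le> B k"
  shows "C2_bounded (\<lambda>x. \<Sum>k. f k x) (\<lambda>x. \<Sum>k. g k x) (\<lambda>x v. \<Sum>k. H k x v) (suminf B)"
proof -
  have f: "norm (f k x) \<le> B k * 1" and g: "norm (g k x) \<le> B k * 1" and H: "norm (H k x v) \<le> B k * norm v" for k x v
    using C2[of k] by (auto simp: C2_bounded_def)
  have tail0: "\<forall>\<^sub>F n in sequentially. (\<Sum>i. B (i + n)) \<le> e" if "e > 0" for e
    using order_tendstoD(2)[OF suminf_exist_split2[OF B(1)] that] by (rule eventually_mono) simp
  have "\<exists>F. \<forall>x\<in>UNIV. (\<lambda>k. f k x) sums F x \<and> (F has_derivative (\<lambda>v. (\<Sum>k. g k x) \<bullet> v)) (at x within UNIV)"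
  proof (rule has_derivative_series[where f' = "\<lambda>k x v. g k x \<bullet> v" and x = 0 and l = "\<Sum>k. f k 0"])
    show "(f n has_derivative (\<bullet>) (g n x)) (at x within UNIV)" for n x
      using C2[of n] by (simp add: C2_bounded_def)
    show "\<forall>\<^sub>F n in sequentially. \<forall>x\<in>UNIV. \<forall>h. norm ((\<Sum>i<n. g i x \<bullet> h) - (\<Sum>k. g k x) \<bullet> h) \<le> e * norm h"
      if e: "e > 0" for e
      using tail0[OF e]
    proof (rule eventually_mono, intro ballI allI)
      fix n x h assume n: "(\<Sum>i. B (i + n)) \<le> e"
      have "norm ((\<Sum>i<n. g i x \<bullet> h) - (\<Sum>k. g k x) \<bullet> h) = \<bar>((\<Sum>i<n. g i x) - (\<Sum>k. g k x)) \<bullet> h\<bar>"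
        by (simp add: inner_diff_left inner_sum_left)
      also have "\<dots> \<le> norm ((\<Sum>i<n. g i x) - (\<Sum>k. g k x)) * norm h" by (rule Cauchy_Schwarz_ineq2)
      also have "\<dots> \<le> e * norm h"
        using norm_partial_suminf_le(3)[of "\<lambda>k. g k x" B 1 n, OF g B] n by (intro mult_right_mono) auto
      finally show "norm ((\<Sum>i<n. g i x \<bullet> h) - (\<Sum>k. g k x) \<bullet> h) \<le> e * norm h" .
    qed
    show "(\<lambda>n. f n 0) sums (\<Sum>k. f k 0)"
      using norm_partial_suminf_le(1)[of "\<lambda>k. f k 0" B 1, OF f B] by (simp add: summable_sums)
  qed auto
  then obtain F where F: "\<And>x. (\<lambda>k. f k x) sums F x" "\<And>x. (F has_derivative (\<lambda>v. (\<Sum>k. g k x) \<bullet> v)) (at x)"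
    by auto
  have "F = (\<lambda>x. \<Sum>k. f k x)" using sums_unique[OF F(1)] by auto
  with F(2) have dF: "((\<lambda>x. \<Sum>k. f k x) has_derivative (\<lambda>v. (\<Sum>k. g k x) \<bullet> v)) (at x)" for x by simp
  have "\<exists>G. \<forall>x\<in>UNIV. (\<lambda>k. g k x) sums G x \<and> (G has_derivative (\<lambda>v. \<Sum>k. H k x v)) (at x within UNIV)"
  proof (rule has_derivative_series[where f' = H and x = 0 and l = "\<Sum>k. g k 0"])
    show "(g n has_derivative H n x) (at x within UNIV)" for n x
      using C2[of n] by (simp add: C2_bounded_def)
    show "\<forall>\<^sub>F n in sequentially. \<forall>x\<in>UNIV. \<forall>h. norm ((\<Sum>i<n. H i x h) - (\<Sum>k. H k x h)) \<le> e * norm h"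
      if e: "e > 0" for e
      using tail0[OF e]
    proof (rule eventually_mono, intro ballI allI)
      fix n x h assume n: "(\<Sum>i. B (i + n)) \<le> e"
      have "norm ((\<Sum>i<n. H i x h) - (\<Sum>k. H k x h)) \<le> (\<Sum>i. B (i + n)) * norm h"
        using norm_partial_suminf_le(3)[of "\<lambda>k. H k x h" B "norm h" n, OF H B] by simp
      also have "\<dots> \<le> e * norm h" using n by (intro mult_right_mono) auto
      finally show "norm ((\<Sum>i<n. H i x h) - (\<Sum>k. H k x h)) \<le> e * norm h" .
    qed
    show "(\<lambda>n. g n 0) sums (\<Sum>k. g k 0)"
      using norm_partial_suminf_le(1)[of "\<lambda>k. g k 0" B 1, OF g B] by (simp add: summable_sums)
  qed auto
  then obtain G where G: "\<And>x. (\<lambda>k. g k x) sums G x" "\<And>x. (G has_derivative (\<lambda>v. \<Sum>k. H k x v)) (at x)"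
    by auto
  have "G = (\<lambda>x. \<Sum>k. g k x)" using sums_unique[OF G(1)] by auto
  with G(2) have dG: "((\<lambda>x. \<Sum>k. g k x) has_derivative (\<lambda>v. \<Sum>k. H k x v)) (at x)" for x by simp
  have cont: "continuous_on UNIV (\<lambda>x. \<Sum>k. H k x v)" for v
  proof (rule uniform_limit_theorem)
    show "uniform_limit UNIV (\<lambda>n x. \<Sum>i<n. H i x v) (\<lambda>x. \<Sum>k. H k x v) sequentially"
      using H by (rule Weierstrass_m_test) (intro summable_mult2 B)
    show "\<forall>\<^sub>F n in sequentially. continuous_on UNIV (\<lambda>x. \<Sum>i<n. H i x v)"
      using C2 by (intro always_eventually allI continuous_on_sum) (simp add: C2_bounded_def)
  qed simp
  have "\<bar>\<Sum>k. f k x\<bar> \<le> suminf B" "norm (\<Sum>k. g k x) \<le> suminf B" "norm (\<Sum>k. H k x v) \<le> suminf B * norm v" for x v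
    using norm_partial_suminf_le(2)[of "\<lambda>k. f k x" B 1, OF f B]
      norm_partial_suminf_le(2)[of "\<lambda>k. g k x" B 1, OF g B]
      norm_partial_suminf_le(2)[of "\<lambda>k. H k x v" B "norm v", OF H B] by auto
  then show ?thesis unfolding C2_bounded_def using dF dG cont by blast
qed

text \<open>The bound 1/2 leaves room everywhere: the squared norm has Hessian 2, so at least 3/2
  survives and the defining function stays convex; on the surface the squared norm lies between 1/2
  and 3/2, so 2x cannot be cancelled by a gradient of size 1/2.\<close>

locale perturbed_sphere =
  fixes \<psi> :: "'a::euclidean_space \<Rightarrow> real" and G :: "'a \<Rightarrow> 'a" and H :: "'a \<Rightarrow> 'a \<Rightarrow> 'a"
  assumes C2: "C2_bounded \<psi> G H (1/2)"
begin

definition \<rho> :: "'a \<Rightarrow> real" where "\<rho> x = x \<bullet> x - 1 + \<psi> x"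
definition grad :: "'a \<Rightarrow> 'a" where "grad x = 2 *\<^sub>R x + G x"
definition surf :: "'a set" where "surf = {x. \<rho> x = 0}"

lemma C2D:
  "(\<psi> has_derivative (\<lambda>h. G x \<bullet> h)) (at x)" "(G has_derivative H x) (at x)"
  "continuous_on UNIV (\<lambda>x. H x v)" "\<bar>\<psi> x\<bar> \<le> 1/2" "norm (G x) \<le> 1/2" "norm (H x v) \<le> 1/2 * norm v"
  using C2 unfolding C2_bounded_def by auto

lemma \<rho>_has_derivative: "(\<rho> has_derivative (\<lambda>h. grad x \<bullet> h)) (at x)"
proof -
  have "((\<lambda>x. x \<bullet> x) has_derivative (\<lambda>v. x \<bullet> v + v \<bullet> x)) (at x)"
    by (auto intro!: derivative_eq_intros)
  from has_derivative_add[OF has_derivative_diff[OF this has_derivative_const[of 1]] C2D(1)]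
  show ?thesis
    unfolding \<rho>_def[abs_def] grad_def by (simp add: inner_add_left inner_commute[of _ x])
qed

lemma grad_has_derivative: "(grad has_derivative (\<lambda>v. 2 *\<^sub>R v + H x v)) (at x)"
  unfolding grad_def[abs_def] by (intro has_derivative_add has_derivative_scaleR_right has_derivative_ident C2D(2))

text \<open>\<open>G\<close> is 1/2-Lipschitz by the Hessian bound, and 2x contributes twice the
  squared distance.\<close>

lemma grad_monotone: "0 \<le> (grad x - grad y) \<bullet> (x - y)"
proof -
  have "norm (G x - G y) \<le> 1/2 * norm (x - y)"
  proof (rule differentiable_bound[where S = UNIV])
    show "onorm (H z) \<le> 1/2" for z
      using C2D(6) by (rule onorm_le)
  qed (use C2D(2) in auto)
  then have "\<bar>(G x - G y) \<bullet> (x - y)\<bar> \<le> 1/2 * norm (x - y) * norm (x - y)"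
    using Cauchy_Schwarz_ineq2[of "G x - G y" "x - y"] by (meson mult_right_mono norm_ge_zero order_trans)
  moreover have "(grad x - grad y) \<bullet> (x - y) = 2 * (norm (x - y) * norm (x - y)) + (G x - G y) \<bullet> (x - y)"
    unfolding power2_eq_square[symmetric] power2_norm_eq_inner grad_def by (simp add: inner_simps algebra_simps)
  moreover have "0 \<le> norm (x - y) * norm (x - y)" by simp
  ultimately show ?thesis by linarith
qed

text \<open>Convexity in first order form, from the mean value theorem and monotonicity of the
  gradient. It serves three times: convexity of the body, the gradient as outer normal, and the sign
  tests that locate the surface above a given point.\<close>

lemma \<rho>_first_order: "\<rho> y + grad y \<bullet> (z - y) \<le> \<rho> z"
proof -
  define \<phi> where "\<phi> = (\<lambda>t::real. \<rho> (y + t *\<^sub>R (z - y)))"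
  have "(\<phi> has_derivative (\<lambda>h. grad (y + t *\<^sub>R (z - y)) \<bullet> (h *\<^sub>R (z - y)))) (at t within {0..1})" for t
  proof -
    have "((\<lambda>t. y + t *\<^sub>R (z - y)) has_derivative (\<lambda>h. h *\<^sub>R (z - y))) (at t within {0..1})"
      by (auto intro!: derivative_eq_intros)
    from has_derivative_compose[OF this \<rho>_has_derivative] show ?thesis by (simp add: \<phi>_def)
  qed
  then obtain t where t: "t \<in> {0<..<1}" "\<phi> 1 - \<phi> 0 = grad (y + t *\<^sub>R (z - y)) \<bullet> ((1 - 0) *\<^sub>R (z - y))"
    using mvt_simple[of 0 1 \<phi> "\<lambda>t h. grad (y + t *\<^sub>R (z - y)) \<bullet> (h *\<^sub>R (z - y))"] by auto
  have "0 \<le> (grad (y + t *\<^sub>R (z - y)) - grad y) \<bullet> (t *\<^sub>R (z - y))"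
    using grad_monotone[of "y + t *\<^sub>R (z - y)" y] by simp
  then have "0 \<le> (grad (y + t *\<^sub>R (z - y)) - grad y) \<bullet> (z - y)"
    using t(1) by (simp add: zero_le_mult_iff)
  then show ?thesis using t(2) by (simp add: \<phi>_def inner_diff_left)
qed

lemma convex_sublevel: "convex {x. \<rho> x \<le> 0}"
proof (rule convexI, clarify)
  fix x y and u v :: real
  assume a: "\<rho> x \<le> 0" "\<rho> y \<le> 0" "0 \<le> u" "0 \<le> v" "u + v = 1"
  define z where "z = u *\<^sub>R x + v *\<^sub>R y"
  have "u * (\<rho> z + grad z \<bullet> (x - z)) + v * (\<rho> z + grad z \<bullet> (y - z)) \<le> u * \<rho> x + v * \<rho> y"
    by (intro add_mono mult_left_mono \<rho>_first_order a)
  moreover have "u * (\<rho> z + grad z \<bullet> (x - z)) + v * (\<rho> z + grad z \<bullet> (y - z))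
      = (u + v) * \<rho> z + grad z \<bullet> (u *\<^sub>R x + v *\<^sub>R y - (u + v) *\<^sub>R z)"
    by (simp add: inner_simps algebra_simps)
  moreover have "u * \<rho> x + v * \<rho> y \<le> 0"
    using a by (intro add_nonpos_nonpos mult_nonneg_nonpos)
  ultimately have "\<rho> z \<le> 0" using a(5) by (simp add: z_def[symmetric])
  then show "\<rho> (u *\<^sub>R x + v *\<^sub>R y) \<le> 0" by (simp add: z_def)
qed

lemma continuous_\<rho>: "continuous_on S \<rho>"
  using has_derivative_continuous[OF \<rho>_has_derivative] by (simp add: continuous_at_imp_continuous_on)

lemma norm_bound: "\<rho> x \<le> 0 \<Longrightarrow> (norm x)\<^sup>2 \<le> 3/2"
  using C2D(4)[of x] by (simp add: \<rho>_def power2_norm_eq_inner abs_le_iff)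

lemma compact_sublevel: "compact {x. \<rho> x \<le> 0}"
proof (rule compact_eq_bounded_closed[THEN iffD2], rule conjI)
  show "bounded {x. \<rho> x \<le> 0}"
  proof (rule boundedI[of _ 2], clarify)
    fix x assume "\<rho> x \<le> 0"
    then have "(norm x)\<^sup>2 \<le> 2\<^sup>2" using norm_bound[of x] by simp
    then show "norm x \<le> 2" by (rule power2_le_imp_le) simp
  qed
  show "closed {x. \<rho> x \<le> 0}"
    by (intro closed_Collect_le continuous_\<rho> continuous_on_const)
qed

lemma grad_nonzero: assumes "x \<in> surf" shows "grad x \<noteq> 0"
proof
  assume "grad x = 0"
  then have "norm (2 *\<^sub>R x) = norm (G x)" by (simp add: grad_def eq_neg_iff_add_eq_0[symmetric])
  then have "norm x \<le> 1/4" using C2D(5)[of x] by simp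
  then have "(norm x)\<^sup>2 \<le> (1/4)\<^sup>2" by (intro power_mono) auto
  moreover have "(norm x)\<^sup>2 \<ge> 1/2" using assms C2D(4)[of x] by (simp add: surf_def \<rho>_def power2_norm_eq_inner abs_le_iff)
  ultimately show False by (simp add: power2_eq_square)
qed

lemma surf_nonempty: "surf \<noteq> {}"
proof -
  obtain b :: 'a where b: "b \<in> Basis" using nonempty_Basis by blast
  have "\<exists>t::real. 0 \<le> t \<and> t \<le> 2 \<and> \<rho> (t *\<^sub>R b) = 0"
  proof (rule IVT')
    show "\<rho> (0 *\<^sub>R b) \<le> 0" "0 \<le> \<rho> (2 *\<^sub>R b)"
      using C2D(4)[of 0] C2D(4)[of "2 *\<^sub>R b"] b by (auto simp: \<rho>_def abs_le_iff)
    show "continuous_on {0..2} (\<lambda>t. \<rho> (t *\<^sub>R b))"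
      by (intro continuous_on_compose2[OF continuous_\<rho>[of UNIV]] continuous_intros) auto
  qed simp
  then show ?thesis by (auto simp: surf_def)
qed

lemma strictly_convex_surf: "strictly_convex_compact_C2_hypersurface surf"
  unfolding strictly_convex_compact_C2_hypersurface_def
proof (intro exI conjI)
  show "\<forall>x. (\<rho> has_derivative (\<lambda>h. grad x \<bullet> h)) (at x)" using \<rho>_has_derivative by blast
  show "\<forall>x. (grad has_derivative (\<lambda>v. 2 *\<^sub>R v + H x v)) (at x)" using grad_has_derivative by blast
  show "\<forall>v. continuous_on UNIV (\<lambda>x. 2 *\<^sub>R v + H x v)" by (intro allI continuous_intros C2D)
  show "surf = {x. \<rho> x = 0}" by (rule surf_def)
  show "\<forall>x\<in>surf. \<forall>v. v \<noteq> 0 \<and> grad x \<bullet> v = 0 \<longrightarrow> (2 *\<^sub>R v + H x v) \<bullet> v > 0"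
  proof (intro ballI allI impI)
    fix x v :: 'a assume "v \<noteq> 0 \<and> grad x \<bullet> v = 0"
    then have v: "0 < norm v * norm v" by simp
    have "\<bar>H x v \<bullet> v\<bar> \<le> norm (H x v) * norm v" by (rule Cauchy_Schwarz_ineq2)
    also have "\<dots> \<le> 1/2 * norm v * norm v" by (intro mult_right_mono C2D) auto
    finally have "\<bar>H x v \<bullet> v\<bar> \<le> 1/2 * norm v * norm v" .
    moreover have "(2 *\<^sub>R v + H x v) \<bullet> v = 2 * (norm v * norm v) + H x v \<bullet> v"
      by (simp add: inner_add_left power2_norm_eq_inner[symmetric] power2_eq_square)
    ultimately show "(2 *\<^sub>R v + H x v) \<bullet> v > 0" using v by linarith
  qed
qed (use surf_nonempty compact_sublevel convex_sublevel grad_nonzero in auto)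

lemma closed_surf: "closed surf"
  unfolding surf_def by (intro closed_Collect_eq continuous_\<rho> continuous_on_const)

lemma hausdorff_surf_finite: "hausdorff_outer (real (DIM('a) - 1)) surf < top"
proof (rule hausdorff_outer_convex_boundary_finite[OF convex_sublevel compact_sublevel])
  show "surf \<subseteq> {x. \<rho> x \<le> 0}" by (auto simp: surf_def)
  fix y assume y: "y \<in> surf"
  have "grad y \<bullet> (z - y) \<le> 0" if "\<rho> z \<le> 0" for z
    using \<rho>_first_order[of y z] y that by (simp add: surf_def)
  then show "\<exists>g. g \<noteq> 0 \<and> (\<forall>z\<in>{x. \<rho> x \<le> 0}. g \<bullet> (z - y) \<le> 0)"
    using grad_nonzero[OF y] by blast
qed

text \<open>Inside the ball the surface meets every line in direction e that passes close to p:
  along e the defining function has slope at least 5/8, so on a segment of half length r/2 it moves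
  by 5r/16, more than the r/4 by which the sideways displacement can disturb it. The graph estimate
  then applies.\<close>

lemma hausdorff_cap_ge:
  fixes e p :: 'a
  assumes dim: "2 \<le> DIM('a)" and e: "e \<in> Basis" and p: "p \<in> surf" "3/4 \<le> p \<bullet> e" and r: "0 < r" "r \<le> 1/4"
  shows "ennreal (unit_ball_vol (real (DIM('a) - 1)) * (r / (32 * real DIM('a))) ^ (DIM('a) - 1))
    \<le> hausdorff_outer (real (DIM('a) - 1)) (surf \<inter> ball p r)"
proof -
  \<comment> \<open>Makes the sideways displacement d at most r/16; with gradients of norm at most 4
    this is the disturbance r/4. The factor 32 of the statement is 16 times the 2 in h/2.\<close>
  define h where "h = r / (16 * real DIM('a))"
  have h0: "0 \<le> h" using r by (simp add: h_def)
  have np: "norm p \<le> 5/4"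
  proof (rule power2_le_imp_le)
    show "(norm p)\<^sup>2 \<le> (5/4)\<^sup>2" using norm_bound[of p] p(1) by (simp add: surf_def power2_eq_square)
  qed simp
  have "\<exists>y\<in>surf \<inter> ball p r. \<forall>b\<in>Basis - {e}. y \<bullet> b = z \<bullet> b"
    if z: "\<And>b. b \<in> Basis - {e} \<Longrightarrow> \<bar>(z - p) \<bullet> b\<bar> \<le> h" for z
  proof -
    define y where "y = (\<lambda>s::real. z + (p \<bullet> e - z \<bullet> e + s) *\<^sub>R e)"
    define d where "d = y 0 - p"
    have ys: "y s = p + d + s *\<^sub>R e" for s by (simp add: y_def d_def algebra_simps)
    have yb: "y s \<bullet> b = z \<bullet> b" if "b \<in> Basis - {e}" for b s
      using that e by (auto simp: y_def inner_add_left inner_Basis)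
    have db: "\<bar>d \<bullet> b\<bar> \<le> h" if "b \<in> Basis" for b
    proof (cases "b = e")
      case True
      then show ?thesis using e h0 by (simp add: d_def y_def inner_add_left inner_diff_left)
    next
      case False
      then show ?thesis using z[of b] yb[of b 0] that by (simp add: d_def inner_diff_left)
    qed
    have nd: "norm d \<le> r/16"
    proof -
      have "(\<Sum>b\<in>Basis. \<bar>d \<bullet> b\<bar>) \<le> real DIM('a) * h" using db by (intro sum_bounded_above) auto
      also have "\<dots> = r/16" by (simp add: h_def)
      finally show ?thesis using norm_le_l1[of d] by linarith
    qed
    have dist: "norm (y s - p) \<le> r/16 + \<bar>s\<bar>" for s
      using norm_triangle_ineq[of d "s *\<^sub>R e"] nd e by (simp add: ys)
    have gr: "norm (grad x) \<le> 4" if "norm (x - p) \<le> 1/4" for x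
    proof -
      have "norm x \<le> 3/2" using norm_triangle_ineq[of "x - p" p] that np by simp
      then show ?thesis using norm_triangle_ineq[of "2 *\<^sub>R x" "G x"] C2D(5)[of x] by (simp add: grad_def)
    qed
    have ge: "5/8 \<le> grad x \<bullet> e" if x: "norm (x - p) \<le> 9/16 * (1/4)" for x
    proof -
      have "\<bar>(x - p) \<bullet> e\<bar> \<le> 9/64" using Basis_le_norm[OF e, of "x - p"] x by simp
      moreover have "\<bar>G x \<bullet> e\<bar> \<le> 1/2" using Basis_le_norm[OF e, of "G x"] C2D(5)[of x] by simp
      ultimately show ?thesis using p(2) unfolding abs_le_iff by (simp add: grad_def inner_add_left inner_diff_left)
    qed
    have gd: "\<bar>grad x \<bullet> d\<bar> \<le> r/4" if "norm (x - p) \<le> 1/4" for x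
    proof -
      have "\<bar>grad x \<bullet> d\<bar> \<le> norm (grad x) * norm d" by (rule Cauchy_Schwarz_ineq2)
      also have "\<dots> \<le> 4 * (r/16)" using gr[OF that] nd by (intro mult_mono) auto
      finally show ?thesis by simp
    qed
    have half: "norm (y s - p) \<le> 9/16 * (1/4)" "norm (y s - p) < r" if "\<bar>s\<bar> \<le> r/2" for s
      using dist[of s] that r by auto
    have "0 \<le> \<rho> (y (r/2))"
    proof -
      have "grad p \<bullet> (y (r/2) - p) = grad p \<bullet> d + r/2 * (grad p \<bullet> e)"
        by (simp add: ys inner_add_right)
      moreover have "r/2 * (5/8) \<le> r/2 * (grad p \<bullet> e)" using ge[of p] r by (intro mult_left_mono) auto
      moreover have "\<bar>grad p \<bullet> d\<bar> \<le> r/4" by (intro gd) simp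
      moreover have "\<rho> p = 0" using p(1) by (simp add: surf_def)
      ultimately show ?thesis using \<rho>_first_order[of p "y (r/2)"] r by linarith
    qed
    \<comment> \<open>Convexity bounds from below only, so for the upper bound at the lower end the
      tangent is taken there and evaluated at p.\<close>
    moreover have "\<rho> (y (- (r/2))) \<le> 0"
    proof -
      let ?y = "y (- (r/2))"
      have n: "norm (?y - p) \<le> 9/16 * (1/4)" using half(1)[of "- (r/2)"] r by simp
      have "grad ?y \<bullet> (p - ?y) = - (grad ?y \<bullet> d) + r/2 * (grad ?y \<bullet> e)"
        by (simp add: ys inner_simps)
      moreover have "r/2 * (5/8) \<le> r/2 * (grad ?y \<bullet> e)" using ge[OF n] r by (intro mult_left_mono) auto
      moreover have "\<bar>grad ?y \<bullet> d\<bar> \<le> r/4" using n by (intro gd) simp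
      moreover have "\<rho> p = 0" using p(1) by (simp add: surf_def)
      ultimately show ?thesis using \<rho>_first_order[of ?y p] r by linarith
    qed
    moreover have "continuous_on {- (r/2)..r/2} (\<lambda>s. \<rho> (y s))"
      unfolding y_def by (intro continuous_on_compose2[OF continuous_\<rho>[of UNIV]] continuous_intros) auto
    ultimately obtain s where s: "- (r/2) \<le> s" "s \<le> r/2" "\<rho> (y s) = 0"
      using IVT'[of "\<lambda>s. \<rho> (y s)" "- (r/2)" 0 "r/2"] r by auto
    have "y s \<in> surf \<inter> ball p r"
      using s half(2)[of s] by (auto simp: surf_def dist_norm norm_minus_commute abs_le_iff)
    then show ?thesis using yb by blast
  qed
  from hausdorff_outer_graph_ge[OF e h0 dim, of p "surf \<inter> ball p r", OF this]
  show ?thesis by (simp add: h_def)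
qed

end

section \<open>Random generalised arithmetic progressions\<close>

text \<open>In the prefix tree of S every node has at most L children, and a node of level j has
  a single child unless j is a branching level.\<close>

lemma card_le_branching:
  fixes S :: "(nat \<Rightarrow> nat) set"
  assumes S: "S \<subseteq> PiE {..<m} (\<lambda>_. {..<L})" and L: "1 \<le> L"
  defines "J \<equiv> {j \<in> {..<m}. \<exists>a\<in>S. \<exists>a'\<in>S. (\<forall>i<j. a i = a' i) \<and> a j \<noteq> a' j}"
  shows "card S \<le> L ^ card J"
proof -
  define T where "T = (\<lambda>j. (\<lambda>a. restrict a {..<j}) ` S)"
  have finS: "finite S" using S by (rule finite_subset) (intro finite_PiE; simp)
  have finT: "finite (T j)" for j unfolding T_def using finS by simp
  have "j \<le> m \<Longrightarrow> card (T j) \<le> L ^ card (J \<inter> {..<j})" for j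
  proof (induction j)
    case 0
    have "T 0 \<subseteq> {restrict (\<lambda>_. 0) {}}" by (auto simp: T_def restrict_def)
    then have "card (T 0) \<le> card {restrict (\<lambda>_. 0::nat) ({}::nat set)}" by (intro card_mono) auto
    then show ?case by simp
  next
    case (Suc j)
    then have IH: "card (T j) \<le> L ^ card (J \<inter> {..<j})" and jm: "j < m" by auto
    have rr: "restrict (restrict a {..<Suc j}) {..<j} = restrict a {..<j}" for a :: "nat \<Rightarrow> nat"
      by (auto simp: restrict_def fun_eq_iff)
    show ?case
    proof (cases "j \<in> J")
      case True
      let ?f = "\<lambda>b. (restrict b {..<j}, b j)"
      have "inj_on ?f (T (Suc j))"
      proof (rule inj_onI)
        fix b b' assume b: "b \<in> T (Suc j)" "b' \<in> T (Suc j)" and eq: "?f b = ?f b'"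
        have "b i = b' i" for i
        proof -
          have "i < j \<or> i = j \<or> i \<ge> Suc j" by auto
          then show ?thesis
          proof (elim disjE)
            assume "i < j" then show ?thesis using eq by (auto dest!: fun_cong[of _ _ i])
          qed (use eq b in \<open>auto simp: T_def restrict_def\<close>)
        qed
        then show "b = b'" by auto
      qed
      moreover have "?f ` T (Suc j) \<subseteq> T j \<times> {..<L}"
        using S jm rr by (auto simp: T_def PiE_def Pi_def)
      ultimately have "card (T (Suc j)) \<le> card (T j \<times> {..<L})"
        using finT by (intro card_inj_on_le[where f = ?f]) auto
      also have "\<dots> \<le> L ^ card (J \<inter> {..<j}) * L" using IH by (simp add: card_cartesian_product)
      also have "\<dots> = L ^ card (J \<inter> {..<Suc j})"
      proof -
        have "J \<inter> {..<Suc j} = insert j (J \<inter> {..<j})" using True by auto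
        then show ?thesis by simp
      qed
      finally show ?thesis .
    next
      case False
      have "inj_on (\<lambda>b. restrict b {..<j}) (T (Suc j))"
      proof (rule inj_onI)
        fix b b' assume b: "b \<in> T (Suc j)" "b' \<in> T (Suc j)" and eq: "restrict b {..<j} = restrict b' {..<j}"
        obtain a a' where a: "a \<in> S" "b = restrict a {..<Suc j}" "a' \<in> S" "b' = restrict a' {..<Suc j}"
          using b by (auto simp: T_def)
        have agree: "a i = a' i" if "i < j" for i
          using fun_cong[OF eq, of i] that a by simp
        then have "a j = a' j" using False a jm by (auto simp: J_def)
        then show "b = b'" using agree a by (auto simp: fun_eq_iff restrict_def less_Suc_eq)
      qed
      moreover have "(\<lambda>b. restrict b {..<j}) ` T (Suc j) \<subseteq> T j" using rr by (auto simp: T_def)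
      ultimately have "card (T (Suc j)) \<le> card (T j)" using finT by (intro card_inj_on_le) auto
      also have "J \<inter> {..<Suc j} = J \<inter> {..<j}" using False by (auto simp: less_Suc_eq)
      with IH have "card (T j) \<le> L ^ card (J \<inter> {..<Suc j})" by simp
      finally show ?thesis .
    qed
  qed
  from this[of m] have "card (T m) \<le> L ^ card (J \<inter> {..<m})" by simp
  moreover have "T m = S"
  proof -
    have "restrict a {..<m} = a" if "a \<in> S" for a
      using S that by (auto simp: PiE_def extensional_def restrict_def fun_eq_iff)
    then show ?thesis by (auto simp: T_def)
  qed
  moreover have "J \<inter> {..<m} = J" by (auto simp: J_def)
  ultimately show ?thesis by simp
qed

text \<open>A conditional probability without division: R does not see coordinate i, and once all
  other coordinates are fixed Q has chance at most \<open>c / card (D i)\<close>.\<close>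

lemma card_PiE_fiber_le:
  fixes D :: "'i \<Rightarrow> 'd set"
  assumes I: "finite I" "i \<in> I" and D: "\<And>i. i \<in> I \<Longrightarrow> finite (D i)"
    and R: "\<And>V z. R (V(i := z)) = R V"
    and Q: "\<And>V. real (card {z \<in> D i. Q (V(i := z))}) \<le> c"
  shows "real (card {V \<in> PiE I D. R V \<and> Q V}) * real (card (D i)) \<le> c * real (card {V \<in> PiE I D. R V})"
proof -
  define W where "W = {V \<in> PiE (I - {i}) D. R V}"
  have finW: "finite W" unfolding W_def using I D by (intro finite_subset[OF _ finite_PiE[of "I - {i}" D]]) auto
  have ins: "insert i (I - {i}) = I" using I by auto
  have decomp: "PiE I D = (\<lambda>(z, V). V(i := z)) ` (D i \<times> PiE (I - {i}) D)"
    using PiE_insert_eq[of i "I - {i}" D] ins by simp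
  have inj: "inj_on (\<lambda>(z, V). V(i := z)) (D i \<times> PiE (I - {i}) D)"
    by (rule inj_combinator) simp
  have "{V \<in> PiE I D. R V} = (\<lambda>(z, V). V(i := z)) ` (D i \<times> W)"
  proof (intro equalityI subsetI)
    fix V assume "V \<in> {V \<in> PiE I D. R V}"
    then have "V \<in> (\<lambda>(z, V). V(i := z)) ` (D i \<times> PiE (I - {i}) D)" and RV: "R V"
      unfolding decomp by auto
    then obtain z V' where "V = V'(i := z)" "z \<in> D i" "V' \<in> PiE (I - {i}) D"
      by (elim imageE SigmaE) auto
    with RV show "V \<in> (\<lambda>(z, V). V(i := z)) ` (D i \<times> W)"
      by (intro image_eqI[of _ _ "(z, V')"]) (auto simp: W_def R)
  next
    fix V assume "V \<in> (\<lambda>(z, V). V(i := z)) ` (D i \<times> W)"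
    then obtain z V' where "V = V'(i := z)" "z \<in> D i" "V' \<in> PiE (I - {i}) D" "R V'"
      by (auto simp: W_def)
    then show "V \<in> {V \<in> PiE I D. R V}" unfolding decomp by (auto simp: R)
  qed
  moreover have "inj_on (\<lambda>(z, V). V(i := z)) (D i \<times> W)"
    by (rule inj_on_subset[OF inj]) (auto simp: W_def)
  ultimately have cR: "card {V \<in> PiE I D. R V} = card (D i) * card W"
    by (simp add: card_image card_cartesian_product)
  have "{V \<in> PiE I D. R V \<and> Q V} \<subseteq> (\<Union>V\<in>W. (\<lambda>z. V(i := z)) ` {z \<in> D i. Q (V(i := z))})"
    unfolding decomp W_def by (auto simp: R)
  then have "card {V \<in> PiE I D. R V \<and> Q V} \<le> card (\<Union>V\<in>W. (\<lambda>z. V(i := z)) ` {z \<in> D i. Q (V(i := z))})"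
    using finW D I by (intro card_mono) auto
  also have "\<dots> \<le> (\<Sum>V\<in>W. card ((\<lambda>z. V(i := z)) ` {z \<in> D i. Q (V(i := z))}))"
    by (rule card_UN_le[OF finW])
  also have "\<dots> \<le> (\<Sum>V\<in>W. card {z \<in> D i. Q (V(i := z))})"
    using D I by (intro sum_mono card_image_le) auto
  finally have "real (card {V \<in> PiE I D. R V \<and> Q V}) \<le> (\<Sum>V\<in>W. real (card {z \<in> D i. Q (V(i := z))}))"
    by (simp flip: of_nat_sum)
  also have "\<dots> \<le> (\<Sum>V\<in>W. c)" by (intro sum_mono Q)
  also have "\<dots> = real (card W) * c" by simp
  finally have "real (card {V \<in> PiE I D. R V \<and> Q V}) * real (card (D i)) \<le> real (card W) * c * real (card (D i))"
    by (intro mult_right_mono) auto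
  then show ?thesis by (simp add: cR mult_ac)
qed

section \<open>Small value estimates for linear forms in the random generators\<close>

lemma card_affine_le:
  fixes x y \<eta> :: real
  assumes "y \<noteq> 0" "0 \<le> \<eta>" "finite Z"
  shows "real (card {z \<in> Z. \<bar>x + y * real z\<bar> \<le> \<eta>}) \<le> 2 * \<eta> / \<bar>y\<bar> + 1"
proof (cases "{z \<in> Z. \<bar>x + y * real z\<bar> \<le> \<eta>} = {}")
  case True
  then show ?thesis using assms by (simp only: card.empty) simp
next
  case False
  let ?S = "{z \<in> Z. \<bar>x + y * real z\<bar> \<le> \<eta>}"
  have fin: "finite ?S" using assms by simp
  define lo hi where "lo = Min ?S" and "hi = Max ?S"
  have lohi: "lo \<in> ?S" "hi \<in> ?S" "lo \<le> hi"
    unfolding lo_def hi_def using fin False by (auto intro: Min_in Max_in simp del: mem_Collect_eq)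
  have "?S \<subseteq> {lo..hi}" unfolding lo_def hi_def using fin by auto
  then have "card ?S \<le> card {lo..hi}" by (intro card_mono) auto
  then have "real (card ?S) \<le> real hi - real lo + 1" using lohi(3) by simp
  moreover have "real hi - real lo \<le> 2 * \<eta> / \<bar>y\<bar>"
  proof -
    have "\<bar>x + y * real lo\<bar> \<le> \<eta>" "\<bar>x + y * real hi\<bar> \<le> \<eta>" using lohi by auto
    then have "\<bar>y * real hi - y * real lo\<bar> \<le> 2 * \<eta>" by linarith
    then have "\<bar>y * (real hi - real lo)\<bar> \<le> 2 * \<eta>" by (simp add: algebra_simps)
    then have "\<bar>y\<bar> * (real hi - real lo) \<le> 2 * \<eta>" using lohi(3) by (simp add: abs_mult)
    then show ?thesis using assms(1) by (simp add: field_simps)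
  qed
  ultimately show ?thesis by linarith
qed

text \<open>For \<open>j < m\<close> the vector with coordinates \<open>V (j, c) / q\<close> is the generator \<open>u\<^sub>j\<close> of the progression;
  row \<open>m\<close> is a random translation.\<close>

definition grid_functions :: "nat \<Rightarrow> nat \<Rightarrow> (nat \<times> 'a::euclidean_space \<Rightarrow> nat) set" where
  "grid_functions m q = PiE ({..m} \<times> Basis) (\<lambda>_. {..<q})"

lemma finite_grid_functions: "finite (grid_functions m q :: (nat \<times> 'a::euclidean_space \<Rightarrow> nat) set)"
  unfolding grid_functions_def by (intro finite_PiE) auto

lemma card_grid_functions:
  "card (grid_functions m q :: (nat \<times> 'a::euclidean_space \<Rightarrow> nat) set) = q ^ (Suc m * DIM('a))"
  unfolding grid_functions_def by (simp add: card_PiE card_cartesian_product)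

text \<open>The inner product of a direction with the combination of the generators with
  coefficients \<open>a\<close>. The direction enters through its coordinates so that rational
  approximations can be inserted, and \<open>a\<close> is real so that differences of coefficient
  vectors are allowed.\<close>

definition pairing :: "nat \<Rightarrow> nat \<Rightarrow> ('a::euclidean_space \<Rightarrow> real) \<Rightarrow> (nat \<times> 'a \<Rightarrow> nat) \<Rightarrow> (nat \<Rightarrow> real) \<Rightarrow> real" where
  "pairing m q \<nu> V a = (\<Sum>i<m. a i * (\<Sum>c\<in>Basis. \<nu> c * (real (V (i, c)) / real q)))"

lemma pairing_upd:
  fixes \<nu> :: "'a::euclidean_space \<Rightarrow> real"
  assumes "j < m" "c0 \<in> Basis"
  shows "pairing m q \<nu> (V((j, c0) := z)) a
    = pairing m q \<nu> (V((j, c0) := 0)) a + a j * \<nu> c0 / real q * real z"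
proof -
  let ?s = "\<lambda>V i. \<Sum>c\<in>Basis. \<nu> c * (real (V (i, c)) / real q)"
  have 1: "?s (V((j, c0) := z)) j = ?s (V((j, c0) := 0)) j + \<nu> c0 / real q * real z"
    using assms(2) by (simp add: sum.remove[of _ c0])
  have "pairing m q \<nu> (V((j, c0) := z)) a = a j * ?s (V((j, c0) := z)) j + (\<Sum>i\<in>{..<m} - {j}. a i * ?s V i)" for z
    unfolding pairing_def using assms(1) by (subst sum.remove[of _ j]) (auto intro!: arg_cong2[where f="(+)"] sum.cong)
  then show ?thesis using 1 by (simp add: algebra_simps)
qed

text \<open>The echelon form replaces independence. The smallest index b is revealed last: all rows
  j > b vanish at b and do not see coordinate (b, c0), whereas row b is affine in it with slope at
  least \<open>\<kappa> / q\<close>. Each row thus contributes one factor.\<close>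

lemma card_echelon_le:
  fixes \<nu> :: "'a::euclidean_space \<Rightarrow> real" and A :: "nat \<Rightarrow> nat \<Rightarrow> int" and \<beta> :: "nat \<Rightarrow> real"
  assumes J: "finite J" "J \<subseteq> {..<m}" and q: "0 < q" and \<eta>: "0 \<le> \<eta>" and \<kappa>: "0 < \<kappa>"
    and c0: "c0 \<in> Basis" "\<kappa> \<le> \<bar>\<nu> c0\<bar>"
    and A: "\<And>j. j \<in> J \<Longrightarrow> A j j \<noteq> 0" "\<And>i j. j \<in> J \<Longrightarrow> i < j \<Longrightarrow> A j i = 0"
  shows "real (card {V \<in> grid_functions m q. \<forall>j\<in>J. \<bar>pairing m q \<nu> V (\<lambda>i. real_of_int (A j i)) + \<beta> j\<bar> \<le> \<eta>})
    \<le> (2 * \<eta> / \<kappa> + 1 / real q) ^ card J * real (card (grid_functions m q :: (nat \<times> 'a \<Rightarrow> nat) set))"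
  using J A
proof (induction J rule: finite_linorder_min_induct)
  case empty
  then show ?case by simp
next
  case (insert b J)
  let ?G = "grid_functions m q :: (nat \<times> 'a \<Rightarrow> nat) set"
  let ?P = "\<lambda>j V. \<bar>pairing m q \<nu> V (\<lambda>i. real_of_int (A j i)) + \<beta> j\<bar> \<le> \<eta>"
  let ?\<rho> = "2 * \<eta> / \<kappa> + 1 / real q"
  have bm: "b < m" using insert.prems by auto
  have r0: "0 \<le> ?\<rho>" using \<eta> \<kappa> by simp
  have Ab: "A b b \<noteq> 0" using insert.prems by simp
  have "1 \<le> \<bar>A b b\<bar>" using Ab by linarith
  then have Ab1: "1 \<le> \<bar>real_of_int (A b b)\<bar>" by linarith
  have IH: "real (card {V \<in> ?G. \<forall>j\<in>J. ?P j V}) \<le> ?\<rho> ^ card J * real (card ?G)"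
    using insert.prems by (intro insert.IH) auto
  \<comment> \<open>Both sides agree with the value at z = 0 in coordinate (b, c0), because the
    coefficient \<open>A j b\<close> is zero.\<close>
  have inv: "(\<forall>j\<in>J. ?P j (V((b, c0) := z))) = (\<forall>j\<in>J. ?P j V)" for V z
  proof (intro ball_cong refl)
    fix j assume j: "j \<in> J"
    then have "A j b = 0" using insert.prems(3) insert.hyps by auto
    then have "pairing m q \<nu> (V((b, c0) := z')) (\<lambda>i. real_of_int (A j i))
        = pairing m q \<nu> (V((b, c0) := 0)) (\<lambda>i. real_of_int (A j i))" for z'
      using pairing_upd[OF bm c0(1), of q \<nu> V z'] by simp
    from this[of z] this[of "V (b, c0)"] show "?P j (V((b, c0) := z)) = ?P j V" by simp
  qed
  have fib: "real (card {z \<in> {..<q}. ?P b (V((b, c0) := z))}) \<le> real q * ?\<rho>" for V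
  proof -
    define y where "y = real_of_int (A b b) * \<nu> c0 / real q"
    have "\<bar>\<nu> c0\<bar> * 1 \<le> \<bar>\<nu> c0\<bar> * \<bar>real_of_int (A b b)\<bar>" using Ab1 by (intro mult_left_mono) auto
    then have y: "\<kappa> / real q \<le> \<bar>y\<bar>" using q c0 by (simp add: y_def abs_mult divide_right_mono mult.commute)
    have kq: "0 < \<kappa> / real q" using \<kappa> q by simp
    have eq: "pairing m q \<nu> (V((b, c0) := z)) (\<lambda>i. real_of_int (A b i)) + \<beta> b
        = (pairing m q \<nu> (V((b, c0) := 0)) (\<lambda>i. real_of_int (A b i)) + \<beta> b) + y * real z" for z
      using pairing_upd[OF bm c0(1), of q \<nu> V z "\<lambda>i. real_of_int (A b i)"] by (simp add: y_def)
    have "{z \<in> {..<q}. ?P b (V((b, c0) := z))} = {z \<in> {..<q}.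
        \<bar>(pairing m q \<nu> (V((b, c0) := 0)) (\<lambda>i. real_of_int (A b i)) + \<beta> b) + y * real z\<bar> \<le> \<eta>}"
      by (subst eq) (rule refl)
    also have "real (card \<dots>) \<le> 2 * \<eta> / \<bar>y\<bar> + 1"
      using y kq \<eta> by (intro card_affine_le) auto
    also have "\<dots> \<le> 2 * \<eta> / (\<kappa> / real q) + 1"
      using y kq \<eta> by (intro add_right_mono divide_left_mono mult_pos_pos) auto
    also have "\<dots> = real q * ?\<rho>" using q \<kappa> by (simp add: field_simps)
    finally show ?thesis .
  qed
  have "real (card {V \<in> ?G. (\<forall>j\<in>J. ?P j V) \<and> ?P b V}) * real (card {..<q})
      \<le> (real q * ?\<rho>) * real (card {V \<in> ?G. \<forall>j\<in>J. ?P j V})"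
    unfolding grid_functions_def
  proof (rule card_PiE_fiber_le[where i = "(b, c0)"])
    show "finite ({..m} \<times> (Basis :: 'a set))" "(b, c0) \<in> {..m} \<times> Basis" using bm c0 by auto
    show "(\<forall>j\<in>J. ?P j (V((b, c0) := z))) = (\<forall>j\<in>J. ?P j V)" for V z by (rule inv)
    show "real (card {z \<in> {..<q}. ?P b (V((b, c0) := z))}) \<le> real q * ?\<rho>" for V by (rule fib)
  qed simp
  then have "real q * real (card {V \<in> ?G. (\<forall>j\<in>J. ?P j V) \<and> ?P b V}) \<le> real q * (?\<rho> * real (card {V \<in> ?G. \<forall>j\<in>J. ?P j V}))"
    by (simp only: card_lessThan mult_ac)
  then have "real (card {V \<in> ?G. (\<forall>j\<in>J. ?P j V) \<and> ?P b V}) \<le> ?\<rho> * real (card {V \<in> ?G. \<forall>j\<in>J. ?P j V})"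
    using q by (simp only: mult_le_cancel_left_pos of_nat_0_less_iff)
  also have "\<dots> \<le> ?\<rho> * (?\<rho> ^ card J * real (card ?G))" by (intro mult_left_mono IH r0)
  also have "\<dots> = ?\<rho> ^ card (insert b J) * real (card ?G)"
    using insert.hyps by (subst card_insert_disjoint) auto
  finally show ?case by (simp add: conj_commute)
qed

text \<open>A point of the translated progression on the torus, in units of 1/q; the reduction
  modulo \<open>q\<close> is the passage to the torus.\<close>

definition grid_point :: "nat \<Rightarrow> nat \<Rightarrow> (nat \<times> 'a::euclidean_space \<Rightarrow> nat) \<Rightarrow> (nat \<Rightarrow> nat) \<Rightarrow> 'a \<Rightarrow> nat" where
  "grid_point m q V a = (\<lambda>c\<in>Basis. (V (m, c) + (\<Sum>i<m. a i * V (i, c))) mod q)"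

section \<open>Uniform distribution and pairwise independence of the points\<close>

lemma nat_eq_of_dvd_diff:
  fixes x y q :: nat
  assumes d: "int q dvd int x - int y" and "x < q" "y < q"
  shows "x = y"
proof (rule ccontr)
  assume "x \<noteq> y"
  then have "int q \<le> \<bar>int x - int y\<bar>" using d by (intro zdvd_imp_le) auto
  then show False using assms by auto
qed

lemma nat_mod_add_right_cancel:
  fixes x y t q :: nat
  assumes "(x + t) mod q = (y + t) mod q" "x < q" "y < q"
  shows "x = y"
proof (rule nat_eq_of_dvd_diff[OF _ assms(2,3)])
  have "int (x + t) mod int q = int (y + t) mod int q"
    using assms(1) by (simp only: zmod_int[symmetric])
  then have "int q dvd int (x + t) - int (y + t)" by (simp only: mod_eq_dvd_iff)
  then show "int q dvd int x - int y" by simp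
qed

text \<open>The translation row m can be recovered from the point and the other rows, so the point
  is exactly uniform on the grid, whatever \<open>a\<close> is.\<close>

lemma card_grid_point_in:
  fixes Q :: "('a::euclidean_space \<Rightarrow> nat) set"
  assumes q: "0 < q" and Q: "Q \<subseteq> PiE Basis (\<lambda>_. {..<q})"
  shows "card {V \<in> grid_functions m q. grid_point m q V a \<in> Q} = card Q * q ^ (m * DIM('a))"
proof -
  let ?G = "grid_functions m q :: (nat \<times> 'a \<Rightarrow> nat) set"
  let ?D = "PiE (Basis :: 'a set) (\<lambda>_. {..<q})" and ?W = "PiE ({..<m} \<times> (Basis :: 'a set)) (\<lambda>_. {..<q})"
  define f where "f = (\<lambda>V :: nat \<times> 'a \<Rightarrow> nat. (grid_point m q V a, restrict V ({..<m} \<times> Basis)))"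
  have inj: "inj_on f ?G"
  proof (rule inj_onI)
    fix V V' assume V: "V \<in> ?G" "V' \<in> ?G" and eq: "f V = f V'"
    have r: "V (i, c) = V' (i, c)" if "i < m" "c \<in> Basis" for i c
      using eq that by (auto simp: f_def dest: fun_cong[where x = "(i, c)"])
    have "V (m, c) = V' (m, c)" if c: "c \<in> Basis" for c
    proof (rule nat_mod_add_right_cancel)
      have "(\<Sum>i<m. a i * V (i, c)) = (\<Sum>i<m. a i * V' (i, c))" using r c by (intro sum.cong) auto
      moreover have "grid_point m q V a c = grid_point m q V' a c" using eq by (simp add: f_def)
      ultimately show "(V (m, c) + (\<Sum>i<m. a i * V (i, c))) mod q = (V' (m, c) + (\<Sum>i<m. a i * V (i, c))) mod q"
        using c by (simp add: grid_point_def)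
      show "V (m, c) < q" "V' (m, c) < q" using V c by (auto simp: grid_functions_def)
    qed
    with r have "V x = V' x" if "x \<in> {..m} \<times> Basis" for x
      using that by (cases x) (auto simp: le_less)
    then show "V = V'" using V by (intro PiE_ext) (auto simp: grid_functions_def)
  qed
  have img: "f ` ?G \<subseteq> ?D \<times> ?W"
  proof
    fix x assume "x \<in> f ` ?G"
    then obtain V where V: "V \<in> PiE ({..m} \<times> (Basis :: 'a set)) (\<lambda>_. {..<q})" "x = f V"
      by (auto simp: grid_functions_def)
    have "grid_point m q V a \<in> ?D" using q by (auto simp: grid_point_def)
    moreover have "restrict V ({..<m} \<times> Basis) \<in> ?W" using PiE_mem[OF V(1)] by (auto simp: restrict_PiE_iff)
    ultimately show "x \<in> ?D \<times> ?W" by (simp add: V(2) f_def)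
  qed
  have "card (?D \<times> ?W) = card ?G"
    by (simp add: card_grid_functions card_cartesian_product card_PiE power_add mult.commute)
  then have surj: "f ` ?G = ?D \<times> ?W"
    using inj img by (intro card_subset_eq) (auto simp: card_image intro!: finite_PiE)
  have "f ` {V \<in> ?G. grid_point m q V a \<in> Q} = Q \<times> ?W"
  proof (intro equalityI subsetI)
    fix x assume "x \<in> f ` {V \<in> ?G. grid_point m q V a \<in> Q}"
    then show "x \<in> Q \<times> ?W" using img by (auto simp: f_def)
  next
    fix x assume x: "x \<in> Q \<times> ?W"
    then have "x \<in> f ` ?G" unfolding surj using Q by blast
    then obtain V where V: "V \<in> ?G" "x = f V" by blast
    then have "grid_point m q V a \<in> Q" using x by (simp add: f_def)
    then show "x \<in> f ` {V \<in> ?G. grid_point m q V a \<in> Q}" using V by blast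
  qed
  then have "card {V \<in> ?G. grid_point m q V a \<in> Q} = card (Q \<times> ?W)"
    using card_image[OF inj_on_subset[OF inj], of "{V \<in> ?G. grid_point m q V a \<in> Q}"] by auto
  then show ?thesis by (simp add: card_cartesian_product card_PiE)
qed

text \<open>Where \<open>a\<close> and \<open>a'\<close> differ at j, their difference is invertible
  modulo the prime \<open>q\<close>. Subtracting the two congruences recovers row j, and then the
  translation row; two points and the remaining rows determine V.\<close>

lemma card_two_grid_points_in:
  fixes Q :: "('a::euclidean_space \<Rightarrow> nat) set"
  assumes q: "prime q" and Q: "Q \<subseteq> PiE Basis (\<lambda>_. {..<q})" and j: "j < m" "a j \<noteq> a' j" "a j < q" "a' j < q"
  shows "card {V \<in> grid_functions m q. grid_point m q V a \<in> Q \<and> grid_point m q V a' \<in> Q}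
    \<le> card Q * card Q * q ^ ((m - 1) * DIM('a))"
proof -
  let ?G = "grid_functions m q :: (nat \<times> 'a \<Rightarrow> nat) set"
  let ?W = "PiE (({..<m} - {j}) \<times> (Basis :: 'a set)) (\<lambda>_. {..<q})"
  define f where "f = (\<lambda>V. ((grid_point m q V a, grid_point m q V a'), restrict V (({..<m} - {j}) \<times> (Basis :: 'a set))))"
  have inj: "inj_on f ?G"
  proof (rule inj_onI)
    fix V V' assume V: "V \<in> ?G" "V' \<in> ?G" and eq: "f V = f V'"
    have lt: "V (i, c) < q" "V' (i, c) < q" if "i \<le> m" "c \<in> Basis" for i c
      using V that by (auto simp: grid_functions_def)
    have r: "V (i, c) = V' (i, c)" if "i < m" "i \<noteq> j" "c \<in> Basis" for i c
      using eq that by (auto simp: f_def dest: fun_cong[where x = "(i, c)"])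
    have dvd: "int q dvd (int (V (m, c)) - int (V' (m, c))) + int (b j) * (int (V (j, c)) - int (V' (j, c)))"
      if c: "c \<in> Basis" and g: "grid_point m q V b = grid_point m q V' b" for b c
    proof -
      let ?t = "\<Sum>i\<in>{..<m} - {j}. b i * V (i, c)"
      have s: "(\<Sum>i<m. b i * V (i, c)) = b j * V (j, c) + ?t"
        using j by (intro sum.remove) auto
      have s': "(\<Sum>i<m. b i * V' (i, c)) = b j * V' (j, c) + ?t"
      proof -
        have "(\<Sum>i<m. b i * V' (i, c)) = b j * V' (j, c) + (\<Sum>i\<in>{..<m} - {j}. b i * V' (i, c))"
          using j by (intro sum.remove) auto
        also have "(\<Sum>i\<in>{..<m} - {j}. b i * V' (i, c)) = ?t" using r c by (intro sum.cong) auto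
        finally show ?thesis .
      qed
      have "(V (m, c) + (b j * V (j, c) + ?t)) mod q = (V' (m, c) + (b j * V' (j, c) + ?t)) mod q"
        using fun_cong[OF g, of c] c by (simp only: grid_point_def restrict_apply' s s')
      then have "int (V (m, c) + (b j * V (j, c) + ?t)) mod int q = int (V' (m, c) + (b j * V' (j, c) + ?t)) mod int q"
        by (simp only: zmod_int[symmetric])
      then have "int q dvd int (V (m, c) + (b j * V (j, c) + ?t)) - int (V' (m, c) + (b j * V' (j, c) + ?t))"
        by (simp only: mod_eq_dvd_iff)
      then show ?thesis by (simp add: algebra_simps)
    qed
    have Vj: "V (j, c) = V' (j, c)" if c: "c \<in> Basis" for c
    proof -
      have "int q dvd (int (a j) - int (a' j)) * (int (V (j, c)) - int (V' (j, c)))"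
        using dvd_diff[OF dvd[OF c, of a] dvd[OF c, of a']] eq by (simp add: f_def algebra_simps)
      then have "int q dvd int (a j) - int (a' j) \<or> int q dvd int (V (j, c)) - int (V' (j, c))"
        using q by (simp add: prime_dvd_mult_iff)
      moreover have "\<not> int q dvd int (a j) - int (a' j)"
        using nat_eq_of_dvd_diff[of q "a j" "a' j"] j by blast
      ultimately have d: "int q dvd int (V (j, c)) - int (V' (j, c))" by blast
      show ?thesis
        using nat_eq_of_dvd_diff[OF d] lt[of j c] j(1) c by simp
    qed
    have Vm: "V (m, c) = V' (m, c)" if c: "c \<in> Basis" for c
    proof -
      have d: "int q dvd int (V (m, c)) - int (V' (m, c))"
        using dvd[OF c, of a] eq Vj[OF c] by (simp add: f_def)
      show ?thesis
        using nat_eq_of_dvd_diff[OF d] lt[of m c] c by simp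
    qed
    have "V x = V' x" if xin: "x \<in> {..m} \<times> Basis" for x
    proof -
      obtain i c where x: "x = (i, c)" "i \<le> m" "c \<in> Basis" using xin by auto
      then consider "i = m" | "i = j" | "i < m" "i \<noteq> j" by linarith
      then show ?thesis by cases (use x r Vj Vm in auto)
    qed
    then show "V = V'" using V by (intro PiE_ext) (auto simp: grid_functions_def)
  qed
  have finQ: "finite Q" using Q by (rule finite_subset) (intro finite_PiE; simp)
  have "card {V \<in> ?G. grid_point m q V a \<in> Q \<and> grid_point m q V a' \<in> Q} \<le> card ((Q \<times> Q) \<times> ?W)"
  proof (rule card_inj_on_le)
    show "inj_on f {V \<in> ?G. grid_point m q V a \<in> Q \<and> grid_point m q V a' \<in> Q}"
      by (rule inj_on_subset[OF inj]) auto
    show "f ` {V \<in> ?G. grid_point m q V a \<in> Q \<and> grid_point m q V a' \<in> Q} \<subseteq> (Q \<times> Q) \<times> ?W"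
    proof
      fix x assume "x \<in> f ` {V \<in> ?G. grid_point m q V a \<in> Q \<and> grid_point m q V a' \<in> Q}"
      then obtain V where V: "V \<in> PiE ({..m} \<times> (Basis :: 'a set)) (\<lambda>_. {..<q})" "x = f V"
        "grid_point m q V a \<in> Q" "grid_point m q V a' \<in> Q"
        by (auto simp: grid_functions_def)
      moreover have "restrict V (({..<m} - {j}) \<times> Basis) \<in> ?W" using PiE_mem[OF V(1)] by (auto simp: restrict_PiE_iff)
      ultimately show "x \<in> (Q \<times> Q) \<times> ?W" by (simp add: f_def)
    qed
    show "finite ((Q \<times> Q) \<times> ?W)" using finQ by (intro finite_cartesian_product finite_PiE) auto
  qed
  also have "\<dots> = card Q * card Q * q ^ ((m - 1) * DIM('a))"
    using j by (simp add: card_cartesian_product card_PiE card_Diff_singleton)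
  finally show ?thesis .
qed

text \<open>Second moment method: with Z the number of hits and \<open>\<lambda>\<close> its mean, the count of V with Z > 0
  is bounded below using \<open>1[Z > 0] \<ge> (4 \<lambda> Z - Z\<^sup>2) / (4 \<lambda>\<^sup>2)\<close>.\<close>

lemma half_hit:
  fixes Q :: "('a::euclidean_space \<Rightarrow> nat) set"
  assumes q: "prime q" "L \<le> q" and Q: "Q \<subseteq> PiE Basis (\<lambda>_. {..<q})" and big: "q ^ DIM('a) \<le> L ^ m * card Q"
  shows "card (grid_functions m q :: (nat \<times> 'a \<Rightarrow> nat) set) \<le>
    2 * card {V \<in> grid_functions m q. \<exists>a\<in>PiE {..<m} (\<lambda>_. {..<L}). grid_point m q V a \<in> Q}"
proof -
  let ?G = "grid_functions m q :: (nat \<times> 'a \<Rightarrow> nat) set" and ?n = "DIM('a)"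
  define A where "A = PiE {..<m} (\<lambda>_. {..<L})"
  have finA: "finite A" unfolding A_def by (intro finite_PiE) auto
  have cardA: "card A = L ^ m" unfolding A_def by (simp add: card_PiE)
  have finG: "finite ?G" by (rule finite_grid_functions)
  have q0: "0 < q" using q(1) by (simp add: prime_gt_0_nat)
  define hit where "hit = (\<lambda>V a. if grid_point m q V a \<in> Q then 1 else (0::real))"
  define Z where "Z = (\<lambda>V. \<Sum>a\<in>A. hit V a)"
  define lam where "lam = real (L ^ m * card Q) / real (q ^ ?n)"
  have lam1: "1 \<le> lam"
  proof -
    have "real (q ^ ?n) \<le> real (L ^ m * card Q)" using big by (simp only: of_nat_le_iff)
    moreover have "0 < real (q ^ ?n)" using q0 by simp
    ultimately show ?thesis unfolding lam_def by (simp only: le_divide_eq_1_pos)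
  qed
  have N: "real (card ?G) = real q ^ ?n * real q ^ (m * ?n)"
    by (simp add: card_grid_functions power_add)
  have one: "(\<Sum>V\<in>?G. hit V a) = real (card Q) * real q ^ (m * ?n)" for a
  proof -
    have "(\<Sum>V\<in>?G. hit V a) = real (card {V \<in> ?G. grid_point m q V a \<in> Q})"
      unfolding hit_def using finG by (simp add: sum.If_cases Int_def)
    then show ?thesis using card_grid_point_in[OF q0 Q, of m a] by simp
  qed
  have S1: "(\<Sum>V\<in>?G. Z V) = lam * real (card ?G)"
  proof -
    have "(\<Sum>V\<in>?G. Z V) = (\<Sum>a\<in>A. \<Sum>V\<in>?G. hit V a)" unfolding Z_def by (rule sum.swap)
    also have "\<dots> = real (L ^ m) * (real (card Q) * real q ^ (m * ?n))" by (simp add: one cardA)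
    also have "\<dots> = lam * real (card ?G)" using q0 unfolding N lam_def by simp
    finally show ?thesis .
  qed
  have two: "(\<Sum>V\<in>?G. hit V a * hit V a') \<le> lam ^ 2 * real (card ?G) / (real (L ^ m))\<^sup>2"
    if a: "a \<in> A" "a' \<in> A" "a \<noteq> a'" for a a'
  proof -
    obtain j where j: "j < m" "a j \<noteq> a' j"
    proof -
      have "\<exists>j\<in>{..<m}. a j \<noteq> a' j"
        using PiE_ext[of a "{..<m}" "\<lambda>_. {..<L}" a'] a unfolding A_def by blast
      then show ?thesis using that by blast
    qed
    have aL: "a j < L" "a' j < L"
      using PiE_mem[OF a(1)[unfolded A_def], of j] PiE_mem[OF a(2)[unfolded A_def], of j] j(1) by simp_all
    then have lt: "a j < q" "a' j < q" and L0: "0 < L" using q(2) by simp_all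
    have "(\<Sum>V\<in>?G. hit V a * hit V a') = (\<Sum>V\<in>?G. if grid_point m q V a \<in> Q \<and> grid_point m q V a' \<in> Q then 1 else 0)"
      by (intro sum.cong) (auto simp: hit_def)
    also have "\<dots> = real (card {V \<in> ?G. grid_point m q V a \<in> Q \<and> grid_point m q V a' \<in> Q})"
      using finG by (simp add: sum.If_cases Int_def)
    also have "\<dots> \<le> real (card Q * card Q * q ^ ((m - 1) * ?n))"
      unfolding of_nat_le_iff by (rule card_two_grid_points_in[OF q(1) Q, of j]) (fact j lt)+
    also have "\<dots> = lam ^ 2 * real (card ?G) / (real (L ^ m))\<^sup>2"
    proof -
      have "q ^ (m * ?n) = q ^ ?n * q ^ ((m - 1) * ?n)"
        using j(1) by (cases m) (auto simp: power_add)
      then have "real q ^ (m * ?n) = real q ^ ?n * real q ^ ((m - 1) * ?n)"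
        by (simp only: of_nat_power[symmetric] of_nat_mult[symmetric])
      then show ?thesis unfolding N lam_def using q0 L0 by (simp add: field_simps power2_eq_square)
    qed
    finally show ?thesis .
  qed
  have S2: "(\<Sum>V\<in>?G. (Z V)\<^sup>2) \<le> lam * real (card ?G) + lam ^ 2 * real (card ?G)"
  proof -
    have "(\<Sum>V\<in>?G. (Z V)\<^sup>2) = (\<Sum>V\<in>?G. \<Sum>a\<in>A. \<Sum>a'\<in>A. hit V a * hit V a')"
      unfolding Z_def power2_eq_square by (simp add: sum_product)
    also have "\<dots> = (\<Sum>a\<in>A. \<Sum>V\<in>?G. \<Sum>a'\<in>A. hit V a * hit V a')" by (rule sum.swap)
    also have "\<dots> = (\<Sum>a\<in>A. \<Sum>a'\<in>A. \<Sum>V\<in>?G. hit V a * hit V a')" by (intro sum.cong refl sum.swap)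
    also have "\<dots> \<le> (\<Sum>a\<in>A. \<Sum>a'\<in>A. (if a = a' then (\<Sum>V\<in>?G. hit V a) else 0) + lam ^ 2 * real (card ?G) / (real (L ^ m))\<^sup>2)"
    proof (intro sum_mono)
      fix a a' assume a: "a \<in> A" "a' \<in> A"
      have nn: "0 \<le> lam ^ 2 * real (card ?G) / (real (L ^ m))\<^sup>2" by simp
      show "(\<Sum>V\<in>?G. hit V a * hit V a') \<le> (if a = a' then (\<Sum>V\<in>?G. hit V a) else 0) + lam ^ 2 * real (card ?G) / (real (L ^ m))\<^sup>2"
      proof (cases "a = a'")
        case True
        have "(\<Sum>V\<in>?G. hit V a * hit V a') = (\<Sum>V\<in>?G. hit V a)" unfolding True by (intro sum.cong) (auto simp: hit_def)
        then show ?thesis using True nn by simp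
      next
        case False then show ?thesis using two[OF a False] by simp
      qed
    qed
    also have "\<dots> = (\<Sum>a\<in>A. (\<Sum>V\<in>?G. hit V a)) + real (card A) * real (card A) * (lam ^ 2 * real (card ?G) / (real (L ^ m))\<^sup>2)"
      using finA by (simp add: sum.distrib)
    also have "(\<Sum>a\<in>A. (\<Sum>V\<in>?G. hit V a)) = lam * real (card ?G)"
      using S1 unfolding Z_def by (subst sum.swap) simp
    also have "real (card A) * real (card A) * (lam ^ 2 * real (card ?G) / (real (L ^ m))\<^sup>2) \<le> lam ^ 2 * real (card ?G)"
      unfolding cardA by (cases "real (L ^ m) = 0") (auto simp: power2_eq_square)
    finally show ?thesis by simp
  qed
  have pt: "(4 * lam * Z V - (Z V)\<^sup>2) / (4 * lam\<^sup>2) \<le> (if \<exists>a\<in>A. grid_point m q V a \<in> Q then 1 else 0)" for V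
  proof (cases "\<exists>a\<in>A. grid_point m q V a \<in> Q")
    case True
    have "0 \<le> (Z V - 2 * lam)\<^sup>2" by simp
    then have "4 * lam * Z V - (Z V)\<^sup>2 \<le> 4 * lam\<^sup>2" by (simp add: power2_eq_square algebra_simps)
    then show ?thesis using True lam1 by simp
  next
    case False
    then have "Z V = 0" unfolding Z_def by (intro sum.neutral) (auto simp: hit_def)
    then show ?thesis using False by simp
  qed
  \<comment> \<open>Here the mean must be at least 1: the diagonal contribution \<open>lam\<close>
    is then at most \<open>lam^2\<close>, and \<open>4 - 1 - 1\<close> over 4 leaves one
    half.\<close>
  have "real (card ?G) / 2 \<le> (4 * lam * (lam * real (card ?G)) - (lam * real (card ?G) + lam ^ 2 * real (card ?G))) / (4 * lam\<^sup>2)"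
  proof -
    have "lam * real (card ?G) * 1 \<le> lam * real (card ?G) * lam" using lam1 by (intro mult_left_mono) auto
    then have "2 * lam\<^sup>2 * real (card ?G) \<le> 4 * lam * (lam * real (card ?G)) - (lam * real (card ?G) + lam ^ 2 * real (card ?G))"
      by (simp add: power2_eq_square algebra_simps)
    then show ?thesis using lam1 by (simp add: field_simps)
  qed
  also have "\<dots> \<le> (4 * lam * (\<Sum>V\<in>?G. Z V) - (\<Sum>V\<in>?G. (Z V)\<^sup>2)) / (4 * lam\<^sup>2)"
    unfolding S1 using S2 by (intro divide_right_mono diff_left_mono) auto
  also have "\<dots> = (\<Sum>V\<in>?G. (4 * lam * Z V - (Z V)\<^sup>2) / (4 * lam\<^sup>2))"
    by (simp add: sum_divide_distrib[symmetric] sum_subtractf sum_distrib_left)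
  also have "\<dots> \<le> (\<Sum>V\<in>?G. (if \<exists>a\<in>A. grid_point m q V a \<in> Q then 1 else 0))" by (intro sum_mono pt)
  also have "\<dots> = real (card {V \<in> ?G. \<exists>a\<in>A. grid_point m q V a \<in> Q})"
    using finG by (simp add: sum.If_cases Int_def)
  finally have "real (card ?G) \<le> real (2 * card {V \<in> ?G. \<exists>a\<in>A. grid_point m q V a \<in> Q})" by simp
  then show ?thesis unfolding A_def by (simp only: of_nat_le_iff)
qed

text \<open>The centre \<open>\<theta>\<close> is free because expanding the kernel asks, for each
  frequency in turn, how many others lie near it in direction \<open>\<nu>\<close>. The part b
  collects integer vectors.\<close>

definition resonant :: "nat \<Rightarrow> nat \<Rightarrow> nat \<Rightarrow> (nat \<times> 'a::euclidean_space \<Rightarrow> nat) \<Rightarrow> real \<Rightarrow> 'a \<Rightarrow> real \<Rightarrow> ((nat \<Rightarrow> nat) \<times> ('a \<Rightarrow> nat)) set" where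
  "resonant m q L V \<eta> \<nu> \<theta> = {(a, b) \<in> PiE {..<m} (\<lambda>_. {..<L}) \<times> PiE Basis (\<lambda>_. {..<L}).
     \<bar>pairing m q (\<lambda>c. \<nu> \<bullet> c) V (\<lambda>i. real (a i)) + (\<Sum>c\<in>Basis. real (b c) * (\<nu> \<bullet> c)) - \<theta>\<bar> \<le> \<eta>}"

text \<open>Of the exponent, DIM('a) is given away to the integer vectors b; what is really demanded
  is that at most \<open>L^d\<close> coefficient vectors occur.\<close>

definition nonresonant :: "nat \<Rightarrow> nat \<Rightarrow> nat \<Rightarrow> nat \<Rightarrow> real \<Rightarrow> (nat \<times> 'a::euclidean_space \<Rightarrow> nat) \<Rightarrow> bool" where
  "nonresonant m q L d \<eta> V \<longleftrightarrow>
     (\<forall>\<nu> \<theta>. norm \<nu> = 1 \<longrightarrow> card (resonant m q L V \<eta> \<nu> \<theta>) \<le> L ^ (DIM('a) + d))"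

lemma pairing_diff: "pairing m q \<nu> V a - pairing m q \<nu> V a' = pairing m q \<nu> V (\<lambda>i. a i - a' i)"
  by (simp add: pairing_def sum_subtractf left_diff_distrib)

text \<open>Justifies replacing a direction by a nearby point of a finite net: every generator has
  coordinates below 1, so each coordinate of the combination is at most
  \<open>(m + 1) * K\<close>.\<close>

lemma pairing_perturb:
  fixes V :: "nat \<times> 'a::euclidean_space \<Rightarrow> nat"
  assumes V: "V \<in> grid_functions m q" and q: "0 < q" and \<nu>: "\<And>c. c \<in> Basis \<Longrightarrow> \<bar>\<nu> c - \<nu>' c\<bar> \<le> \<zeta>"
    and a: "\<And>i. i < m \<Longrightarrow> \<bar>a i\<bar> \<le> K" and b: "\<And>c. c \<in> Basis \<Longrightarrow> \<bar>b c\<bar> \<le> K"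
  shows "\<bar>(pairing m q \<nu> V a + (\<Sum>c\<in>Basis. b c * \<nu> c)) - (pairing m q \<nu>' V a + (\<Sum>c\<in>Basis. b c * \<nu>' c))\<bar>
    \<le> real DIM('a) * ((real m + 1) * K * \<zeta>)"
proof -
  have swap: "pairing m q \<nu> V a = (\<Sum>c\<in>Basis. (\<Sum>i<m. a i * (real (V (i, c)) / real q)) * \<nu> c)" for \<nu>
    unfolding pairing_def by (simp add: sum_distrib_left sum_distrib_right mult_ac sum.swap[of _ "{..<m}"])
  have "(pairing m q \<nu> V a + (\<Sum>c\<in>Basis. b c * \<nu> c)) - (pairing m q \<nu>' V a + (\<Sum>c\<in>Basis. b c * \<nu>' c))
      = (\<Sum>c\<in>Basis. ((\<Sum>i<m. a i * (real (V (i, c)) / real q)) + b c) * (\<nu> c - \<nu>' c))"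
    unfolding swap by (simp add: sum.distrib sum_subtractf algebra_simps)
  also have "\<bar>\<dots>\<bar> \<le> (\<Sum>c\<in>(Basis::'a set). (real m + 1) * K * \<zeta>)"
  proof (intro order_trans[OF sum_abs] sum_mono)
    fix c :: 'a assume c: "c \<in> Basis"
    have "\<bar>\<Sum>i<m. a i * (real (V (i, c)) / real q)\<bar> \<le> (\<Sum>i<m. K)"
    proof (intro order_trans[OF sum_abs] sum_mono)
      fix i assume i: "i \<in> {..<m}"
      have "V (i, c) < q" using V i c by (auto simp: grid_functions_def)
      then have "\<bar>a i\<bar> * (real (V (i, c)) / real q) \<le> K * 1"
        using a[of i] i q by (intro mult_mono) auto
      then show "\<bar>a i * (real (V (i, c)) / real q)\<bar> \<le> K" by (simp add: abs_mult)
    qed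
    then have "\<bar>(\<Sum>i<m. a i * (real (V (i, c)) / real q)) + b c\<bar> \<le> (real m + 1) * K"
      using b[OF c] by (simp add: algebra_simps)
    then show "\<bar>((\<Sum>i<m. a i * (real (V (i, c)) / real q)) + b c) * (\<nu> c - \<nu>' c)\<bar> \<le> (real m + 1) * K * \<zeta>"
      unfolding abs_mult using \<nu>[OF c] by (intro mult_mono) auto
  qed
  finally show ?thesis by simp
qed

text \<open>More than \<open>L^d\<close> coefficient vectors in one slab force d branching levels.
  Each level j yields a difference of two of them with leading index j, so these d differences are
  in echelon form and all pair to at most \<open>2\<eta>\<close> with the direction,
  \<open>3\<eta>\<close> after rounding it to a net. The bound multiplies the net size, the choices
  of levels, the choices of differences and the echelon probability.\<close>

lemma card_not_nonresonant_le:
  assumes q: "0 < q" "1 / \<eta> \<le> real q" and \<eta>: "0 < \<eta>" and L: "1 \<le> L" and Z: "2 * DIM('a) \<le> Z"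
    and fine: "real DIM('a) * ((real m + 1) * real L) / real Z \<le> \<eta>"
  shows "real (card {V \<in> grid_functions m q :: (nat \<times> 'a \<Rightarrow> nat) set. \<not> nonresonant m q L d \<eta> V}) \<le>
    real ((2 * Z + 1) ^ DIM('a)) * 2 ^ m * ((2 * real L) ^ (m + DIM('a)) * (13 * real DIM('a) * \<eta>)) ^ d
      * real (card (grid_functions m q :: (nat \<times> 'a::euclidean_space \<Rightarrow> nat) set))"
proof -
  let ?G = "grid_functions m q :: (nat \<times> 'a \<Rightarrow> nat) set" and ?n = "DIM('a)"
  define I where "I = {- int L<..<int L}"
  define U where "U = PiE {..<m} (\<lambda>_. I) \<times> PiE (Basis :: 'a set) (\<lambda>_. I)"
  define Net where "Net = PiE (Basis :: 'a set) (\<lambda>_. {- int Z..int Z})"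
  define Js where "Js = {J. J \<subseteq> {..<m} \<and> card J = d}"
  define E where "E = (\<lambda>z J (F :: nat \<Rightarrow> (nat \<Rightarrow> int) \<times> ('a \<Rightarrow> int)). {V \<in> ?G. \<forall>j\<in>J.
    \<bar>pairing m q (\<lambda>c. real_of_int (z c) / real Z) V (\<lambda>i. real_of_int (fst (F j) i))
      + (\<Sum>c\<in>Basis. real_of_int (snd (F j) c) * (real_of_int (z c) / real Z))\<bar> \<le> 3 * \<eta>})"
  define T where "T = {(z, J, F). z \<in> Net \<and> J \<in> Js \<and> F \<in> PiE J (\<lambda>_. U) \<and>
     (\<exists>c0\<in>Basis. 1 / (2 * real ?n) \<le> \<bar>real_of_int (z c0) / real Z\<bar>) \<and>
     (\<forall>j\<in>J. fst (F j) j \<noteq> 0 \<and> (\<forall>i<j. fst (F j) i = 0))}"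
  \<comment> \<open>A superset of \<open>T\<close> without the side conditions, in product form so
    that it can be counted.\<close>
  define W where "W = (\<Union>z\<in>Net. \<Union>J\<in>Js. \<Union>F\<in>PiE J (\<lambda>_. U). {(z, J, F)})"
  have n0: "0 < real ?n" by simp
  have Z0: "0 < real Z" using Z DIM_positive[where 'a='a] by linarith
  have finI: "finite I" by (simp add: I_def)
  have finU: "finite U" unfolding U_def using finI by (intro finite_cartesian_product finite_PiE) auto
  have finJs: "finite Js" unfolding Js_def by (rule finite_subset[of _ "Pow {..<m}"]) auto
  have finJ: "finite J" if "J \<in> Js" for J using that by (auto simp: Js_def intro: finite_subset)
  have finNet: "finite Net" unfolding Net_def by (intro finite_PiE) auto
  have TW: "T \<subseteq> W" unfolding T_def W_def by auto
  have cardI: "real (card I) \<le> 2 * real L" by (simp add: I_def)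
  have cardU: "real (card U) \<le> (2 * real L) ^ (m + ?n)"
  proof -
    have "real (card U) = real (card I) ^ (m + ?n)"
      unfolding U_def by (simp add: card_cartesian_product card_PiE power_add)
    also have "\<dots> \<le> (2 * real L) ^ (m + ?n)" by (intro power_mono cardI) auto
    finally show ?thesis .
  qed
  have cardJs: "card Js \<le> 2 ^ m"
  proof -
    have "card Js \<le> card (Pow {..<m})" unfolding Js_def by (intro card_mono) auto
    then show ?thesis by (simp add: card_Pow)
  qed
  have cardNet: "card Net = (2 * Z + 1) ^ ?n" unfolding Net_def by (simp add: card_PiE nat_add_distrib nat_mult_distrib)
  have finW: "finite W" unfolding W_def
    by (intro finite_UN_I finNet finJs finite_PiE finJ finU finite.emptyI finite.insertI) auto
  have "card W \<le> (\<Sum>z\<in>Net. \<Sum>J\<in>Js. \<Sum>F\<in>PiE J (\<lambda>_. U). card {(z, J, F)})"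
    unfolding W_def
  proof (rule order_trans[OF card_UN_le[OF finNet]], rule sum_mono)
    fix z
    show "card (\<Union>J\<in>Js. \<Union>F\<in>PiE J (\<lambda>_. U). {(z, J, F)}) \<le> (\<Sum>J\<in>Js. \<Sum>F\<in>PiE J (\<lambda>_. U). card {(z, J, F)})"
    proof (rule order_trans[OF card_UN_le[OF finJs]], rule sum_mono)
      fix J assume "J \<in> Js"
      then show "card (\<Union>F\<in>PiE J (\<lambda>_. U). {(z, J, F)}) \<le> (\<Sum>F\<in>PiE J (\<lambda>_. U). card {(z, J, F)})"
        by (intro card_UN_le finite_PiE finJ finU)
    qed
  qed
  also have "\<dots> = (\<Sum>z\<in>Net. \<Sum>J\<in>Js. card U ^ d)"
  proof (intro sum.cong refl)
    fix J assume J: "J \<in> Js"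
    have "(\<Sum>F\<in>PiE J (\<lambda>_. U). card {(z, J, F)}) = card (PiE J (\<lambda>_. U))" for z :: "'a \<Rightarrow> int" by simp
    also have "\<dots> = card U ^ d" using J finJ[OF J] by (simp add: card_PiE Js_def)
    finally show "(\<Sum>F\<in>PiE J (\<lambda>_. U). card {(z, J, F)}) = card U ^ d" for z :: "'a \<Rightarrow> int" .
  qed
  also have "\<dots> = card Net * (card Js * card U ^ d)" by simp
  finally have "real (card W) \<le> real (card Net * (card Js * card U ^ d))" by (simp only: of_nat_le_iff)
  also have "\<dots> = real (card Net) * (real (card Js) * real (card U) ^ d)" by simp
  also have "\<dots> \<le> real ((2 * Z + 1) ^ ?n) * (2 ^ m * ((2 * real L) ^ (m + ?n)) ^ d)"
  proof (intro mult_mono power_mono cardU)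
    show "real (card Js) \<le> 2 ^ m" using cardJs by (metis of_nat_le_iff of_nat_numeral of_nat_power)
  qed (simp_all add: cardNet)
  finally have cardW: "real (card W) \<le> real ((2 * Z + 1) ^ ?n) * (2 ^ m * ((2 * real L) ^ (m + ?n)) ^ d)" .
  have cardE: "real (card (E z J F)) \<le> (13 * real ?n * \<eta>) ^ d * real (card ?G)" if T: "(z, J, F) \<in> T" for z J F
  proof -
    obtain c0 where c0: "c0 \<in> Basis" "1 / (2 * real ?n) \<le> \<bar>real_of_int (z c0) / real Z\<bar>"
      using T by (auto simp: T_def)
    have J: "finite J" "J \<subseteq> {..<m}" "card J = d" using T by (auto simp: T_def Js_def intro: finite_subset)
    have "real (card (E z J F)) \<le> (2 * (3 * \<eta>) / (1 / (2 * real ?n)) + 1 / real q) ^ card J * real (card ?G)"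
      unfolding E_def
    proof (rule card_echelon_le[where \<nu> = "\<lambda>c. real_of_int (z c) / real Z" and A = "\<lambda>j. fst (F j)", OF J(1,2) q(1) _ _ c0])
      show "fst (F j) j \<noteq> 0" if "j \<in> J" for j using T that by (auto simp: T_def)
      show "fst (F j) i = 0" if "j \<in> J" "i < j" for i j using T that by (auto simp: T_def)
    qed (use \<eta> n0 in auto)
    \<comment> \<open>13 = 12 + 1: width \<open>3\<eta>\<close> with a coordinate of size at least
      1/(2n) gives \<open>12 n \<eta>\<close>, and the rounding term 1/q is at most
      \<open>n \<eta>\<close>.\<close>
    also have "\<dots> \<le> (13 * real ?n * \<eta>) ^ card J * real (card ?G)"
    proof (intro mult_right_mono power_mono)
      have "1 / real q \<le> \<eta>" using q \<eta> by (simp add: field_simps)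
      also have "\<eta> \<le> real ?n * \<eta>" using \<eta> by simp
      finally show "2 * (3 * \<eta>) / (1 / (2 * real ?n)) + 1 / real q \<le> 13 * real ?n * \<eta>" by (simp add: mult.commute)
    qed (use \<eta> in auto)
    finally show ?thesis using J by simp
  qed
  have bad: "{V \<in> ?G. \<not> nonresonant m q L d \<eta> V} \<subseteq> (\<Union>(z, J, F)\<in>T. E z J F)"
  proof
    fix V assume "V \<in> {V \<in> ?G. \<not> nonresonant m q L d \<eta> V}"
    then obtain \<nu> \<theta> where V: "V \<in> ?G" and \<nu>: "norm \<nu> = 1" and big: "L ^ (?n + d) < card (resonant m q L V \<eta> \<nu> \<theta>)"
      by (auto simp: nonresonant_def not_le)
    define S where "S = resonant m q L V \<eta> \<nu> \<theta>"
    define A where "A = fst ` S"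
    have Ssub: "S \<subseteq> PiE {..<m} (\<lambda>_. {..<L}) \<times> PiE Basis (\<lambda>_. {..<L})" by (auto simp: S_def resonant_def)
    have SD: "fst t \<in> PiE {..<m} (\<lambda>_. {..<L})" "snd t \<in> PiE Basis (\<lambda>_. {..<L})" if "t \<in> S" for t
      using subsetD[OF Ssub that] by (simp_all only: mem_Times_iff)
    have Asub: "A \<subseteq> PiE {..<m} (\<lambda>_. {..<L})" unfolding A_def using SD(1) by (rule image_subsetI)
    have finA: "finite A" using Asub by (rule finite_subset) (intro finite_PiE; simp)
    have "card S \<le> card (A \<times> PiE (Basis :: 'a set) (\<lambda>_. {..<L}))"
    proof (rule card_mono)
      show "finite (A \<times> PiE (Basis :: 'a set) (\<lambda>_. {..<L}))" using finA by (intro finite_cartesian_product finite_PiE) auto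
      show "S \<subseteq> A \<times> PiE (Basis :: 'a set) (\<lambda>_. {..<L})"
        unfolding A_def using SD(2) by (intro subsetI) (simp only: mem_Times_iff imageI)
    qed
    also have "\<dots> = card A * L ^ ?n" by (simp add: card_cartesian_product card_PiE)
    finally have "L ^ (?n + d) < card A * L ^ ?n" using big unfolding S_def by linarith
    then have "L ^ d * L ^ ?n < card A * L ^ ?n" by (simp only: power_add mult.commute)
    then have Abig: "L ^ d < card A" by (simp only: mult_less_cancel2)
    define Jb where "Jb = {j \<in> {..<m}. \<exists>a\<in>A. \<exists>a'\<in>A. (\<forall>i<j. a i = a' i) \<and> a j \<noteq> a' j}"
    have "card A \<le> L ^ card Jb" unfolding Jb_def by (rule card_le_branching[OF Asub L])
    then have "d \<le> card Jb"
    proof -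
      have "\<not> card Jb \<le> d" using Abig \<open>card A \<le> L ^ card Jb\<close> power_increasing[of "card Jb" d L] L by linarith
      then show ?thesis by simp
    qed
    then obtain J where J: "J \<subseteq> Jb" "card J = d" "finite J" by (rule obtain_subset_with_card_n)
    have "\<forall>j\<in>J. \<exists>s s'. s \<in> S \<and> s' \<in> S \<and> (\<forall>i<j. fst s i = fst s' i) \<and> fst s j \<noteq> fst s' j"
      using J(1) unfolding Jb_def A_def by blast
    then obtain s s' where s: "\<And>j. j \<in> J \<Longrightarrow> s j \<in> S" "\<And>j. j \<in> J \<Longrightarrow> s' j \<in> S"
      "\<And>i j. j \<in> J \<Longrightarrow> i < j \<Longrightarrow> fst (s j) i = fst (s' j) i" "\<And>j. j \<in> J \<Longrightarrow> fst (s j) j \<noteq> fst (s' j) j"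
      by metis
    \<comment> \<open>Subtraction removes the unknown \<open>\<theta>\<close> and leaves zeros
      before position j, where the two elements first differ.\<close>
    define F where "F = (\<lambda>j\<in>J. ((\<lambda>i\<in>{..<m}. int (fst (s j) i) - int (fst (s' j) i)),
      (\<lambda>c\<in>(Basis :: 'a set). int (snd (s j) c) - int (snd (s' j) c))))"
    define z where "z = (\<lambda>c\<in>Basis. \<lfloor>(\<nu> \<bullet> c) * real Z\<rfloor>)"
    have \<nu>1: "\<bar>\<nu> \<bullet> c\<bar> \<le> 1" if "c \<in> Basis" for c using Basis_le_norm[OF that, of \<nu>] \<nu> by simp
    have zc: "\<bar>\<nu> \<bullet> c - real_of_int (z c) / real Z\<bar> \<le> 1 / real Z" if c: "c \<in> Basis" for c
    proof -
      have "\<bar>(\<nu> \<bullet> c) * real Z - real_of_int (z c)\<bar> \<le> 1" using c unfolding z_def by simp linarith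
      then have "\<bar>((\<nu> \<bullet> c) * real Z - real_of_int (z c)) / real Z\<bar> \<le> 1 / real Z"
        using Z0 by (simp add: divide_right_mono)
      moreover have "((\<nu> \<bullet> c) * real Z - real_of_int (z c)) / real Z = \<nu> \<bullet> c - real_of_int (z c) / real Z"
        using Z0 by (simp add: field_simps)
      ultimately show ?thesis by simp
    qed
    have zNet: "z \<in> Net"
      unfolding Net_def
    proof (rule PiE_I)
      fix c :: 'a assume c: "c \<in> Basis"
      have "\<bar>(\<nu> \<bullet> c) * real Z\<bar> \<le> 1 * real Z" unfolding abs_mult using \<nu>1[OF c] by (intro mult_mono) auto
      then have "- real Z \<le> (\<nu> \<bullet> c) * real Z" "(\<nu> \<bullet> c) * real Z \<le> real Z" by linarith+
      then have "- int Z \<le> \<lfloor>(\<nu> \<bullet> c) * real Z\<rfloor>" "\<lfloor>(\<nu> \<bullet> c) * real Z\<rfloor> \<le> int Z"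
        by (simp_all add: le_floor_iff) (metis floor_mono floor_of_nat)
      then show "z c \<in> {- int Z..int Z}" using c by (simp add: z_def)
    qed (simp add: z_def)
    \<comment> \<open>The coordinates of a unit vector have absolute values summing to at least 1.
      Rounding costs at most 1/Z, hence the 1/(2n) that follows.\<close>
    obtain c0 :: 'a where c0: "c0 \<in> Basis" "1 / real ?n \<le> \<bar>\<nu> \<bullet> c0\<bar>"
    proof (rule ccontr)
      assume "\<not> thesis"
      then have "\<bar>\<nu> \<bullet> c\<bar> < 1 / real ?n" if "c \<in> Basis" for c using that \<open>\<And>c0. c0 \<in> Basis \<Longrightarrow> 1 / real ?n \<le> \<bar>\<nu> \<bullet> c0\<bar> \<Longrightarrow> thesis\<close> not_less by blast
      then have "(\<Sum>c\<in>Basis. \<bar>\<nu> \<bullet> c\<bar>) < (\<Sum>c\<in>(Basis :: 'a set). 1 / real ?n)" by (intro sum_strict_mono) auto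
      then show False using norm_le_l1[of \<nu>] \<nu> by simp
    qed
    have c0z: "1 / (2 * real ?n) \<le> \<bar>real_of_int (z c0) / real Z\<bar>"
    proof -
      have "1 / real Z \<le> 1 / (2 * real ?n)" using Z Z0 by (intro divide_left_mono) auto
      moreover have "1 / real ?n = 1 / (2 * real ?n) + 1 / (2 * real ?n)" by simp
      ultimately show ?thesis using zc[OF c0(1)] c0(2) by linarith
    qed
    have FU: "F j \<in> U" if "j \<in> J" for j
    proof -
      have "- int L < int (fst (s j) i) - int (fst (s' j) i) \<and> int (fst (s j) i) - int (fst (s' j) i) < int L" if "i < m" for i
        using PiE_mem[OF SD(1)[OF s(1)[OF \<open>j \<in> J\<close>]], of i] PiE_mem[OF SD(1)[OF s(2)[OF \<open>j \<in> J\<close>]], of i] that by simp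
      moreover have "- int L < int (snd (s j) c) - int (snd (s' j) c) \<and> int (snd (s j) c) - int (snd (s' j) c) < int L"
        if c: "c \<in> Basis" for c
      proof -
        have "snd (s j) c < L" "snd (s' j) c < L"
          using PiE_mem[OF SD(2)[OF s(1)[OF \<open>j \<in> J\<close>]] c] PiE_mem[OF SD(2)[OF s(2)[OF \<open>j \<in> J\<close>]] c] by simp_all
        then show ?thesis by auto
      qed
      ultimately show ?thesis using that by (simp add: F_def U_def I_def)
    qed
    have Jm: "J \<subseteq> {..<m}" using J(1) by (auto simp: Jb_def)
    have "(z, J, F) \<in> T"
      unfolding T_def
    proof (clarsimp, intro conjI)
      show "z \<in> Net" by (rule zNet)
      show "J \<in> Js" using Jm J by (simp add: Js_def)
      show "F \<in> J \<rightarrow>\<^sub>E U" using FU by (auto simp: F_def)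
      show "\<exists>c0\<in>Basis. 1 / (2 * real ?n) \<le> \<bar>real_of_int (z c0)\<bar> / real Z" using c0 c0z by auto
      show "\<forall>j\<in>J. fst (F j) j \<noteq> 0 \<and> (\<forall>i<j. fst (F j) i = 0)"
        using s(3,4) Jm by (force simp: F_def)
    qed
    moreover have "V \<in> E z J F"
      unfolding E_def
    proof (clarsimp simp: V)
      fix j assume j: "j \<in> J"
      let ?b = "\<lambda>c. real_of_int (snd (F j) c)" and ?a = "\<lambda>i. real_of_int (fst (F j) i)"
      let ?\<nu> = "\<lambda>c. \<nu> \<bullet> c" and ?\<nu>' = "\<lambda>c. real_of_int (z c) / real Z"
      have r: "\<bar>pairing m q ?\<nu> V (\<lambda>i. real (fst t i)) + (\<Sum>c\<in>Basis. real (snd t c) * (\<nu> \<bullet> c)) - \<theta>\<bar> \<le> \<eta>" if "t \<in> S" for t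
        using that by (auto simp: S_def resonant_def)
      have p1: "pairing m q ?\<nu> V ?a = pairing m q ?\<nu> V (\<lambda>i. real (fst (s j) i)) - pairing m q ?\<nu> V (\<lambda>i. real (fst (s' j) i))"
        unfolding pairing_diff unfolding pairing_def using j by (intro sum.cong) (auto simp: F_def)
      have p2: "(\<Sum>c\<in>Basis. ?b c * ?\<nu> c) = (\<Sum>c\<in>Basis. real (snd (s j) c) * (\<nu> \<bullet> c)) - (\<Sum>c\<in>Basis. real (snd (s' j) c) * (\<nu> \<bullet> c))"
        unfolding sum_subtractf[symmetric] using j by (intro sum.cong) (auto simp: F_def left_diff_distrib)
      have near: "\<bar>pairing m q ?\<nu> V ?a + (\<Sum>c\<in>Basis. ?b c * ?\<nu> c)\<bar> \<le> 2 * \<eta>"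
        unfolding p1 p2 using r[OF s(1)[OF j]] r[OF s(2)[OF j]] by linarith
      have "\<bar>(pairing m q ?\<nu> V ?a + (\<Sum>c\<in>Basis. ?b c * ?\<nu> c)) - (pairing m q ?\<nu>' V ?a + (\<Sum>c\<in>Basis. ?b c * ?\<nu>' c))\<bar>
          \<le> real ?n * ((real m + 1) * real L * (1 / real Z))"
      proof (rule pairing_perturb[OF V q(1) zc])
        have FjU: "fst (F j) \<in> PiE {..<m} (\<lambda>_. I)" "snd (F j) \<in> PiE Basis (\<lambda>_. I)"
          using FU[OF j] by (auto simp: U_def mem_Times_iff)
        show "\<bar>?a i\<bar> \<le> real L" if "i < m" for i
          using PiE_mem[OF FjU(1), of i] that by (auto simp: I_def)
        show "\<bar>?b c\<bar> \<le> real L" if "c \<in> Basis" for c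
          using PiE_mem[OF FjU(2), of c] that by (auto simp: I_def)
      qed
      also have "\<dots> \<le> \<eta>" using fine by simp
      finally show "\<bar>pairing m q ?\<nu>' V ?a + (\<Sum>c\<in>Basis. ?b c * real_of_int (z c) / real Z)\<bar> \<le> 3 * \<eta>"
        using near by simp
    qed
    ultimately show "V \<in> (\<Union>(z, J, F)\<in>T. E z J F)" by blast
  qed
  have finT: "finite T" using finite_subset[OF TW finW] .
  have finE: "finite (E z J F)" for z J F
    unfolding E_def by (rule finite_subset[OF _ finite_grid_functions]) blast
  have "card {V \<in> ?G. \<not> nonresonant m q L d \<eta> V} \<le> card (\<Union>(z, J, F)\<in>T. E z J F)"
    using bad finT finE by (intro card_mono) auto
  also have "\<dots> \<le> (\<Sum>(z, J, F)\<in>T. card (E z J F))"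
    using card_UN_le[OF finT, of "\<lambda>(z, J, F). E z J F"] by (simp add: case_prod_beta)
  finally have "real (card {V \<in> ?G. \<not> nonresonant m q L d \<eta> V}) \<le> (\<Sum>(z, J, F)\<in>T. real (card (E z J F)))"
    by (simp add: case_prod_beta flip: of_nat_sum)
  also have "\<dots> \<le> (\<Sum>t\<in>T. (13 * real ?n * \<eta>) ^ d * real (card ?G))"
    by (intro sum_mono) (use cardE in auto)
  also have "\<dots> = real (card T) * ((13 * real ?n * \<eta>) ^ d * real (card ?G))" by simp
  also have "\<dots> \<le> (real ((2 * Z + 1) ^ ?n) * (2 ^ m * ((2 * real L) ^ (m + ?n)) ^ d)) * ((13 * real ?n * \<eta>) ^ d * real (card ?G))"
  proof (intro mult_right_mono)
    have "card T \<le> card W" by (rule card_mono[OF finW TW])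
    then show "real (card T) \<le> real ((2 * Z + 1) ^ ?n) * (2 ^ m * ((2 * real L) ^ (m + ?n)) ^ d)"
      using cardW by linarith
  qed (use \<eta> in auto)
  also have "\<dots> = real ((2 * Z + 1) ^ ?n) * 2 ^ m * ((2 * real L) ^ (m + ?n) * (13 * real ?n * \<eta>)) ^ d * real (card ?G)"
    unfolding power_mult_distrib[of "(2 * real L) ^ (m + ?n)" "13 * real ?n * \<eta>" d] by (simp only: mult_ac)
  finally show ?thesis .
qed

text \<open>First moment: on average at least half of the targets are hit. The V excluded by
  resonance are at most a quarter of all and account for at most a quarter of the targets, so some
  remaining V hits a quarter.\<close>

lemma exists_nonresonant_hitting:
  fixes Q :: "'i \<Rightarrow> ('a::euclidean_space \<Rightarrow> nat) set"
  assumes q: "prime q" "1 / \<eta> \<le> real q" "L \<le> q" and \<eta>: "0 < \<eta>" and L: "1 \<le> L" and Z: "2 * DIM('a) \<le> Z"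
    and fine: "real DIM('a) * ((real m + 1) * real L) / real Z \<le> \<eta>"
    and small: "real ((2 * Z + 1) ^ DIM('a)) * 2 ^ m * ((2 * real L) ^ (m + DIM('a)) * (13 * real DIM('a) * \<eta>)) ^ d \<le> 1 / 4"
    and I: "finite I" and Q: "\<And>i. i \<in> I \<Longrightarrow> Q i \<subseteq> PiE Basis (\<lambda>_. {..<q})"
      "\<And>i. i \<in> I \<Longrightarrow> q ^ DIM('a) \<le> L ^ m * card (Q i)"
  obtains V where "V \<in> grid_functions m q" "nonresonant m q L d \<eta> V"
    "card I \<le> 4 * card {i \<in> I. \<exists>a\<in>PiE {..<m} (\<lambda>_. {..<L}). grid_point m q V a \<in> Q i}"
proof -
  let ?G = "grid_functions m q :: (nat \<times> 'a \<Rightarrow> nat) set"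
  let ?hit = "\<lambda>V i. \<exists>a\<in>PiE {..<m} (\<lambda>_. {..<L}). grid_point m q V a \<in> Q i"
  let ?h = "\<lambda>V. real (card {i \<in> I. ?hit V i})"
  have q0: "0 < q" using q(1) by (simp add: prime_gt_0_nat)
  have finG: "finite ?G" by (rule finite_grid_functions)
  have Gne: "0 < card ?G" using q0 by (simp add: card_grid_functions)
  have sum_h: "(\<Sum>V\<in>?G. ?h V) \<ge> real (card I) * real (card ?G) / 2"
  proof -
    have "(\<Sum>V\<in>?G. ?h V) = (\<Sum>V\<in>?G. \<Sum>i\<in>I. if ?hit V i then 1 else 0)"
      using I by (intro sum.cong refl) (simp add: sum.If_cases Int_def)
    also have "\<dots> = (\<Sum>i\<in>I. \<Sum>V\<in>?G. if ?hit V i then 1 else 0)" by (rule sum.swap)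
    also have "\<dots> = (\<Sum>i\<in>I. real (card {V \<in> ?G. ?hit V i}))"
      using finG by (intro sum.cong refl) (simp add: sum.If_cases Int_def)
    also have "\<dots> \<ge> (\<Sum>i\<in>I. real (card ?G) / 2)"
    proof (rule sum_mono)
      fix i assume i: "i \<in> I"
      have "card ?G \<le> 2 * card {V \<in> ?G. ?hit V i}" by (rule half_hit[OF q(1,3) Q(1)[OF i] Q(2)[OF i]])
      then show "real (card ?G) / 2 \<le> real (card {V \<in> ?G. ?hit V i})" by linarith
    qed
    finally show ?thesis by simp
  qed
  have bad: "real (card {V \<in> ?G. \<not> nonresonant m q L d \<eta> V}) \<le> real (card ?G) / 4"
  proof -
    have "real (card {V \<in> ?G. \<not> nonresonant m q L d \<eta> V}) \<le> 1 / 4 * real (card ?G)"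
      by (rule order_trans[OF card_not_nonresonant_le[OF q0 q(2) \<eta> L Z fine] mult_right_mono[OF small]]) simp
    then show ?thesis by simp
  qed
  have "\<exists>V\<in>?G. nonresonant m q L d \<eta> V \<and> card I \<le> 4 * card {i \<in> I. ?hit V i}"
  proof (rule ccontr)
    assume "\<not> ?thesis"
    then have lt: "4 * card {i \<in> I. ?hit V i} < card I" if "V \<in> ?G" "nonresonant m q L d \<eta> V" for V
      using that by (meson not_le)
    have le: "?h V \<le> (if nonresonant m q L d \<eta> V then real (card I) / 4 else real (card I))" if "V \<in> ?G" for V
    proof (cases "nonresonant m q L d \<eta> V")
      case True then show ?thesis using lt[OF that True] by simp
    next
      case False then show ?thesis using I by (simp add: card_mono)
    qed
    have c: "card {V \<in> ?G. nonresonant m q L d \<eta> V} + card {V \<in> ?G. \<not> nonresonant m q L d \<eta> V} = card ?G"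
    proof -
      have "card ({V \<in> ?G. nonresonant m q L d \<eta> V} \<union> {V \<in> ?G. \<not> nonresonant m q L d \<eta> V})
          = card {V \<in> ?G. nonresonant m q L d \<eta> V} + card {V \<in> ?G. \<not> nonresonant m q L d \<eta> V}"
        using finG by (intro card_Un_disjoint) auto
      moreover have "{V \<in> ?G. nonresonant m q L d \<eta> V} \<union> {V \<in> ?G. \<not> nonresonant m q L d \<eta> V} = ?G" by auto
      ultimately show ?thesis by simp
    qed
    \<comment> \<open>Needed for strictness: the two averages could otherwise be equal.\<close>
    have ne: "{V \<in> ?G. nonresonant m q L d \<eta> V} \<noteq> {}"
    proof
      assume "{V \<in> ?G. nonresonant m q L d \<eta> V} = {}"
      then have "card ?G = card {V \<in> ?G. \<not> nonresonant m q L d \<eta> V}" using c by (simp only: card.empty)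
      then show False using bad Gne by simp
    qed
    then obtain V0 where V0: "V0 \<in> ?G" "nonresonant m q L d \<eta> V0" by blast
    have "(\<Sum>V\<in>?G. ?h V) < (\<Sum>V\<in>?G. if nonresonant m q L d \<eta> V then real (card I) / 4 else real (card I))"
    proof (rule sum_strict_mono_ex1[OF finG])
      show "\<forall>V\<in>?G. ?h V \<le> (if nonresonant m q L d \<eta> V then real (card I) / 4 else real (card I))" using le by blast
      show "\<exists>V\<in>?G. ?h V < (if nonresonant m q L d \<eta> V then real (card I) / 4 else real (card I))"
        using V0 lt[OF V0] by (intro bexI[of _ V0]) auto
    qed
    also have "\<dots> = real (card {V \<in> ?G. nonresonant m q L d \<eta> V}) * (real (card I) / 4)
        + real (card {V \<in> ?G. \<not> nonresonant m q L d \<eta> V}) * real (card I)"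
      using finG by (simp add: sum.If_cases Int_def Diff_eq Collect_neg_eq[symmetric])
    also have "\<dots> \<le> real (card ?G) * (real (card I) / 4) + (real (card ?G) / 4) * real (card I)"
      using bad c by (intro add_mono mult_right_mono) auto
    finally show False using sum_h by (simp add: field_simps)
  qed
  then show ?thesis using that by blast
qed

section \<open>Bohr sets and tubes\<close>

definition bohr_set :: "'j set \<Rightarrow> ('j \<Rightarrow> 'a::euclidean_space) \<Rightarrow> real \<Rightarrow> 'a set" where
  "bohr_set J u \<epsilon> = {x. \<forall>j\<in>J. \<exists>k::int. \<bar>x \<bullet> u j - of_int k\<bar> \<le> \<epsilon>}"

lemma bohr_set_borel [measurable]: "finite J \<Longrightarrow> bohr_set J u \<epsilon> \<in> sets borel"
proof -
  assume J: "finite J"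
  have "bohr_set J u \<epsilon> = (\<Inter>j\<in>J. \<Union>k::int. {x. \<bar>x \<bullet> u j - of_int k\<bar> \<le> \<epsilon>}) \<inter> UNIV" (is "_ = ?R")
    by (auto simp: bohr_set_def)
  also have "?R \<in> sets borel"
  proof (cases "J = {}")
    case False
    have "closed {x. \<bar>x \<bullet> u j - of_int k\<bar> \<le> \<epsilon>}" for j and k :: int
      by (intro closed_Collect_le continuous_intros)
    then show ?thesis using J False by (intro sets.Int sets.finite_INT sets.countable_UN'') auto
  qed simp
  finally show ?thesis .
qed

lemma prod_cis: "finite J \<Longrightarrow> (\<Prod>j\<in>J. cis (f j)) = cis (\<Sum>j\<in>J. f j)"
  by (induction J rule: finite_induct) (auto simp: cis_mult)

text \<open>Up to normalisation its squared modulus is a product of Fejer kernels, one in each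
  \<open>x \<bullet> u j\<close>.\<close>

definition trig_sum :: "'j set \<Rightarrow> nat \<Rightarrow> ('j \<Rightarrow> 'a::euclidean_space) \<Rightarrow> 'a \<Rightarrow> complex" where
  "trig_sum J L u x = (\<Sum>a\<in>PiE J (\<lambda>_. {..<L}). cis (2 * pi * (\<Sum>j\<in>J. real (a j) * (x \<bullet> u j))))"

lemma trig_sum_prod:
  assumes "finite J"
  shows "trig_sum J L u x = (\<Prod>j\<in>J. \<Sum>t<L. cis (2 * pi * (real t * (x \<bullet> u j))))"
proof -
  have "(\<Prod>j\<in>J. \<Sum>t<L. cis (2 * pi * (real t * (x \<bullet> u j)))) =
      (\<Sum>a\<in>PiE J (\<lambda>_. {..<L}). \<Prod>j\<in>J. cis (2 * pi * (real (a j) * (x \<bullet> u j))))"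
    using assms by (intro prod_sum_PiE) auto
  then show ?thesis using assms by (simp add: trig_sum_def prod_cis sum_distrib_left)
qed

lemma cos_ge_half: assumes "\<bar>x\<bar> \<le> pi / 3" shows "1 / 2 \<le> cos x"
proof -
  have "cos (pi / 3) \<le> cos \<bar>x\<bar>" using assms pi_ge_zero by (intro cos_monotone_0_pi_le) auto
  then show ?thesis by (simp add: cos_60)
qed

text \<open>All phases stay within a sixth of a turn of an integer, so every term has real part at
  least 1/2.\<close>

lemma cis_sum_ge:
  fixes y \<epsilon> :: real and k :: int
  assumes y: "\<bar>y - of_int k\<bar> \<le> \<epsilon>" and \<epsilon>: "8 * real L * \<epsilon> \<le> 1"
  shows "real L / 2 \<le> cmod (\<Sum>t<L. cis (2 * pi * (real t * y)))"
proof -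
  have "real L / 2 = (\<Sum>t<L. 1/2)" by simp
  also have "\<dots> \<le> (\<Sum>t<L. Re (cis (2 * pi * (real t * y))))"
  proof (rule sum_mono)
    fix t assume t: "t \<in> {..<L}"
    have "\<bar>real t * (y - of_int k)\<bar> \<le> real L * \<epsilon>"
      unfolding abs_mult using t y by (intro mult_mono) auto
    then have "\<bar>real t * (y - of_int k)\<bar> \<le> 1 / 6" using \<epsilon> by linarith
    then have "\<bar>2 * pi * (real t * (y - of_int k))\<bar> \<le> pi / 3"
      by (simp add: abs_mult)
    then have "1 / 2 \<le> cos (2 * pi * (real t * (y - of_int k)))" by (rule cos_ge_half)
    also have "2 * pi * (real t * (y - of_int k)) = 2 * pi * (real t * y) - 2 * pi * of_int (int t * k)"
      by (simp add: algebra_simps)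
    also have "cos \<dots> = cos (2 * pi * (real t * y))"
      using cos_int_2pin[of "int t * k"] sin_int_2pin[of "int t * k"] by (simp add: cos_diff)
    finally show "1 / 2 \<le> Re (cis (2 * pi * (real t * y)))" by simp
  qed
  also have "\<dots> = Re (\<Sum>t<L. cis (2 * pi * (real t * y)))" by simp
  also have "\<dots> \<le> cmod (\<Sum>t<L. cis (2 * pi * (real t * y)))" by (rule complex_Re_le_cmod)
  finally show ?thesis .
qed

lemma trig_sum_bohr_ge:
  assumes J: "finite J" and x: "x \<in> bohr_set J u \<epsilon>" and \<epsilon>: "8 * real L * \<epsilon> \<le> 1"
  shows "(real L / 2) ^ card J \<le> cmod (trig_sum J L u x)"
proof -
  have "(real L / 2) ^ card J = (\<Prod>j\<in>J. real L / 2)" by simp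
  also have "\<dots> \<le> (\<Prod>j\<in>J. cmod (\<Sum>t<L. cis (2 * pi * (real t * (x \<bullet> u j)))))"
  proof (rule prod_mono)
    fix j assume "j \<in> J"
    then obtain k :: int where "\<bar>x \<bullet> u j - of_int k\<bar> \<le> \<epsilon>" using x by (auto simp: bohr_set_def)
    from cis_sum_ge[OF this \<epsilon>]
    show "0 \<le> real L / 2 \<and> real L / 2 \<le> cmod (\<Sum>t<L. cis (2 * pi * (real t * (x \<bullet> u j))))" by simp
  qed
  also have "\<dots> = cmod (trig_sum J L u x)" using J by (simp add: trig_sum_prod prod_norm)
  finally show ?thesis .
qed

section \<open>Gaussian averages of the kernel along a line\<close>

abbreviation gauss :: "real measure" where "gauss \<equiv> std_normal_distribution"

interpretation gauss: prob_space gauss by (rule prob_space_normal_density) simp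

lemma integrable_gauss_cis: "integrable gauss (\<lambda>z. cis (\<alpha> + t * z))"
proof (rule gauss.integrable_const_bound[where B = 1])
  show "AE z in gauss. norm (cis (\<alpha> + t * z)) \<le> 1" by simp
  have "continuous_on UNIV (\<lambda>z. cis (\<alpha> + t * z))" by (intro continuous_intros)
  then show "(\<lambda>z. cis (\<alpha> + t * z)) \<in> borel_measurable gauss"
    by (simp add: borel_measurable_continuous_onI)
qed

lemma norm_gauss_cis_integral: "cmod (LINT z|gauss. cis (\<alpha> + t * z)) = exp (- t\<^sup>2 / 2)"
proof -
  have "(LINT z|gauss. cis (\<alpha> + t * z)) = (LINT z|gauss. cis \<alpha> * cis (t * z))" by (simp add: cis_mult)
  also have "\<dots> = cis \<alpha> * (LINT z|gauss. cis (t * z))" by simp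
  also have "(LINT z|gauss. cis (t * z)) = char gauss t"
    unfolding char_def by (intro Bochner_Integration.integral_cong) (auto simp: cis_conv_exp)
  finally show ?thesis by (simp add: char_std_normal_distribution norm_mult)
qed

text \<open>Expanding the square gives one Gaussian characteristic function for every pair of
  frequencies: at most 1 when they are within \<open>\<eta>\<close> in direction
  \<open>\<nu>\<close>, and at most \<open>exp (- (R * \<eta>)\<^sup>2)\<close> otherwise. The
  Gaussian weight makes the far pairs negligible, which the slow decay of a sharp cutoff would
  not.\<close>

lemma gauss_average_trig_sum_le:
  fixes \<nu> x :: "'a::euclidean_space"
  assumes J: "finite J" and cnt: "\<And>\<theta>. card {a \<in> PiE J (\<lambda>_. {..<L}). \<bar>(\<Sum>j\<in>J. real (a j) * (\<nu> \<bullet> u j)) - \<theta>\<bar> \<le> \<eta>} \<le> Cnt"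
    and R: "0 \<le> R" and \<eta>: "0 \<le> \<eta>"
  shows "integrable gauss (\<lambda>z. (cmod (trig_sum J L u (x + (R * z) *\<^sub>R \<nu>)))\<^sup>2)"
    "(LINT z|gauss. (cmod (trig_sum J L u (x + (R * z) *\<^sub>R \<nu>)))\<^sup>2)
      \<le> real L ^ card J * (real Cnt + real L ^ card J * exp (- (R * \<eta>)\<^sup>2))"
proof -
  define A where "A = PiE J (\<lambda>_. {..<L})"
  have finA: "finite A" unfolding A_def using J by (intro finite_PiE) auto
  have cardA: "card A = L ^ card J" unfolding A_def using J by (simp add: card_PiE)
  define \<phi> where "\<phi> = (\<lambda>a. 2 * pi * (\<Sum>j\<in>J. real (a j) * (x \<bullet> u j)))"
  define \<theta> where "\<theta> = (\<lambda>a. \<Sum>j\<in>J. real (a j) * (\<nu> \<bullet> u j))"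
  have tr: "trig_sum J L u (x + (R * z) *\<^sub>R \<nu>) = (\<Sum>a\<in>A. cis (\<phi> a + 2 * pi * R * \<theta> a * z))" for z
    unfolding trig_sum_def A_def[symmetric]
  proof (intro sum.cong refl arg_cong[where f = cis])
    fix a
    have "(\<Sum>j\<in>J. real (a j) * ((x + (R * z) *\<^sub>R \<nu>) \<bullet> u j)) = (\<Sum>j\<in>J. real (a j) * (x \<bullet> u j)) + R * z * \<theta> a"
      unfolding \<theta>_def by (simp add: inner_add_left sum.distrib sum_distrib_left algebra_simps)
    then show "2 * pi * (\<Sum>j\<in>J. real (a j) * ((x + (R * z) *\<^sub>R \<nu>) \<bullet> u j)) = \<phi> a + 2 * pi * R * \<theta> a * z"
      by (simp add: \<phi>_def algebra_simps)
  qed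
  have sq: "complex_of_real ((cmod (trig_sum J L u (x + (R * z) *\<^sub>R \<nu>)))\<^sup>2)
      = (\<Sum>a\<in>A. \<Sum>a'\<in>A. cis ((\<phi> a - \<phi> a') + (2 * pi * R * (\<theta> a - \<theta> a')) * z))" for z
  proof -
    have "complex_of_real ((cmod (trig_sum J L u (x + (R * z) *\<^sub>R \<nu>)))\<^sup>2)
        = (\<Sum>a\<in>A. cis (\<phi> a + 2 * pi * R * \<theta> a * z)) * cnj (\<Sum>a\<in>A. cis (\<phi> a + 2 * pi * R * \<theta> a * z))"
      unfolding tr by (rule complex_norm_square)
    also have "\<dots> = (\<Sum>a\<in>A. \<Sum>a'\<in>A. cis (\<phi> a + 2 * pi * R * \<theta> a * z) * cis (- (\<phi> a' + 2 * pi * R * \<theta> a' * z)))"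
      by (simp add: sum_product cis_cnj)
    also have "\<dots> = (\<Sum>a\<in>A. \<Sum>a'\<in>A. cis ((\<phi> a - \<phi> a') + (2 * pi * R * (\<theta> a - \<theta> a')) * z))"
      by (intro sum.cong refl) (simp add: cis_mult algebra_simps)
    finally show ?thesis .
  qed
  have int: "integrable gauss (\<lambda>z. complex_of_real ((cmod (trig_sum J L u (x + (R * z) *\<^sub>R \<nu>)))\<^sup>2))"
    unfolding sq by (intro Bochner_Integration.integrable_sum integrable_gauss_cis)
  show int': "integrable gauss (\<lambda>z. (cmod (trig_sum J L u (x + (R * z) *\<^sub>R \<nu>)))\<^sup>2)"
    using integrable_Re[OF int] by simp
  \<comment> \<open>For a fixed frequency the near ones are counted by \<open>cnt\<close> with
    centre \<open>\<theta> a\<close>; this is why the count has to be uniform in the centre.\<close>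
  have row: "(\<Sum>a'\<in>A. exp (- (2 * pi * R * (\<theta> a - \<theta> a'))\<^sup>2 / 2)) \<le> real Cnt + real L ^ card J * exp (- (R * \<eta>)\<^sup>2)"
    if a: "a \<in> A" for a
  proof -
    have "(\<Sum>a'\<in>A. exp (- (2 * pi * R * (\<theta> a - \<theta> a'))\<^sup>2 / 2))
        \<le> (\<Sum>a'\<in>A. (if \<bar>\<theta> a' - \<theta> a\<bar> \<le> \<eta> then 1 else 0) + exp (- (R * \<eta>)\<^sup>2))"
    proof (rule sum_mono)
      fix a'
      show "exp (- (2 * pi * R * (\<theta> a - \<theta> a'))\<^sup>2 / 2) \<le> (if \<bar>\<theta> a' - \<theta> a\<bar> \<le> \<eta> then 1 else 0) + exp (- (R * \<eta>)\<^sup>2)"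
      proof (cases "\<bar>\<theta> a' - \<theta> a\<bar> \<le> \<eta>")
        case True
        have "exp (- (2 * pi * R * (\<theta> a - \<theta> a'))\<^sup>2 / 2) \<le> 1" by simp
        then show ?thesis using True exp_gt_zero[of "- (R * \<eta>)\<^sup>2"] by (simp add: add_increasing2)
      next
        case False
        have "(R * \<eta>)\<^sup>2 \<le> (R * \<bar>\<theta> a - \<theta> a'\<bar>)\<^sup>2"
          using False R \<eta> by (intro power_mono mult_left_mono) auto
        also have "\<dots> = 1 * (R * (\<theta> a - \<theta> a'))\<^sup>2" by (simp add: power_mult_distrib)
        also have "\<dots> \<le> (2 * pi\<^sup>2) * (R * (\<theta> a - \<theta> a'))\<^sup>2"
        proof (rule mult_right_mono)
          have "1\<^sup>2 \<le> pi\<^sup>2" using pi_gt3 by (intro power_mono) auto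
          then show "1 \<le> 2 * pi\<^sup>2" by simp
        qed simp
        also have "\<dots> = (2 * pi * R * (\<theta> a - \<theta> a'))\<^sup>2 / 2" by (simp add: power_mult_distrib)
        finally show ?thesis using False by simp
      qed
    qed
    also have "\<dots> = real (card {a' \<in> A. \<bar>\<theta> a' - \<theta> a\<bar> \<le> \<eta>}) + real (card A) * exp (- (R * \<eta>)\<^sup>2)"
      using finA by (simp add: sum.distrib sum.If_cases Int_def)
    also have "\<dots> \<le> real Cnt + real L ^ card J * exp (- (R * \<eta>)\<^sup>2)"
      using cnt[of "\<theta> a"] unfolding cardA by (simp add: A_def \<theta>_def)
    finally show ?thesis .
  qed
  have "(LINT z|gauss. (cmod (trig_sum J L u (x + (R * z) *\<^sub>R \<nu>)))\<^sup>2)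
      = Re (LINT z|gauss. complex_of_real ((cmod (trig_sum J L u (x + (R * z) *\<^sub>R \<nu>)))\<^sup>2))"
    by (subst integral_complex_of_real) simp
  also have "\<dots> \<le> cmod (LINT z|gauss. complex_of_real ((cmod (trig_sum J L u (x + (R * z) *\<^sub>R \<nu>)))\<^sup>2))"
    by (rule complex_Re_le_cmod)
  also have "(LINT z|gauss. complex_of_real ((cmod (trig_sum J L u (x + (R * z) *\<^sub>R \<nu>)))\<^sup>2))
      = (\<Sum>a\<in>A. \<Sum>a'\<in>A. (LINT z|gauss. cis ((\<phi> a - \<phi> a') + (2 * pi * R * (\<theta> a - \<theta> a')) * z)))"
    unfolding sq
    by (simp add: Bochner_Integration.integral_sum integrable_gauss_cis Bochner_Integration.integrable_sum)
  also have "cmod \<dots> \<le> (\<Sum>a\<in>A. \<Sum>a'\<in>A. exp (- (2 * pi * R * (\<theta> a - \<theta> a'))\<^sup>2 / 2))"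
    by (rule order_trans[OF norm_sum sum_mono[OF order_trans[OF norm_sum sum_mono]]])
      (simp only: norm_gauss_cis_integral order_refl)
  also have "\<dots> \<le> (\<Sum>a\<in>A. real Cnt + real L ^ card J * exp (- (R * \<eta>)\<^sup>2))" by (intro sum_mono row)
  also have "\<dots> = real L ^ card J * (real Cnt + real L ^ card J * exp (- (R * \<eta>)\<^sup>2))" by (simp add: cardA)
  finally show "(LINT z|gauss. (cmod (trig_sum J L u (x + (R * z) *\<^sub>R \<nu>)))\<^sup>2)
      \<le> real L ^ card J * (real Cnt + real L ^ card J * exp (- (R * \<eta>)\<^sup>2))" .
qed

section \<open>Tubes inside a ball\<close>

lemma tube_ball_subset:
  fixes \<nu> :: "'a::euclidean_space"
  assumes \<nu>: "norm \<nu> = 1" and R: "0 < R"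
  shows "tube a \<nu> \<inter> ball 0 R \<subseteq> (\<Union>j\<in>{- \<lceil>R\<rceil>..\<lceil>R\<rceil>}. ball (a - (a \<bullet> \<nu>) *\<^sub>R \<nu> + of_int j *\<^sub>R \<nu>) 2)"
proof
  fix x assume x: "x \<in> tube a \<nu> \<inter> ball 0 R"
  define j where "j = \<lfloor>x \<bullet> \<nu>\<rfloor>"
  have "\<bar>x \<bullet> \<nu>\<bar> \<le> norm x * norm \<nu>" by (rule Cauchy_Schwarz_ineq2)
  then have "\<bar>x \<bullet> \<nu>\<bar> < R" using x \<nu> by simp
  then have j: "j \<in> {- \<lceil>R\<rceil>..\<lceil>R\<rceil>}" unfolding j_def by (auto; linarith)
  have "norm (x - (a - (a \<bullet> \<nu>) *\<^sub>R \<nu> + of_int j *\<^sub>R \<nu>)) < 2"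
  proof -
    have "x - (a - (a \<bullet> \<nu>) *\<^sub>R \<nu> + of_int j *\<^sub>R \<nu>) =
        ((x - a) - ((x - a) \<bullet> \<nu>) *\<^sub>R \<nu>) + (x \<bullet> \<nu> - of_int j) *\<^sub>R \<nu>"
      by (simp add: algebra_simps)
    also have "norm \<dots> \<le> norm ((x - a) - ((x - a) \<bullet> \<nu>) *\<^sub>R \<nu>) + norm ((x \<bullet> \<nu> - of_int j) *\<^sub>R \<nu>)"
      by (rule norm_triangle_ineq)
    also have "\<dots> < 1 + 1"
    proof (rule add_less_le_mono)
      show "norm ((x - a) - ((x - a) \<bullet> \<nu>) *\<^sub>R \<nu>) < 1" using x by (simp add: tube_def)
      show "norm ((x \<bullet> \<nu> - of_int j) *\<^sub>R \<nu>) \<le> 1" unfolding j_def using \<nu> by simp linarith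
    qed
    finally show ?thesis by simp
  qed
  then have "x \<in> ball (a - (a \<bullet> \<nu>) *\<^sub>R \<nu> + of_int j *\<^sub>R \<nu>) 2" by (simp add: dist_norm norm_minus_commute)
  with j show "x \<in> (\<Union>j\<in>{- \<lceil>R\<rceil>..\<lceil>R\<rceil>}. ball (a - (a \<bullet> \<nu>) *\<^sub>R \<nu> + of_int j *\<^sub>R \<nu>) 2)" by blast
qed

lemma open_tube: "open (tube a \<nu>)"
  unfolding tube_def by (intro open_Collect_less continuous_intros)

lemma tube_borel [measurable]: "tube a \<nu> \<in> sets borel"
  using open_tube by (rule borel_open)

lemma emeasure_tube_ball_le:
  fixes \<nu> :: "'a::euclidean_space"
  assumes \<nu>: "norm \<nu> = 1" and R: "1 \<le> R"
  shows "emeasure lborel (tube a \<nu> \<inter> ball 0 R) \<le> ennreal (5 * R * measure lborel (ball (0::'a) 2))"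
proof -
  have b: "emeasure lborel (ball c 2) = ennreal (measure lborel (ball (0::'a) 2))" for c :: 'a
    by (simp add: emeasure_ball content_ball)
  have "emeasure lborel (tube a \<nu> \<inter> ball 0 R)
      \<le> emeasure lborel (\<Union>j\<in>{- \<lceil>R\<rceil>..\<lceil>R\<rceil>}. ball (a - (a \<bullet> \<nu>) *\<^sub>R \<nu> + of_int j *\<^sub>R \<nu>) 2)"
    using tube_ball_subset[OF \<nu>, of R a] R by (intro emeasure_mono) auto
  also have "\<dots> \<le> (\<Sum>j\<in>{- \<lceil>R\<rceil>..\<lceil>R\<rceil>}. emeasure lborel (ball (a - (a \<bullet> \<nu>) *\<^sub>R \<nu> + of_int j *\<^sub>R \<nu>) 2))"
    by (intro emeasure_subadditive_finite) auto
  also have "\<dots> = ennreal (real (nat (2 * \<lceil>R\<rceil> + 1)) * measure lborel (ball (0::'a) 2))"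
    unfolding b by (simp add: ennreal_mult' ennreal_of_nat_eq_real_of_nat)
  also have "\<dots> \<le> ennreal (5 * R * measure lborel (ball (0::'a) 2))"
  proof (intro ennreal_leI mult_right_mono)
    have "real (nat (2 * \<lceil>R\<rceil> + 1)) = 2 * of_int \<lceil>R\<rceil> + 1" using R by simp
    also have "of_int \<lceil>R\<rceil> \<le> R + 1" by linarith
    finally show "real (nat (2 * \<lceil>R\<rceil> + 1)) \<le> 5 * R" using R by simp
  qed simp
  finally show ?thesis .
qed

lemma trig_sum_continuous: "continuous_on UNIV (trig_sum J L u)"
  unfolding trig_sum_def[abs_def] by (intro continuous_intros)

text \<open>The probability of a shift of length at most R, the only shifts for which the truncated
  tube is controlled.\<close>

definition gauss_central :: real where "gauss_central = measure gauss {-1..1}"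

lemma gauss_central_pos: "0 < gauss_central"
proof -
  have "\<not> (AE z in lborel. \<not> (z \<in> {-1..1::real} \<and> 0 < std_normal_density z))"
  proof
    assume "AE z in lborel. \<not> (z \<in> {-1..1::real} \<and> 0 < std_normal_density z)"
    then have "AE z in lborel. z \<notin> {-1..1::real}" by (simp add: normal_density_pos)
    then have "emeasure lborel {-1..1::real} = 0"
    proof (subst AE_iff_measurable[symmetric, of "{-1..1::real}" lborel "\<lambda>z. z \<notin> {-1..1}"])
      show "{z \<in> space lborel. \<not> z \<notin> {-1..1::real}} = {-1..1}" by auto
    qed auto
    then show False by simp
  qed
  moreover have "std_normal_density z \<noteq> 0" for z using normal_density_pos[of 1 0 z] by simp
  ultimately have "emeasure gauss {-1..1} \<noteq> 0"
    by (subst emeasure_density) (auto simp: nn_integral_0_iff_AE indicator_def normal_density_pos elim!: eventually_mono)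
  then show ?thesis unfolding gauss_central_def gauss.emeasure_eq_measure
    by (simp add: zero_less_measure_iff)
qed

text \<open>The tube is invariant under translation along its axis, so averaging over Gaussian
  translates reduces the integral over the tube to an integral along lines.\<close>

lemma emeasure_bohr_tube_le:
  fixes u :: "'j \<Rightarrow> 'a::euclidean_space"
  assumes J: "finite J" and \<nu>: "norm \<nu> = 1" and R: "1 \<le> R" and \<eta>: "0 \<le> \<eta>" and L: "1 \<le> L"
    and \<epsilon>: "8 * real L * \<epsilon> \<le> 1"
    and cnt: "\<And>\<theta>. card {a \<in> PiE J (\<lambda>_. {..<L}). \<bar>(\<Sum>j\<in>J. real (a j) * (\<nu> \<bullet> u j)) - \<theta>\<bar> \<le> \<eta>} \<le> Cnt"
  shows "emeasure lborel (bohr_set J u \<epsilon> \<inter> ball 0 R \<inter> tube a \<nu>) \<le>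
    ennreal (10 * measure lborel (ball (0::'a) 2) / gauss_central * R * 4 ^ card J / real L ^ card J
      * (real Cnt + real L ^ card J * exp (- (R * \<eta>)\<^sup>2)))"
proof -
  let ?T = "\<lambda>R. tube a \<nu> \<inter> ball (0::'a) R"
  define B where "B = real L ^ card J * (real Cnt + real L ^ card J * exp (- (R * \<eta>)\<^sup>2))"
  define h where "h = (\<lambda>x. ennreal ((cmod (trig_sum J L u x))\<^sup>2))"
  define c where "c = (real L / 2) ^ card J"
  have c0: "0 < c" using L by (simp add: c_def)
  have B0: "0 \<le> B" by (simp add: B_def)
  have [measurable]: "h \<in> borel_measurable borel"
    unfolding h_def using borel_measurable_continuous_onI[OF trig_sum_continuous[of J L u]] by measurable
  have T[measurable]: "?T r \<in> sets borel" for r by (intro sets.Int tube_borel borel_open) auto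
  interpret pair_sigma_finite gauss "lborel :: 'a measure" ..
  \<comment> \<open>The majorisation of the Bohr set by the kernel, which is at least
    \<open>c^2\<close> there.\<close>
  have step1: "ennreal (c\<^sup>2) * emeasure lborel (bohr_set J u \<epsilon> \<inter> ball 0 R \<inter> tube a \<nu>) \<le> (\<integral>\<^sup>+x. indicator (?T R) x * h x \<partial>lborel)"
  proof -
    have "ennreal (c\<^sup>2) * emeasure lborel (bohr_set J u \<epsilon> \<inter> ball 0 R \<inter> tube a \<nu>)
        = (\<integral>\<^sup>+x. ennreal (c\<^sup>2) * indicator (bohr_set J u \<epsilon> \<inter> ball 0 R \<inter> tube a \<nu>) x \<partial>lborel)"
      using J by (subst nn_integral_cmult_indicator) (auto intro!: sets.Int)
    also have "\<dots> \<le> (\<integral>\<^sup>+x. indicator (?T R) x * h x \<partial>lborel)"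
    proof (rule nn_integral_mono)
      fix x
      show "ennreal (c\<^sup>2) * indicator (bohr_set J u \<epsilon> \<inter> ball 0 R \<inter> tube a \<nu>) x \<le> indicator (?T R) x * h x"
      proof (cases "x \<in> bohr_set J u \<epsilon> \<inter> ball 0 R \<inter> tube a \<nu>")
        case True
        then have "c \<le> cmod (trig_sum J L u x)" unfolding c_def by (intro trig_sum_bohr_ge[OF J _ \<epsilon>]) auto
        then have "c\<^sup>2 \<le> (cmod (trig_sum J L u x))\<^sup>2" using c0 by (intro power_mono) auto
        then show ?thesis using True by (auto simp: h_def intro: ennreal_leI)
      qed simp
    qed
    finally show ?thesis .
  qed
  have translate: "(\<integral>\<^sup>+x. indicator (?T R) x * h x \<partial>lborel)
      = (\<integral>\<^sup>+x. indicator (?T R) (v + x) * h (v + x) \<partial>lborel)" for v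
  proof -
    have "(\<integral>\<^sup>+x. indicator (?T R) x * h x \<partial>lborel) = (\<integral>\<^sup>+x. indicator (?T R) x * h x \<partial>distr lborel borel ((+) v))"
      by (simp add: lborel_distr_plus)
    also have "\<dots> = (\<integral>\<^sup>+x. indicator (?T R) (v + x) * h (v + x) \<partial>lborel)"
      by (subst nn_integral_distr) auto
    finally show ?thesis .
  qed
  \<comment> \<open>Shifts by at most R along the axis fix the tube and map the ball of radius R
    into that of radius 2R; negative or larger z are covered by nonnegativity or by the zero
    indicator.\<close>
  have shrink: "indicator {-1..1} z * (\<integral>\<^sup>+x. indicator (?T R) x * h x \<partial>lborel)
      \<le> (\<integral>\<^sup>+x. indicator (?T (2 * R)) x * h (x + (R * z) *\<^sub>R \<nu>) \<partial>lborel)" for z :: real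
  proof (cases "z \<in> {-1..1}")
    case True
    have "(\<integral>\<^sup>+x. indicator (?T R) ((R * z) *\<^sub>R \<nu> + x) * h ((R * z) *\<^sub>R \<nu> + x) \<partial>lborel)
        \<le> (\<integral>\<^sup>+x. indicator (?T (2 * R)) x * h (x + (R * z) *\<^sub>R \<nu>) \<partial>lborel)"
    proof (rule nn_integral_mono)
      fix x
      have "x \<in> ?T (2 * R)" if x: "(R * z) *\<^sub>R \<nu> + x \<in> ?T R"
      proof
        have "\<nu> \<bullet> \<nu> = 1" using \<nu> by (simp add: norm_eq_1)
        then have "((R * z) *\<^sub>R \<nu> + x - a) - (((R * z) *\<^sub>R \<nu> + x - a) \<bullet> \<nu>) *\<^sub>R \<nu> = (x - a) - ((x - a) \<bullet> \<nu>) *\<^sub>R \<nu>"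
          by (simp add: inner_simps algebra_simps)
        moreover have "norm (((R * z) *\<^sub>R \<nu> + x - a) - (((R * z) *\<^sub>R \<nu> + x - a) \<bullet> \<nu>) *\<^sub>R \<nu>) < 1"
          using x by (simp only: Int_iff tube_def mem_Collect_eq)
        ultimately show "x \<in> tube a \<nu>" by (simp only: tube_def mem_Collect_eq)
        have "norm ((R * z) *\<^sub>R \<nu>) \<le> R" using True R \<nu> by (simp add: abs_mult abs_le_iff mult_left_le)
        then show "x \<in> ball 0 (2 * R)"
          using x norm_triangle_ineq4[of "(R * z) *\<^sub>R \<nu> + x" "(R * z) *\<^sub>R \<nu>"] by simp
      qed
      then show "indicator (?T R) ((R * z) *\<^sub>R \<nu> + x) * h ((R * z) *\<^sub>R \<nu> + x)
          \<le> indicator (?T (2 * R)) x * h (x + (R * z) *\<^sub>R \<nu>)"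
        by (auto simp: indicator_def add.commute)
    qed
    then show ?thesis using True translate[of "(R * z) *\<^sub>R \<nu>"] by simp
  qed simp
  have meas[measurable]: "(\<lambda>(z, x). indicator (?T (2 * R)) x * h (x + (R * z) *\<^sub>R \<nu>)) \<in> borel_measurable (gauss \<Otimes>\<^sub>M lborel)"
    by measurable
  have "ennreal gauss_central * (\<integral>\<^sup>+x. indicator (?T R) x * h x \<partial>lborel)
      = (\<integral>\<^sup>+z. indicator {-1..1} z * (\<integral>\<^sup>+x. indicator (?T R) x * h x \<partial>lborel) \<partial>gauss)"
    by (subst nn_integral_multc) (auto simp: gauss_central_def gauss.emeasure_eq_measure)
  also have "\<dots> \<le> (\<integral>\<^sup>+z. (\<integral>\<^sup>+x. indicator (?T (2 * R)) x * h (x + (R * z) *\<^sub>R \<nu>) \<partial>lborel) \<partial>gauss)"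
    by (intro nn_integral_mono shrink)
  also have "\<dots> = (\<integral>\<^sup>+x. (\<integral>\<^sup>+z. indicator (?T (2 * R)) x * h (x + (R * z) *\<^sub>R \<nu>) \<partial>gauss) \<partial>lborel)"
    using Fubini[OF meas] by simp
  also have "\<dots> \<le> (\<integral>\<^sup>+x. ennreal B * indicator (?T (2 * R)) x \<partial>lborel)"
  proof (rule nn_integral_mono)
    fix x
    have "(\<integral>\<^sup>+z. h (x + (R * z) *\<^sub>R \<nu>) \<partial>gauss) = ennreal (LINT z|gauss. (cmod (trig_sum J L u (x + (R * z) *\<^sub>R \<nu>)))\<^sup>2)"
      unfolding h_def using gauss_average_trig_sum_le(1)[OF J cnt, of R] R \<eta> by (intro nn_integral_eq_integral) auto
    also have "\<dots> \<le> ennreal B"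
      unfolding B_def using gauss_average_trig_sum_le(2)[OF J cnt, of R] R \<eta> by (intro ennreal_leI) auto
    finally have "(\<integral>\<^sup>+z. h (x + (R * z) *\<^sub>R \<nu>) \<partial>gauss) \<le> ennreal B" .
    then show "(\<integral>\<^sup>+z. indicator (?T (2 * R)) x * h (x + (R * z) *\<^sub>R \<nu>) \<partial>gauss) \<le> ennreal B * indicator (?T (2 * R)) x"
      by (cases "x \<in> ?T (2 * R)") auto
  qed
  also have "\<dots> = ennreal B * emeasure lborel (?T (2 * R))" by (intro nn_integral_cmult_indicator) simp
  also have "\<dots> \<le> ennreal B * ennreal (5 * (2 * R) * measure lborel (ball (0::'a) 2))"
    using R by (intro mult_left_mono emeasure_tube_ball_le \<nu>) auto
  also have "\<dots> = ennreal (B * (10 * R * measure lborel (ball (0::'a) 2)))"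
    using R B0 by (subst ennreal_mult[symmetric]) auto
  finally have step2: "ennreal gauss_central * (\<integral>\<^sup>+x. indicator (?T R) x * h x \<partial>lborel)
      \<le> ennreal (B * (10 * R * measure lborel (ball (0::'a) 2)))" .
  have "emeasure lborel (bohr_set J u \<epsilon> \<inter> ball 0 R \<inter> tube a \<nu>)
      = ennreal (1 / (gauss_central * c\<^sup>2)) * (ennreal gauss_central * (ennreal (c\<^sup>2) * emeasure lborel (bohr_set J u \<epsilon> \<inter> ball 0 R \<inter> tube a \<nu>)))"
    using gauss_central_pos c0 by (simp add: mult.assoc[symmetric] ennreal_mult[symmetric])
  also have "\<dots> \<le> ennreal (1 / (gauss_central * c\<^sup>2)) * ennreal (B * (10 * R * measure lborel (ball (0::'a) 2)))"
    by (intro mult_left_mono order_trans[OF mult_left_mono[OF step1] step2]) auto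
  also have "\<dots> = ennreal (1 / (gauss_central * c\<^sup>2) * (B * (10 * R * measure lborel (ball (0::'a) 2))))"
    using B0 R gauss_central_pos by (subst ennreal_mult) auto
  also have "1 / (gauss_central * c\<^sup>2) * (B * (10 * R * measure lborel (ball (0::'a) 2)))
     = 10 * measure lborel (ball (0::'a) 2) / gauss_central * R * 4 ^ card J / real L ^ card J
      * (real Cnt + real L ^ card J * exp (- (R * \<eta>)\<^sup>2))"
  proof -
    have "c\<^sup>2 = real L ^ card J * real L ^ card J / 4 ^ card J"
      unfolding c_def by (simp add: power2_eq_square power_divide flip: power_mult_distrib)
    moreover have "1 / (g * (l * l / f)) * (l * W * (10 * R * v)) = 10 * v / g * R * f / l * W"
      if "l \<noteq> 0" "f \<noteq> 0" "g \<noteq> 0" for g l f W v :: real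
      using that by (simp add: field_simps)
    ultimately show ?thesis unfolding B_def using L gauss_central_pos by simp
  qed
  finally show ?thesis .
qed

text \<open>Pigeonhole: one of the cells of the torus contains a fraction of at least \<open>N\<close> to the power
  minus \<open>card J\<close> of the ball, and differences of points of a cell lie in the Bohr set.\<close>

lemma measure_bohr_ball_ge:
  fixes u :: "'j \<Rightarrow> 'a::euclidean_space"
  assumes J: "finite J" and N: "0 < N" and R: "0 < R"
  shows "measure lborel (ball (0::'a) (R / 2)) / real N ^ card J \<le> measure lborel (bohr_set J u (1 / real N) \<inter> ball 0 R)"
proof -
  define cell where "cell = (\<lambda>x. \<lambda>j\<in>J. nat \<lfloor>real N * frac (x \<bullet> u j)\<rfloor>)"
  define E where "E = (\<lambda>\<kappa>. {x \<in> ball (0::'a) (R / 2). \<forall>j\<in>J. nat \<lfloor>real N * frac (x \<bullet> u j)\<rfloor> = \<kappa> j})"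
  define K where "K = PiE J (\<lambda>_. {..<N})"
  have finK: "finite K" unfolding K_def using J by (intro finite_PiE) auto
  have cardK: "card K = N ^ card J" unfolding K_def using J by (simp add: card_PiE)
  have Em[measurable]: "E \<kappa> \<in> sets borel" for \<kappa>
  proof -
    have "E \<kappa> = ball 0 (R / 2) \<inter> {x \<in> space borel. \<forall>j\<in>J. nat \<lfloor>real N * frac (x \<bullet> u j)\<rfloor> = \<kappa> j}" by (auto simp: E_def)
    also have "\<dots> \<in> sets borel"
      using J unfolding frac_def by measurable
    finally show ?thesis .
  qed
  have fm: "E \<kappa> \<in> fmeasurable lborel" for \<kappa>
  proof (rule fmeasurableI2[of "ball 0 (R / 2)"])
    show "ball 0 (R / 2) \<in> fmeasurable (lborel :: 'a measure)" by (intro fmeasurableI emeasure_bounded_finite) auto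
    show "E \<kappa> \<subseteq> ball 0 (R / 2)" by (auto simp: E_def)
    show "E \<kappa> \<in> sets lborel" using Em by simp
  qed
  have cover: "ball 0 (R / 2) \<subseteq> (\<Union>\<kappa>\<in>K. E \<kappa>)"
  proof
    fix x :: 'a assume x: "x \<in> ball 0 (R / 2)"
    have "cell x \<in> K" unfolding K_def cell_def
    proof (rule restrict_PiE_iff[THEN iffD2], intro ballI)
      fix j
      have "real N * frac (x \<bullet> u j) < real N * 1" using N frac_lt_1[of "x \<bullet> u j"] by (intro mult_strict_left_mono) auto
      moreover have "0 \<le> real N * frac (x \<bullet> u j)" by simp
      ultimately show "nat \<lfloor>real N * frac (x \<bullet> u j)\<rfloor> \<in> {..<N}" by (simp add: nat_less_iff floor_less_iff)
    qed
    moreover have "x \<in> E (cell x)" using x by (simp add: E_def cell_def)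
    ultimately show "x \<in> (\<Union>\<kappa>\<in>K. E \<kappa>)" by blast
  qed
  have "measure lborel (ball (0::'a) (R / 2)) \<le> measure lborel (\<Union>\<kappa>\<in>K. E \<kappa>)"
    using cover finK fm by (intro measure_mono_fmeasurable fmeasurable.finite_UN) auto
  also have "\<dots> \<le> (\<Sum>\<kappa>\<in>K. measure lborel (E \<kappa>))"
    using finK fm by (intro measure_UNION_le) (auto simp: fmeasurable_def)
  finally have le: "measure lborel (ball (0::'a) (R / 2)) \<le> (\<Sum>\<kappa>\<in>K. measure lborel (E \<kappa>))" .
  have "\<exists>\<kappa>\<in>K. measure lborel (ball (0::'a) (R / 2)) / real N ^ card J \<le> measure lborel (E \<kappa>)"
  proof (rule ccontr)
    assume "\<not> ?thesis"
    then have lt: "\<And>\<kappa>. \<kappa> \<in> K \<Longrightarrow> measure lborel (E \<kappa>) < measure lborel (ball (0::'a) (R / 2)) / real N ^ card J" by force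
    have "K \<noteq> {}" using cardK N by (metis card.empty power_not_zero less_numeral_extra(3))
    then have "(\<Sum>\<kappa>\<in>K. measure lborel (E \<kappa>)) < (\<Sum>\<kappa>\<in>K. measure lborel (ball (0::'a) (R / 2)) / real N ^ card J)"
      using finK lt by (intro sum_strict_mono) auto
    also have "\<dots> = measure lborel (ball (0::'a) (R / 2))" using N by (simp add: cardK)
    finally show False using le by simp
  qed
  then obtain \<kappa> where \<kappa>: "measure lborel (ball (0::'a) (R / 2)) / real N ^ card J \<le> measure lborel (E \<kappa>)" by blast
  have "0 < measure lborel (ball (0::'a) (R / 2))" using R by (simp add: content_ball)
  then have "0 < measure lborel (ball (0::'a) (R / 2)) / real N ^ card J" using N by simp
  with \<kappa> have "E \<kappa> \<noteq> {}" by auto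
  \<comment> \<open>With one point of the rich cell fixed, taking differences is a translation and
    preserves volume.\<close>
  then obtain x0 where x0: "x0 \<in> E \<kappa>" by blast
  let ?X = "bohr_set J u (1 / real N) \<inter> ball 0 R"
  have Xm: "?X \<in> sets borel" using J by (intro sets.Int bohr_set_borel) auto
  have sub: "E \<kappa> \<subseteq> (+) x0 ` ?X"
  proof
    fix x assume x: "x \<in> E \<kappa>"
    have "norm (x - x0) < R" using x x0 norm_triangle_ineq4[of x x0] by (simp add: E_def)
    moreover have "\<exists>k::int. \<bar>(x - x0) \<bullet> u j - of_int k\<bar> \<le> 1 / real N" if j: "j \<in> J" for j
    proof -
      let ?f = "frac (x \<bullet> u j)" and ?g = "frac (x0 \<bullet> u j)"
      have "\<lfloor>real N * ?f\<rfloor> = \<lfloor>real N * ?g\<rfloor>"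
      proof -
        have "nat \<lfloor>real N * ?f\<rfloor> = nat \<lfloor>real N * ?g\<rfloor>" using x x0 j by (simp add: E_def)
        moreover have "0 \<le> \<lfloor>real N * ?f\<rfloor>" "0 \<le> \<lfloor>real N * ?g\<rfloor>" by simp_all
        ultimately show ?thesis using eq_nat_nat_iff by blast
      qed
      then have "\<bar>real N * ?f - real N * ?g\<bar> \<le> 1" by linarith
      then have "real N * \<bar>?f - ?g\<bar> \<le> 1" using N by (simp add: right_diff_distrib[symmetric] abs_mult)
      then have "\<bar>?f - ?g\<bar> \<le> 1 / real N" using N by (simp add: field_simps)
      moreover have "(x - x0) \<bullet> u j - of_int (\<lfloor>x \<bullet> u j\<rfloor> - \<lfloor>x0 \<bullet> u j\<rfloor>) = ?f - ?g"
        unfolding frac_def inner_diff_left of_int_diff by linarith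
      ultimately show ?thesis by metis
    qed
    ultimately have "x - x0 \<in> ?X" by (simp add: bohr_set_def)
    then show "x \<in> (+) x0 ` ?X" by (intro image_eqI[of _ _ "x - x0"]) auto
  qed
  have Xf: "?X \<in> fmeasurable lborel"
  proof (rule fmeasurableI2[of "ball 0 R"])
    show "ball 0 R \<in> fmeasurable (lborel :: 'a measure)" by (intro fmeasurableI emeasure_bounded_finite) auto
  qed (use Xm in auto)
  have img: "(+) x0 ` ?X = (\<lambda>x. x - x0) -` ?X"
  proof (intro equalityI subsetI)
    fix x assume "x \<in> (\<lambda>x. x - x0) -` ?X"
    then show "x \<in> (+) x0 ` ?X" by (intro image_eqI[of _ _ "x - x0"]) auto
  qed auto
  have tr: "emeasure lborel ((+) x0 ` ?X) = emeasure lborel ?X"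
  proof -
    have "emeasure lborel ?X = emeasure (distr lborel borel ((+) (- x0))) ?X" by (simp add: lborel_distr_plus)
    also have "\<dots> = emeasure lborel ((+) (- x0) -` ?X \<inter> space lborel)" using Xm by (intro emeasure_distr) auto
    also have "(+) (- x0) -` ?X \<inter> space lborel = (+) x0 ` ?X" unfolding img by auto
    finally show ?thesis by simp
  qed
  have "emeasure lborel (E \<kappa>) \<le> emeasure lborel ((+) x0 ` ?X)"
  proof (rule emeasure_mono[OF sub])
    have "(+) x0 ` ?X = (\<lambda>x. x - x0) -` ?X \<inter> space borel" using img by simp
    also have "\<dots> \<in> sets borel" using Xm by (intro measurable_sets[of _ borel borel]) auto
    finally show "(+) x0 ` ?X \<in> sets lborel" by simp
  qed
  then have "emeasure lborel (E \<kappa>) \<le> emeasure lborel ?X" by (simp add: tr)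
  then have "measure lborel (E \<kappa>) \<le> measure lborel ?X"
    using fm[of \<kappa>] Xf by (simp add: emeasure_eq_measure2)
  with \<kappa> show ?thesis by linarith
qed

section \<open>A single scale\<close>

text \<open>Each bump is scaled by the missing height at its centre. It equals 1 there, and every
  other bump vanishes there, so the surface passes through the centre. Bumps of different scales may
  overlap; they only have to avoid each other's centres.\<close>

lemma surface_through_points:
  fixes P :: "nat \<Rightarrow> 'a::euclidean_space set" and \<delta> :: "nat \<Rightarrow> real"
  assumes fin: "\<And>k. finite (P k)" and \<delta>: "\<And>k. 0 < \<delta> k" "\<And>k. \<delta> k \<le> 1"
    and sep: "\<And>k p p'. p \<in> P k \<Longrightarrow> p' \<in> P k \<Longrightarrow> p \<noteq> p' \<Longrightarrow> 2 * \<delta> k \<le> norm (p - p')"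
    and sep': "\<And>k k' p p'. k \<noteq> k' \<Longrightarrow> p \<in> P k \<Longrightarrow> p' \<in> P k' \<Longrightarrow> \<delta> k' \<le> norm (p - p')"
    and height: "\<And>k p. p \<in> P k \<Longrightarrow> \<bar>1 - p \<bullet> p\<bar> \<le> (1/2) ^ k * (\<delta> k)\<^sup>2 / 120"
  shows "\<exists>\<psi> G H. perturbed_sphere \<psi> G H \<and> (\<forall>k. P k \<subseteq> perturbed_sphere.surf \<psi>)"
proof -
  define \<tau> where "\<tau> = (\<lambda>k. (1/2) ^ k * (\<delta> k)\<^sup>2 / 120)"
  define f where "f = (\<lambda>k x. \<Sum>p\<in>P k. (1 - p \<bullet> p) * bump (\<delta> k) p x)"
  define G where "G = (\<lambda>k x. \<Sum>p\<in>P k. (1 - p \<bullet> p) *\<^sub>R bump_grad (\<delta> k) p x)"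
  define H where "H = (\<lambda>k x v. \<Sum>p\<in>P k. (1 - p \<bullet> p) *\<^sub>R bump_hess (\<delta> k) p x v)"
  \<comment> \<open>30/120 = 1/4 from the bump bound; the geometric series then sums to the 1/2
    allowed in \<open>perturbed_sphere\<close>.\<close>
  define B where "B = (\<lambda>k::nat. (1/2) ^ k * (1/4 :: real))"
  have C2k: "C2_bounded (f k) (G k) (H k) (B k)" for k
  proof -
    have "C2_bounded (f k) (G k) (H k) (30 * \<tau> k / (\<delta> k)\<^sup>2)"
      unfolding f_def G_def H_def
      by (rule C2_bounded_bump_sum) (use fin \<delta> sep height in \<open>auto simp: \<tau>_def\<close>)
    moreover have "30 * \<tau> k / (\<delta> k)\<^sup>2 = B k" using \<delta>(1)[of k] by (simp add: \<tau>_def B_def)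
    ultimately show ?thesis by simp
  qed
  have sumB: "B sums (1/2)"
    using sums_mult2[OF geometric_sums[of "1/2::real"], of "1/4"] by (simp add: B_def)
  define \<psi> where "\<psi> = (\<lambda>x. \<Sum>k. f k x)"
  have C2: "C2_bounded \<psi> (\<lambda>x. \<Sum>k. G k x) (\<lambda>x v. \<Sum>k. H k x v) (1/2)"
  proof -
    have "C2_bounded \<psi> (\<lambda>x. \<Sum>k. G k x) (\<lambda>x v. \<Sum>k. H k x v) (suminf B)"
      unfolding \<psi>_def by (rule C2_bounded_suminf[OF C2k sums_summable[OF sumB]]) (simp add: B_def)
    then show ?thesis by (simp only: sums_unique[OF sumB, symmetric])
  qed
  then interpret perturbed_sphere \<psi> "\<lambda>x. \<Sum>k. G k x" "\<lambda>x v. \<Sum>k. H k x v" by unfold_locales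
  have "p \<in> surf" if p: "p \<in> P k" for k p
  proof -
    have zero: "f j p = 0" if "j \<noteq> k" for j
      unfolding f_def
    proof (rule sum.neutral, intro ballI)
      fix p' assume "p' \<in> P j"
      then have "\<delta> j \<le> norm (p - p')" using sep'[of k j p p'] p that by auto
      then show "(1 - p' \<bullet> p') * bump (\<delta> j) p' p = 0" by (simp add: bump_outside(1)[OF \<delta>(1)])
    qed
    have "f k p = 1 - p \<bullet> p"
    proof -
      have z: "(1 - p' \<bullet> p') * bump (\<delta> k) p' p = 0" if "p' \<in> P k - {p}" for p'
      proof -
        have "2 * \<delta> k \<le> norm (p - p')" using sep[OF p, of p'] that by auto
        then have "\<delta> k \<le> norm (p - p')" using \<delta>(1)[of k] by linarith
        then show ?thesis by (simp add: bump_outside(1)[OF \<delta>(1)])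
      qed
      have "f k p = (1 - p \<bullet> p) * bump (\<delta> k) p p + (\<Sum>p'\<in>P k - {p}. (1 - p' \<bullet> p') * bump (\<delta> k) p' p)"
        unfolding f_def by (rule sum.remove[OF fin p])
      then show ?thesis using z by (simp add: bump_center)
    qed
    moreover have "\<psi> p = (\<Sum>j\<in>{k}. f j p)" unfolding \<psi>_def using zero by (intro suminf_finite) auto
    ultimately show ?thesis by (simp add: surf_def \<rho>_def)
  qed
  then show ?thesis using perturbed_sphere_axioms by blast
qed

section \<open>Counting grid points in a cap\<close>

lemma card_nat_interval_ge:
  fixes x y :: real
  assumes "0 \<le> x" "x \<le> y"
  shows "y - x - 1 \<le> real (card {k::nat. x \<le> real k \<and> real k \<le> y})" "finite {k::nat. x \<le> real k \<and> real k \<le> y}"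
proof -
  have eq: "{k::nat. x \<le> real k \<and> real k \<le> y} = {nat \<lceil>x\<rceil>..nat \<lfloor>y\<rfloor>}"
    using assms by (auto simp: nat_ceiling_le_eq le_nat_floor) (use of_nat_floor[of y] in linarith)
  show "finite {k::nat. x \<le> real k \<and> real k \<le> y}" by (simp add: eq)
  have "y - x - 1 \<le> real_of_int (\<lfloor>y\<rfloor> - \<lceil>x\<rceil> + 1)" by linarith
  also have "\<dots> \<le> real (Suc (nat \<lfloor>y\<rfloor>) - nat \<lceil>x\<rceil>)"
    using assms by linarith
  finally show "y - x - 1 \<le> real (card {k::nat. x \<le> real k \<and> real k \<le> y})" by (simp add: eq)
qed

text \<open>A cap of the sphere thickened inwards: a cube of side \<open>\<delta>\<close> in the
  coordinates other than e, intersected with a thin shell. Naturals make the e-coordinate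
  nonnegative, which selects one hemisphere.\<close>

definition grid_cell :: "nat \<Rightarrow> 'a::euclidean_space \<Rightarrow> ('a \<Rightarrow> real) \<Rightarrow> real \<Rightarrow> real \<Rightarrow> ('a \<Rightarrow> nat) set" where
  "grid_cell q e lo \<delta> \<tau> = {z \<in> PiE Basis (\<lambda>_. {..<q}).
     (\<forall>b\<in>Basis - {e}. lo b \<le> real (z b) / real q \<and> real (z b) / real q \<le> lo b + \<delta>) \<and>
     1 - \<tau> \<le> (\<Sum>b\<in>Basis. (real (z b) / real q)\<^sup>2) \<and> (\<Sum>b\<in>Basis. (real (z b) / real q)\<^sup>2) \<le> 1}"

text \<open>Choose the coordinates other than e freely in the cube; the e-coordinate then fills an
  interval between two square roots. Half of each length is sacrificed to rounding.\<close>

lemma card_grid_cell_ge: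
  fixes e :: "'a::euclidean_space"
  assumes e: "e \<in> Basis" and dim: "2 \<le> DIM('a)" and lo: "\<And>b. b \<in> Basis - {e} \<Longrightarrow> 0 < lo b"
    "\<And>b. b \<in> Basis - {e} \<Longrightarrow> lo b + \<delta> \<le> 1 / (2 * real DIM('a))"
    and \<delta>: "0 < \<delta>" "2 \<le> \<delta> * real q" and \<tau>: "\<tau> \<le> 1/4" "4 \<le> \<tau> * real q"
  shows "(\<delta> * real q / 2) ^ (DIM('a) - 1) * (\<tau> * real q / 4) \<le> real (card (grid_cell q e lo \<delta> \<tau>))"
proof -
  let ?n = "DIM('a)" and ?q = "real q"
  have q0: "0 < ?q" using \<delta> by (metis mult_zero_right not_numeral_le_zero of_nat_0_less_iff of_nat_0 gr0I)
  have \<tau>0: "0 < \<tau>" using \<tau> q0 by (metis less_eq_real_def linorder_not_le mult_nonneg_nonneg mult_nonpos_nonneg not_numeral_le_zero order_trans)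
  define S where "S = (\<lambda>b::'a. {k::nat. ?q * lo b \<le> real k \<and> real k \<le> ?q * (lo b + \<delta>)})"
  define Y where "Y = PiE (Basis - {e}) S"
  define s where "s = (\<lambda>y::'a \<Rightarrow> nat. \<Sum>b\<in>Basis - {e}. (real (y b) / ?q)\<^sup>2)"
  define T where "T = (\<lambda>y. {k::nat. ?q * sqrt (1 - s y - \<tau>) \<le> real k \<and> real k \<le> ?q * sqrt (1 - s y)})"
  have S: "?q * \<delta> / 2 \<le> real (card (S b))" "finite (S b)" if b: "b \<in> Basis - {e}" for b
  proof -
    have le: "?q * lo b \<le> ?q * (lo b + \<delta>)" using q0 \<delta> by (intro mult_left_mono) auto
    have nn: "0 \<le> ?q * lo b" using q0 lo(1)[OF b] by simp
    show "finite (S b)" unfolding S_def by (rule card_nat_interval_ge(2)[OF nn le])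
    have "?q * (lo b + \<delta>) - ?q * lo b - 1 \<le> real (card (S b))" unfolding S_def by (rule card_nat_interval_ge(1)[OF nn le])
    then show "?q * \<delta> / 2 \<le> real (card (S b))" using \<delta>(2) by (simp add: algebra_simps)
  qed
  have yb: "lo b \<le> real (y b) / ?q" "real (y b) / ?q \<le> lo b + \<delta>" if "y \<in> Y" "b \<in> Basis - {e}" for y b
    using PiE_mem[OF that(1)[unfolded Y_def] that(2)] q0 by (simp_all add: S_def field_simps)
  have sy: "0 < s y" "s y \<le> 1/4" if y: "y \<in> Y" for y
  proof -
    have pos: "0 < real (y b) / ?q" if "b \<in> Basis - {e}" for b using yb(1)[OF y that] lo(1)[OF that] by linarith
    have ne: "Basis - {e} \<noteq> {}"
    proof
      assume "Basis - {e} = {}"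
      then have "(Basis :: 'a set) \<subseteq> {e}" by auto
      then have "card (Basis :: 'a set) \<le> card {e}" by (intro card_mono) auto
      then show False using dim by simp
    qed
    show "0 < s y" unfolding s_def
    proof (rule sum_pos)
      fix b assume "b \<in> Basis - {e}"
      then show "0 < (real (y b) / ?q)\<^sup>2" using pos[of b] by (simp only: zero_less_power)
    qed (use ne in auto)
    have "s y \<le> (\<Sum>b\<in>Basis - {e}. (1 / (2 * real ?n))\<^sup>2)" unfolding s_def
    proof (rule sum_mono)
      fix b assume b: "b \<in> Basis - {e}"
      show "(real (y b) / ?q)\<^sup>2 \<le> (1 / (2 * real ?n))\<^sup>2"
        using yb(2)[OF y b] lo(2)[OF b] by (intro power_mono) auto
    qed
    also have "\<dots> \<le> (\<Sum>b\<in>(Basis :: 'a set). (1 / (2 * real ?n))\<^sup>2)" by (intro sum_mono2) auto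
    also have "\<dots> = 1 / (4 * real ?n)" by (simp add: power2_eq_square)
    also have "\<dots> \<le> 1 / (4 * 1)" using dim by (intro divide_left_mono) auto
    finally show "s y \<le> 1/4" by simp
  qed
  have T: "\<tau> * ?q / 4 \<le> real (card (T y))" "finite (T y)" if y: "y \<in> Y" for y
  proof -
    define A where "A = 1 - s y - \<tau>"
    have A: "0 \<le> A" "A \<le> A + \<tau>" "A + \<tau> \<le> 1" using sy[OF y] \<tau> \<tau>0 by (auto simp: A_def)
    have As: "A + \<tau> = 1 - s y" by (simp add: A_def)
    have sq: "sqrt A \<le> sqrt (A + \<tau>)" "sqrt (A + \<tau>) \<le> 1" using A by auto
    have nn: "0 \<le> ?q * sqrt A" using q0 A by simp
    have le: "?q * sqrt A \<le> ?q * sqrt (A + \<tau>)" using q0 sq by (intro mult_left_mono) auto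
    have TA: "T y = {k::nat. ?q * sqrt A \<le> real k \<and> real k \<le> ?q * sqrt (A + \<tau>)}" by (simp add: T_def A_def)
    show "finite (T y)" unfolding TA by (rule card_nat_interval_ge(2)[OF nn le])
    \<comment> \<open>Both roots are at most 1, so the interval has length at least
      \<open>\<tau>/2\<close>.\<close>
    have "\<tau> = (sqrt (A + \<tau>) - sqrt A) * (sqrt (A + \<tau>) + sqrt A)"
      using A \<tau>0 by (simp add: algebra_simps)
    also have "\<dots> \<le> (sqrt (A + \<tau>) - sqrt A) * 2"
    proof (rule mult_left_mono)
      show "sqrt (A + \<tau>) + sqrt A \<le> 2" "0 \<le> sqrt (A + \<tau>) - sqrt A" using sq by linarith+
    qed
    finally have "\<tau> / 2 \<le> sqrt (A + \<tau>) - sqrt A" by simp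
    then have "?q * (\<tau> / 2) \<le> ?q * (sqrt (A + \<tau>) - sqrt A)" using q0 by (intro mult_left_mono) auto
    moreover have "?q * sqrt (A + \<tau>) - ?q * sqrt A - 1 \<le> real (card (T y))" unfolding TA
      by (rule card_nat_interval_ge(1)[OF nn le])
    ultimately show "\<tau> * ?q / 4 \<le> real (card (T y))" using \<tau>(2) by (simp add: algebra_simps)
  qed
  have finY: "finite Y" unfolding Y_def using S(2) by (intro finite_PiE) auto
  have "(\<lambda>(y, k). y(e := k)) ` (SIGMA y:Y. T y) \<subseteq> grid_cell q e lo \<delta> \<tau>"
  proof clarify
    fix y k assume y: "y \<in> Y" and k: "k \<in> T y"
    have sum: "(\<Sum>b\<in>Basis. (real ((y(e := k)) b) / ?q)\<^sup>2) = (real k / ?q)\<^sup>2 + s y"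
      unfolding s_def using e by (subst sum.remove[of _ e]) (auto intro!: sum.cong)
    have kq: "sqrt (1 - s y - \<tau>) \<le> real k / ?q" "real k / ?q \<le> sqrt (1 - s y)"
      using k q0 by (simp_all add: T_def field_simps)
    have "(sqrt (1 - s y - \<tau>))\<^sup>2 \<le> (real k / ?q)\<^sup>2" using kq sy[OF y] \<tau> by (intro power_mono) auto
    then have 1: "1 - \<tau> \<le> (real k / ?q)\<^sup>2 + s y" using sy[OF y] \<tau> by simp
    have "(real k / ?q)\<^sup>2 \<le> (sqrt (1 - s y))\<^sup>2" using kq by (intro power_mono) auto
    then have 2: "(real k / ?q)\<^sup>2 + s y \<le> 1" using sy[OF y] by simp
    have "real k / ?q < 1"
    proof -
      have "sqrt (1 - s y) < 1" using sy[OF y] by simp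
      then show ?thesis using kq(2) by linarith
    qed
    then have "k < q" using q0 by simp
    moreover have "y b < q" if b: "b \<in> Basis - {e}" for b
    proof -
      have "real (y b) / ?q \<le> 1 / (2 * real ?n)" using yb(2)[OF y b] lo(2)[OF b] by linarith
      also have "\<dots> < 1" using dim by simp
      finally show ?thesis using q0 by simp
    qed
    ultimately have "y(e := k) \<in> PiE Basis (\<lambda>_. {..<q})"
      using y e by (auto simp: Y_def PiE_def extensional_def)
    then show "y(e := k) \<in> grid_cell q e lo \<delta> \<tau>"
      unfolding grid_cell_def using yb[OF y] 1 2 by (simp only: mem_Collect_eq sum) auto
  qed
  moreover have "inj_on (\<lambda>(y, k). y(e := k)) (SIGMA y:Y. T y)"
  proof (rule inj_onI, clarify)
    fix y k y' k' assume y: "y \<in> Y" "y' \<in> Y" and eq: "y(e := k) = y'(e := k')"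
    have "k = k'" using fun_cong[OF eq, of e] by simp
    moreover have "y = y'"
    proof (rule PiE_ext[OF y[unfolded Y_def]])
      fix b assume "b \<in> Basis - {e}"
      then show "y b = y' b" using fun_cong[OF eq, of b] by auto
    qed
    ultimately show "y = y' \<and> k = k'" by simp
  qed
  moreover have "finite (grid_cell q e lo \<delta> \<tau>)"
    unfolding grid_cell_def by (rule finite_subset[of _ "PiE Basis (\<lambda>_. {..<q})"]) (auto intro!: finite_PiE)
  ultimately have "card (SIGMA y:Y. T y) \<le> card (grid_cell q e lo \<delta> \<tau>)"
    by (intro card_inj_on_le) auto
  moreover have "(\<delta> * ?q / 2) ^ (?n - 1) * (\<tau> * ?q / 4) \<le> real (card (SIGMA y:Y. T y))"
  proof -
    have "(\<delta> * ?q / 2) ^ (?n - 1) = (\<Prod>b\<in>Basis - {e}. \<delta> * ?q / 2)" using e by (simp add: card_Diff_singleton)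
    also have "\<dots> \<le> (\<Prod>b\<in>Basis - {e}. real (card (S b)))"
      using S(1) \<delta> by (intro prod_mono) (auto simp: mult.commute)
    also have "\<dots> = real (card Y)" unfolding Y_def by (subst card_PiE) auto
    finally have cY: "(\<delta> * ?q / 2) ^ (?n - 1) \<le> real (card Y)" .
    have "(\<delta> * ?q / 2) ^ (?n - 1) * (\<tau> * ?q / 4) \<le> real (card Y) * (\<tau> * ?q / 4)"
      using cY \<tau>0 by (intro mult_right_mono) auto
    also have "\<dots> = (\<Sum>y\<in>Y. \<tau> * ?q / 4)" by simp
    also have "\<dots> \<le> (\<Sum>y\<in>Y. real (card (T y)))" by (intro sum_mono T(1))
    also have "\<dots> = real (card (SIGMA y:Y. T y))" using finY T(2) by (simp add: card_SigmaI)
    finally show ?thesis .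
  qed
  ultimately show ?thesis by linarith
qed

text \<open>The conclusion of the theorem with a general factor \<open>\<Lambda>\<close>, so that
  scales can be treated before the power of R is inserted. Positivity of both norms excludes the
  empty inequality between zeros.\<close>

definition weighted_ratio_ge :: "'a::euclidean_space set \<Rightarrow> real \<Rightarrow> real \<Rightarrow> bool" where
  "weighted_ratio_ge \<Sigma> R \<Lambda> \<longleftrightarrow> (\<exists>(f :: 'a \<Rightarrow> complex) (w :: 'a \<Rightarrow> real).
     L2_on (surface_measure \<Sigma>) f \<and> L2_norm_sq (surface_measure \<Sigma>) f > 0 \<and>
     w \<in> borel_measurable lborel \<and> (\<forall>x. 0 \<le> w x \<and> w x \<le> 1) \<and>
     (\<forall>x. w x \<noteq> 0 \<longrightarrow> x \<in> ball 0 R) \<and> MT_norm w > 0 \<and>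
     (LINT x:ball 0 R|lborel. (cmod (extension_op \<Sigma> f x))\<^sup>2 * w x)
       \<ge> \<Lambda> * L2_norm_sq (surface_measure \<Sigma>) f * MT_norm w)"

lemma weighted_ratio_ge_mono:
  assumes "weighted_ratio_ge \<Sigma> R \<Lambda>" "\<Lambda>' \<le> \<Lambda>"
  shows "weighted_ratio_ge \<Sigma> R \<Lambda>'"
proof -
  obtain f w where fw: "L2_on (surface_measure \<Sigma>) f" "L2_norm_sq (surface_measure \<Sigma>) f > 0"
    "w \<in> borel_measurable lborel" "\<forall>x. 0 \<le> w x \<and> w x \<le> 1"
    "\<forall>x. w x \<noteq> 0 \<longrightarrow> x \<in> ball 0 R" "MT_norm w > 0"
    and ge: "\<Lambda> * L2_norm_sq (surface_measure \<Sigma>) f * MT_norm w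
      \<le> (LINT x:ball 0 R|lborel. (cmod (extension_op \<Sigma> f x))\<^sup>2 * w x)"
    using assms(1) unfolding weighted_ratio_ge_def by blast
  have "\<Lambda>' * L2_norm_sq (surface_measure \<Sigma>) f * MT_norm w \<le> \<Lambda> * L2_norm_sq (surface_measure \<Sigma>) f * MT_norm w"
    using assms(2) fw(2,6) by (intro mult_right_mono) auto
  from order_trans[OF this ge] fw show ?thesis unfolding weighted_ratio_ge_def by blast
qed

text \<open>With f the indicator of the caps, the squared norm of f is its mass S. On the Bohr set
  all phases agree up to 1/8 of a turn, half from \<open>phase\<close> and half from the cap radius,
  so the extension has modulus at least S/2. The left side is at least \<open>S^2/4\<close> times
  the volume of X, and one factor S cancels.\<close>

lemma scale_estimate:
  fixes \<Sigma> :: "'a::euclidean_space set" and u :: "'j \<Rightarrow> 'a" and v0 :: 'a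
  assumes \<Sigma>: "closed \<Sigma>" "hausdorff_outer (real (DIM('a) - 1)) \<Sigma> < top"
    and P: "finite P" "P \<noteq> {}" "P \<subseteq> \<Sigma>" and \<kappa>: "0 < \<kappa>"
    and cap: "\<And>p. p \<in> P \<Longrightarrow> ennreal \<kappa> \<le> hausdorff_outer (real (DIM('a) - 1)) (\<Sigma> \<inter> ball p r)"
    and sep: "\<And>p p'. p \<in> P \<Longrightarrow> p' \<in> P \<Longrightarrow> p \<noteq> p' \<Longrightarrow> 2 * r \<le> norm (p - p')"
    and R: "0 < R" "R * r \<le> 1/16" "R \<le> R'" and J: "finite J" and \<epsilon>: "0 < \<epsilon>"
    and phase: "\<And>x p. x \<in> bohr_set J u \<epsilon> \<Longrightarrow> p \<in> P \<Longrightarrow> \<exists>k::int. \<bar>x \<bullet> p - x \<bullet> v0 - of_int k\<bar> \<le> 1/16"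
    and tube: "\<And>\<nu> a. norm \<nu> = 1 \<Longrightarrow> emeasure lborel (bohr_set J u \<epsilon> \<inter> ball 0 R \<inter> tube a \<nu>) \<le> ennreal MT"
    and MT: "0 \<le> MT" and vol: "0 \<le> Vol" "Vol \<le> measure lborel (bohr_set J u \<epsilon> \<inter> ball 0 R)"
    and \<Lambda>: "0 \<le> \<Lambda>" "\<Lambda> * MT \<le> 1/4 * (real (card P) * \<kappa>) * Vol"
  shows "weighted_ratio_ge \<Sigma> R' \<Lambda>"
proof -
  define M where "M = surface_measure \<Sigma>"
  have setsM: "sets M = sets (restrict_space borel \<Sigma>)" by (simp add: M_def sets_surface_measure)
  have spaceM: "space M = \<Sigma>" by (simp add: M_def space_surface_measure)
  have cl_in: "\<Sigma> \<inter> B \<in> sets M" if "B \<in> sets borel" for B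
    using that by (auto simp: setsM sets_restrict_space)
  have emM: "emeasure M (\<Sigma> \<inter> B) = hausdorff_outer (real (DIM('a) - 1)) (\<Sigma> \<inter> B)" if "B \<in> sets borel" for B
    unfolding M_def by (rule emeasure_surface_measure) (use cl_in[OF that] in \<open>simp add: setsM\<close>)
  interpret M: finite_measure M
  proof
    have "emeasure M (space M) = hausdorff_outer (real (DIM('a) - 1)) \<Sigma>"
      using emM[of UNIV] by (simp add: spaceM)
    then show "emeasure M (space M) \<noteq> \<infinity>" using \<Sigma>(2) by simp
  qed
  have idM: "(\<lambda>s. s) \<in> measurable M borel"
    using measurable_restrict_space1[of "\<lambda>s. s" borel borel \<Sigma>] measurable_cong_sets[OF setsM refl] by auto
  define Y where "Y = (\<Union>p\<in>P. \<Sigma> \<inter> ball p r)"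
  have Ym: "Y \<in> sets M" unfolding Y_def using P(1) cl_in by (intro sets.finite_UN) auto
  define S where "S = measure M Y"
  have S_ge: "real (card P) * \<kappa> \<le> S"
  proof -
    have disj: "disjoint_family_on (\<lambda>p. \<Sigma> \<inter> ball p r) P"
      unfolding disjoint_family_on_def
    proof (intro ballI impI, rule ccontr)
      fix p p' assume pp: "p \<in> P" "p' \<in> P" "p \<noteq> p'" and "\<Sigma> \<inter> ball p r \<inter> (\<Sigma> \<inter> ball p' r) \<noteq> {}"
      then obtain s where "dist p s < r" "dist p' s < r" by auto
      then have "dist p p' < 2 * r" using dist_triangle_less_add[of p s r p' r] by (simp add: dist_commute)
      then show False using sep[OF pp] by (simp add: dist_norm)
    qed
    have "measure M Y = (\<Sum>p\<in>P. measure M (\<Sigma> \<inter> ball p r))"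
      unfolding Y_def using disj P(1) cl_in by (intro M.finite_measure_finite_Union) auto
    also have "\<dots> \<ge> (\<Sum>p\<in>P. \<kappa>)"
    proof (rule sum_mono)
      fix p assume "p \<in> P"
      from cap[OF this] have "ennreal \<kappa> \<le> ennreal (measure M (\<Sigma> \<inter> ball p r))"
        using emM[of "ball p r"] by (simp only: M.emeasure_eq_measure borel_open open_ball)
      then show "\<kappa> \<le> measure M (\<Sigma> \<inter> ball p r)" by simp
    qed
    finally show ?thesis by (simp add: S_def)
  qed
  have S0: "0 < S"
  proof -
    have "0 < card P" using P(1,2) by (simp add: card_gt_0_iff)
    then have "0 < real (card P) * \<kappa>" using \<kappa> by simp
    with S_ge show ?thesis by linarith
  qed
  define f where "f = (\<lambda>s. complex_of_real (indicator Y s))"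
  have fm[measurable]: "f \<in> borel_measurable M" unfolding f_def using Ym by measurable
  have f2: "(cmod (f s))\<^sup>2 = indicator Y s" for s by (simp add: f_def indicator_def)
  have intY: "integrable M (indicator Y :: 'a \<Rightarrow> real)"
    using Ym by (intro integrable_real_indicator) (auto simp: M.emeasure_eq_measure)
  have L2: "L2_on M f" "L2_norm_sq M f = S"
    unfolding L2_on_def L2_norm_sq_def f2 using fm intY Ym by (auto simp: S_def)
  define X where "X = bohr_set J u \<epsilon> \<inter> ball 0 R"
  have Xm[measurable]: "X \<in> sets borel" unfolding X_def using J by (intro sets.Int bohr_set_borel) auto
  define w where "w = (\<lambda>x. indicator X x :: real)"
  have XR': "X \<subseteq> ball 0 R'" using R(3) by (auto simp: X_def)
  have Xfin: "emeasure lborel X < \<infinity>"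
    by (rule emeasure_bounded_finite) (auto simp: X_def intro: bounded_subset[OF bounded_ball])
  define Ef where "Ef = (\<lambda>x. extension_op \<Sigma> f x)"
  have Ef: "Ef x = (LINT s|M. f s * cis (2 * pi * (x \<bullet> s)))" for x
    by (simp add: Ef_def extension_op_def M_def)
  have cism: "(\<lambda>s. cis (\<alpha> + 2 * pi * (x \<bullet> s))) \<in> borel_measurable M" for x \<alpha>
  proof -
    have "(\<lambda>s. cis (\<alpha> + 2 * pi * (x \<bullet> s))) \<in> borel_measurable borel"
      by (intro borel_measurable_continuous_onI continuous_intros)
    from measurable_compose[OF idM this] show ?thesis by simp
  qed
  have intf: "integrable M (\<lambda>s. f s * cis (\<alpha> + 2 * pi * (x \<bullet> s)))" for x \<alpha>
  proof (rule Bochner_Integration.integrable_bound[OF intY])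
    show "(\<lambda>s. f s * cis (\<alpha> + 2 * pi * (x \<bullet> s))) \<in> borel_measurable M" using cism by measurable
    show "AE s in M. norm (f s * cis (\<alpha> + 2 * pi * (x \<bullet> s))) \<le> norm (indicator Y s :: real)"
      by (simp add: norm_mult f_def)
  qed
  have Ef_le: "cmod (Ef x) \<le> S" for x
  proof -
    have "cmod (Ef x) \<le> (LINT s|M. cmod (f s * cis (2 * pi * (x \<bullet> s))))" unfolding Ef by (rule integral_norm_bound)
    also have "\<dots> = (LINT s|M. indicator Y s)"
      by (intro Bochner_Integration.integral_cong) (auto simp: norm_mult f_def indicator_def)
    also have "\<dots> = S" using Ym by (simp add: S_def)
    finally show ?thesis .
  qed
  have Ef_ge: "S / 2 \<le> cmod (Ef x)" if x: "x \<in> X" for x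
  proof -
    \<comment> \<open>The common translation v0 is arbitrary and rotates all phases by the same
      amount at a given x; the rotation is undone before taking real parts.\<close>
    define \<phi> where "\<phi> = 2 * pi * (x \<bullet> v0)"
    have pt: "indicator Y s * (1/2) \<le> Re (f s * cis (- \<phi> + 2 * pi * (x \<bullet> s)))" for s
    proof (cases "s \<in> Y")
      case True
      then obtain p where p: "p \<in> P" "norm (s - p) < r" by (auto simp: Y_def dist_norm norm_minus_commute)
      obtain k :: int where k: "\<bar>x \<bullet> p - x \<bullet> v0 - of_int k\<bar> \<le> 1/16"
        using phase[OF _ p(1), of x] x by (auto simp: X_def)
      have "\<bar>x \<bullet> (s - p)\<bar> \<le> norm x * norm (s - p)" by (rule Cauchy_Schwarz_ineq2)
      also have "\<dots> \<le> R * r" using x p(2) R(1) by (intro mult_mono) (auto simp: X_def)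
      also have "\<dots> \<le> 1/16" by (rule R(2))
      finally have "\<bar>x \<bullet> s - x \<bullet> p\<bar> \<le> 1/16" by (simp add: inner_diff_right)
      with k have "\<bar>x \<bullet> s - x \<bullet> v0 - of_int k\<bar> \<le> 1/6" by linarith
      then have "\<bar>2 * pi * (x \<bullet> s - x \<bullet> v0 - of_int k)\<bar> \<le> pi / 3"
        by (simp add: abs_mult)
      then have "1/2 \<le> cos (2 * pi * (x \<bullet> s - x \<bullet> v0 - of_int k))" by (rule cos_ge_half)
      also have "2 * pi * (x \<bullet> s - x \<bullet> v0 - of_int k) = (- \<phi> + 2 * pi * (x \<bullet> s)) - 2 * pi * of_int k"
        by (simp add: \<phi>_def algebra_simps)
      also have "cos \<dots> = cos (- \<phi> + 2 * pi * (x \<bullet> s))"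
        unfolding cos_diff using cos_int_2pin[of k] sin_int_2pin[of k] by simp
      finally show ?thesis using True by (simp add: f_def)
    qed (simp add: f_def)
    have "S / 2 = (LINT s|M. indicator Y s * (1/2))" using Ym by (simp add: S_def)
    also have "\<dots> \<le> (LINT s|M. Re (f s * cis (- \<phi> + 2 * pi * (x \<bullet> s))))"
      using intY integrable_Re[OF intf[of "- \<phi>" x]] pt by (intro integral_mono) auto
    also have "\<dots> = Re (LINT s|M. f s * cis (- \<phi> + 2 * pi * (x \<bullet> s)))" by (rule integral_Re[OF intf])
    also have "\<dots> \<le> cmod (LINT s|M. f s * cis (- \<phi> + 2 * pi * (x \<bullet> s)))" by (rule complex_Re_le_cmod)
    also have "(LINT s|M. f s * cis (- \<phi> + 2 * pi * (x \<bullet> s))) = (LINT s|M. cis (- \<phi>) * (f s * cis (2 * pi * (x \<bullet> s))))"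
      by (intro Bochner_Integration.integral_cong refl) (simp only: cis_mult[symmetric] mult_ac)
    also have "\<dots> = cis (- \<phi>) * Ef x" unfolding Ef by simp
    also have "cmod \<dots> = cmod (Ef x)" by (simp add: norm_mult)
    finally show ?thesis .
  qed
  have Efm: "Ef \<in> borel_measurable lborel"
  proof -
    have "(\<lambda>(x, s). f s * cis (2 * pi * (x \<bullet> s))) \<in> borel_measurable (lborel \<Otimes>\<^sub>M M)"
    proof -
      have s[measurable]: "(\<lambda>z. snd z) \<in> measurable (lborel \<Otimes>\<^sub>M M) borel"
        by (rule measurable_compose[OF measurable_snd idM])
      have x[measurable]: "(\<lambda>z. fst z) \<in> measurable (lborel \<Otimes>\<^sub>M M) borel"
        by (rule measurable_compose[OF measurable_fst]) simp
      have cis: "cis \<in> borel_measurable borel" by (intro borel_measurable_continuous_onI continuous_intros)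
      have "(\<lambda>z. 2 * pi * (fst z \<bullet> snd z)) \<in> borel_measurable (lborel \<Otimes>\<^sub>M M)" by measurable
      from measurable_compose[OF this cis]
      have "(\<lambda>z. f (snd z) * cis (2 * pi * (fst z \<bullet> snd z))) \<in> borel_measurable (lborel \<Otimes>\<^sub>M M)"
        by (intro borel_measurable_times measurable_compose[OF measurable_snd fm])
      then show ?thesis by (simp add: case_prod_beta)
    qed
    from M.borel_measurable_lebesgue_integral[OF this] show ?thesis
      unfolding Ef[abs_def] by simp
  qed
  have intX: "integrable lborel (indicator X :: 'a \<Rightarrow> real)"
    using Xfin by (intro integrable_real_indicator) auto
  have LHS: "S\<^sup>2 / 4 * measure lborel X \<le> (LINT x:ball 0 R'|lborel. (cmod (Ef x))\<^sup>2 * w x)"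
  proof -
    have "S\<^sup>2 / 4 * measure lborel X = (LINT x|lborel. indicator X x * (S\<^sup>2 / 4))" by simp
    also have "\<dots> \<le> (LINT x|lborel. indicator (ball 0 R') x *\<^sub>R ((cmod (Ef x))\<^sup>2 * w x))"
    proof (rule integral_mono)
      show "integrable lborel (\<lambda>x. indicator X x * (S\<^sup>2 / 4))" using intX by simp
      show "integrable lborel (\<lambda>x. indicator (ball 0 R') x *\<^sub>R ((cmod (Ef x))\<^sup>2 * w x))"
      proof (rule Bochner_Integration.integrable_bound[OF integrable_mult_right[OF intX, of "S\<^sup>2"]])
        show "(\<lambda>x. indicator (ball 0 R') x *\<^sub>R ((cmod (Ef x))\<^sup>2 * w x)) \<in> borel_measurable lborel"
          unfolding w_def using Efm
          by (intro borel_measurable_scaleR borel_measurable_times borel_measurable_power borel_measurable_norm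
              borel_measurable_indicator) auto
        have "(cmod (Ef x))\<^sup>2 \<le> S\<^sup>2" for x using Ef_le[of x] by (intro power_mono) auto
        then show "AE x in lborel. norm (indicator (ball 0 R') x *\<^sub>R ((cmod (Ef x))\<^sup>2 * w x)) \<le> norm (S\<^sup>2 * indicator X x)"
          by (intro AE_I2) (auto simp: w_def indicator_def)
      qed
      fix x
      show "indicator X x * (S\<^sup>2 / 4) \<le> indicator (ball 0 R') x *\<^sub>R ((cmod (Ef x))\<^sup>2 * w x)"
      proof (cases "x \<in> X")
        case True
        have "(S / 2)\<^sup>2 \<le> (cmod (Ef x))\<^sup>2" using Ef_ge[OF True] S0 by (intro power_mono) auto
        then show ?thesis using True XR' by (auto simp: w_def power_divide)
      qed (simp add: w_def)
    qed
    finally show ?thesis by (simp add: set_lebesgue_integral_def)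
  qed
  have tube_int: "(LINT x:tube a \<nu>|lborel. w x) = measure lborel (X \<inter> tube a \<nu>)" for a \<nu>
  proof -
    have "(LINT x:tube a \<nu>|lborel. w x) = (LINT x|lborel. indicator (X \<inter> tube a \<nu>) x)"
      unfolding set_lebesgue_integral_def by (intro Bochner_Integration.integral_cong) (auto simp: w_def indicator_def)
    then show ?thesis by simp
  qed
  have tube_le: "(LINT x:tube a \<nu>|lborel. w x) \<le> MT" if "\<nu> \<in> sphere 0 1" for a \<nu>
  proof -
    have "measure lborel (X \<inter> tube a \<nu>) \<le> MT"
      unfolding measure_def X_def using tube[of \<nu> a] MT that by (intro enn2real_leI) auto
    then show ?thesis by (simp add: tube_int)
  qed
  have max_le: "MT_max w \<nu> \<le> MT" if "\<nu> \<in> sphere 0 1" for \<nu>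
    unfolding MT_max_def using tube_le[OF that] by (intro cSUP_least) auto
  have ne: "sphere (0::'a) 1 \<noteq> {}"
    using nonempty_Basis by (metis mem_sphere_0 norm_Basis ex_in_conv)
  have norm_le: "MT_norm w \<le> MT"
    unfolding MT_norm_def using max_le ne by (intro cSUP_least) auto
  have norm_pos: "0 < MT_norm w"
  proof -
    obtain \<nu> :: 'a where \<nu>: "\<nu> \<in> sphere 0 1" using ne by blast
    \<comment> \<open>Radius of a ball around the origin contained in X and in the tube through 0:
      there all \<open>x \<bullet> u j\<close> are within \<open>\<epsilon>\<close> of the integer
      0.\<close>
    define \<rho> where "\<rho> = min (min R (1/2)) (\<epsilon> / (1 + (\<Sum>j\<in>J. norm (u j))))"
    have sum0: "0 \<le> (\<Sum>j\<in>J. norm (u j))" by (intro sum_nonneg) auto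
    have \<rho>0: "0 < \<rho>" using R(1) \<epsilon> sum0 by (simp add: \<rho>_def)
    have sub: "ball 0 \<rho> \<subseteq> X \<inter> tube 0 \<nu>"
    proof
      fix x :: 'a assume "x \<in> ball 0 \<rho>"
      then have x: "norm x < \<rho>" by simp
      have "\<bar>x \<bullet> u j\<bar> \<le> \<epsilon>" if j: "j \<in> J" for j
      proof -
        have "\<bar>x \<bullet> u j\<bar> \<le> norm x * norm (u j)" by (rule Cauchy_Schwarz_ineq2)
        also have "\<dots> \<le> \<rho> * (1 + (\<Sum>j\<in>J. norm (u j)))"
          using x \<rho>0 member_le_sum[of j J "\<lambda>j. norm (u j)"] j J by (intro mult_mono) auto
        also have "\<dots> \<le> \<epsilon> / (1 + (\<Sum>j\<in>J. norm (u j))) * (1 + (\<Sum>j\<in>J. norm (u j)))"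
          using sum0 by (intro mult_right_mono) (auto simp: \<rho>_def)
        also have "\<dots> = \<epsilon>" using sum0 by simp
        finally show ?thesis .
      qed
      then have "x \<in> bohr_set J u \<epsilon>" unfolding bohr_set_def by (auto intro!: exI[of _ 0])
      moreover have "norm x < R" using x by (simp add: \<rho>_def)
      moreover have "x \<in> tube 0 \<nu>"
      proof -
        have "\<bar>x \<bullet> \<nu>\<bar> \<le> norm x * norm \<nu>" by (rule Cauchy_Schwarz_ineq2)
        then have "norm (x - (x \<bullet> \<nu>) *\<^sub>R \<nu>) \<le> norm x + norm x"
          using norm_triangle_ineq4[of x "(x \<bullet> \<nu>) *\<^sub>R \<nu>"] \<nu> by simp
        also have "\<dots> < 1" using x by (simp add: \<rho>_def)
        finally show ?thesis by (simp add: tube_def)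
      qed
      ultimately show "x \<in> X \<inter> tube 0 \<nu>" by (simp add: X_def)
    qed
    have "0 < measure lborel (ball (0::'a) \<rho>)" using \<rho>0 by (simp add: content_ball)
    also have "\<dots> \<le> measure lborel (X \<inter> tube 0 \<nu>)"
    proof (rule measure_mono_fmeasurable[OF sub])
      have "emeasure lborel (X \<inter> tube 0 \<nu>) < \<infinity>"
        by (rule emeasure_bounded_finite) (auto simp: X_def intro: bounded_subset[OF bounded_ball])
      then show "X \<inter> tube 0 \<nu> \<in> fmeasurable lborel" by (intro fmeasurableI) auto
    qed simp
    also have "\<dots> \<le> MT_max w \<nu>"
      unfolding MT_max_def tube_int[symmetric]
      by (rule cSUP_upper) (use tube_le[OF \<nu>] in \<open>auto intro!: bdd_aboveI2\<close>)
    also have "\<dots> \<le> MT_norm w"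
      unfolding MT_norm_def by (rule cSUP_upper[OF \<nu>]) (use max_le in \<open>auto intro!: bdd_aboveI2\<close>)
    finally show ?thesis .
  qed
  have main: "\<Lambda> * S * MT_norm w \<le> (LINT x:ball 0 R'|lborel. (cmod (Ef x))\<^sup>2 * w x)"
  proof -
    have "\<Lambda> * S * MT_norm w \<le> \<Lambda> * S * MT" using norm_le \<Lambda>(1) S0 by (intro mult_left_mono) auto
    also have "\<dots> = S * (\<Lambda> * MT)" by simp
    also have "\<dots> \<le> S * (1/4 * (real (card P) * \<kappa>) * Vol)" using \<Lambda>(2) S0 by (intro mult_left_mono) auto
    also have "\<dots> \<le> S * (1/4 * S * measure lborel X)"
      using S_ge S0 vol unfolding X_def[symmetric] by (intro mult_left_mono mult_mono) auto
    also have "\<dots> = S\<^sup>2 / 4 * measure lborel X" by (simp add: power2_eq_square)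
    finally show ?thesis using LHS by linarith
  qed
  show ?thesis
    unfolding weighted_ratio_ge_def
  proof (intro exI[of _ f] exI[of _ w] conjI)
    show "L2_on (surface_measure \<Sigma>) f" "0 < L2_norm_sq (surface_measure \<Sigma>) f"
      using L2 S0 by (simp_all add: M_def[symmetric])
    show "\<Lambda> * L2_norm_sq (surface_measure \<Sigma>) f * MT_norm w \<le> (LINT x:ball 0 R'|lborel. (cmod (extension_op \<Sigma> f x))\<^sup>2 * w x)"
      using main L2 by (simp add: M_def[symmetric] Ef_def)
    show "w \<in> borel_measurable lborel" unfolding w_def by measurable
    show "\<forall>x. 0 \<le> w x \<and> w x \<le> 1" by (simp add: w_def indicator_def)
    show "\<forall>x. w x \<noteq> 0 \<longrightarrow> x \<in> ball 0 R'" using XR' by (auto simp: w_def indicator_def)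
  qed (rule norm_pos)
qed

text \<open>Hypothesis \<open>big\<close> says that the progression has on average at least one
  point in each of the \<open>K^(n-1)\<close> cells; a quarter of the cells then supply one point
  each. These lie in the progression modulo integer vectors only, which is why the basis vectors
  join the generators in the index set \<open>{..<m} <+> Basis\<close>.\<close>

lemma scale_points:
  fixes e :: "'a::euclidean_space" and \<eta> \<delta> \<tau> \<beta> :: real
  assumes dim: "2 \<le> DIM('a)" and e: "e \<in> Basis"
    and \<eta>: "0 < \<eta>" and L: "1 \<le> L" and Z: "2 * DIM('a) \<le> Z"
    and fine: "real DIM('a) * ((real m + 1) * real L) / real Z \<le> \<eta>"
    and small: "real ((2 * Z + 1) ^ DIM('a)) * 2 ^ m * ((2 * real L) ^ (m + DIM('a)) * (13 * real DIM('a) * \<eta>)) ^ d \<le> 1 / 4"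
    and \<delta>: "0 < \<delta>" and \<tau>: "0 < \<tau>" "\<tau> \<le> 1/4" and \<beta>: "0 < \<beta>" "\<beta> + 4 * \<delta> * real K \<le> 1 / (2 * real DIM('a))"
    and big: "1 \<le> real L ^ m * ((\<delta> / 2) ^ (DIM('a) - 1) * (\<tau> / 4))"
  shows "\<exists>(P :: 'a set) (u :: nat \<Rightarrow> 'a) (v0 :: 'a). finite P \<and> K ^ (DIM('a) - 1) \<le> 4 * card P \<and>
    (\<forall>p\<in>P. 1 - \<tau> \<le> p \<bullet> p \<and> p \<bullet> p \<le> 1 \<and> 0 \<le> p \<bullet> e \<and> (\<forall>b\<in>Basis - {e}. \<beta> \<le> p \<bullet> b \<and> p \<bullet> b \<le> \<beta> + 4 * \<delta> * real K)) \<and>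
    (\<forall>p\<in>P. \<forall>p'\<in>P. p \<noteq> p' \<longrightarrow> 3 * \<delta> \<le> norm (p - p')) \<and>
    (\<forall>p\<in>P. \<exists>(a :: nat \<Rightarrow> nat) (b :: 'a \<Rightarrow> nat). (\<forall>i<m. a i \<le> L) \<and> (\<forall>c\<in>Basis. b c \<le> m * L) \<and>
       p = v0 + (\<Sum>i<m. real (a i) *\<^sub>R u i) - (\<Sum>c\<in>Basis. real (b c) *\<^sub>R c)) \<and>
    (\<forall>\<nu> \<theta>. norm \<nu> = 1 \<longrightarrow> card {a \<in> PiE ({..<m} <+> Basis) (\<lambda>_. {..<L}).
       \<bar>(\<Sum>j\<in>{..<m} <+> Basis. real (a j) * (\<nu> \<bullet> case_sum u id j)) - \<theta>\<bar> \<le> \<eta>} \<le> L ^ (DIM('a) + d))"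
proof -
  let ?n = "DIM('a)"
  \<comment> \<open>Lower bounds on q: finer than \<open>\<eta>\<close>, coefficients below L
    distinct modulo q, and cells wide and thick enough to contain grid points.\<close>
  obtain q0 :: nat where q0: "max (max (1 / \<eta>) (real L)) (max (2 / \<delta>) (4 / \<tau>)) < real q0"
    using reals_Archimedean2 by blast
  obtain q where q: "prime q" "q0 < q" using bigger_prime by blast
  have qb: "1 / \<eta> \<le> real q" "L \<le> q" "2 / \<delta> \<le> real q" "4 / \<tau> \<le> real q"
    using q0 q(2) by simp_all
  have qpos: "0 < q" using q by simp
  have q\<delta>: "2 \<le> \<delta> * real q" "4 \<le> \<tau> * real q" using qb(3,4) \<delta> \<tau> by (simp_all add: field_simps)
  define I where "I = PiE (Basis - {e}) (\<lambda>_. {..<K})"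
  \<comment> \<open>Cells have side \<open>\<delta>\<close> but spacing \<open>4 \<delta>\<close>,
    so points of different cells differ by at least \<open>3 \<delta>\<close> in some
    coordinate.\<close>
  define lo where "lo = (\<lambda>(i :: 'a \<Rightarrow> nat) b. \<beta> + 4 * \<delta> * real (i b))"
  define Q where "Q = (\<lambda>i. grid_cell q e (lo i) \<delta> \<tau>)"
  have finI: "finite I" unfolding I_def by (intro finite_PiE) auto
  have cardI: "card I = K ^ (?n - 1)" unfolding I_def using e by (simp add: card_PiE card_Diff_singleton)
  have lo_range: "\<beta> \<le> lo i b" "lo i b + \<delta> \<le> \<beta> + 4 * \<delta> * real K" if i: "i \<in> I" "b \<in> Basis - {e}" for i b
  proof -
    have "i b < K" using PiE_mem[OF i(1)[unfolded I_def] i(2)] by simp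
    then have "real (i b) + 1 \<le> real K" by simp
    then have "4 * \<delta> * (real (i b) + 1) \<le> 4 * \<delta> * real K" using \<delta> by (intro mult_left_mono) auto
    then show "\<beta> \<le> lo i b" "lo i b + \<delta> \<le> \<beta> + 4 * \<delta> * real K"
      using \<delta> by (auto simp: lo_def distrib_left)
  qed
  have Qsub: "Q i \<subseteq> PiE Basis (\<lambda>_. {..<q})" for i unfolding Q_def grid_cell_def by blast
  have Qbig: "q ^ ?n \<le> L ^ m * card (Q i)" if i: "i \<in> I" for i
  proof -
    have "(\<delta> * real q / 2) ^ (?n - 1) * (\<tau> * real q / 4) \<le> real (card (Q i))"
      unfolding Q_def
    proof (rule card_grid_cell_ge[OF e dim _ _ \<delta> q\<delta>(1) \<tau>(2) q\<delta>(2)])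
      fix b assume b: "b \<in> Basis - {e}"
      show "0 < lo i b" using lo_range(1)[OF i b] \<beta>(1) by linarith
      show "lo i b + \<delta> \<le> 1 / (2 * real ?n)" using lo_range(2)[OF i b] \<beta>(2) by linarith
    qed
    moreover have "(\<delta> * real q / 2) ^ (?n - 1) * (\<tau> * real q / 4) = real q ^ ?n * ((\<delta> / 2) ^ (?n - 1) * (\<tau> / 4))"
    proof -
      have "real q ^ ?n = real q ^ (?n - 1) * real q" using dim by (cases ?n) auto
      moreover have "(\<delta> * real q / 2) ^ (?n - 1) = (\<delta> / 2) ^ (?n - 1) * real q ^ (?n - 1)"
        by (simp add: power_mult_distrib[symmetric])
      ultimately show ?thesis by (simp only: mult_ac times_divide_eq_left times_divide_eq_right)
    qed
    ultimately have "real q ^ ?n * ((\<delta> / 2) ^ (?n - 1) * (\<tau> / 4)) \<le> real (card (Q i))" by (simp only:)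
    then have "real L ^ m * (real q ^ ?n * ((\<delta> / 2) ^ (?n - 1) * (\<tau> / 4))) \<le> real L ^ m * real (card (Q i))"
      by (rule mult_left_mono) simp
    moreover have "real q ^ ?n * 1 \<le> real q ^ ?n * (real L ^ m * ((\<delta> / 2) ^ (?n - 1) * (\<tau> / 4)))"
      using big by (intro mult_left_mono) auto
    ultimately have "real q ^ ?n \<le> real L ^ m * real (card (Q i))" by (simp only: mult_ac mult_1_right)
    then have "real (q ^ ?n) \<le> real (L ^ m * card (Q i))" by simp
    then show ?thesis by (simp only: of_nat_le_iff)
  qed
  obtain V where V: "V \<in> grid_functions m q" "nonresonant m q L d \<eta> V"
    and Vhit: "card I \<le> 4 * card {i \<in> I. \<exists>a\<in>PiE {..<m} (\<lambda>_. {..<L}). grid_point m q V a \<in> Q i}"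
    by (rule exists_nonresonant_hitting[OF q(1) qb(1,2) \<eta> L Z fine small finI, of Q]) (use Qsub Qbig in auto)
  have Vlt: "V (i, c) < q" if "i \<le> m" "c \<in> Basis" for i c
    using V(1) that by (auto simp: grid_functions_def)
  define h where "h = {i \<in> I. \<exists>a\<in>PiE {..<m} (\<lambda>_. {..<L}). grid_point m q V a \<in> Q i}"
  have "\<forall>i\<in>h. \<exists>a. a \<in> PiE {..<m} (\<lambda>_. {..<L}) \<and> grid_point m q V a \<in> Q i" unfolding h_def by blast
  then obtain A where A: "\<And>i. i \<in> h \<Longrightarrow> A i \<in> PiE {..<m} (\<lambda>_. {..<L})" "\<And>i. i \<in> h \<Longrightarrow> grid_point m q V (A i) \<in> Q i"
    by metis
  define pt where "pt = (\<lambda>i. \<Sum>b\<in>(Basis :: 'a set). (real (grid_point m q V (A i) b) / real q) *\<^sub>R b)"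
  have ptb: "pt i \<bullet> b = real (grid_point m q V (A i) b) / real q" if "b \<in> Basis" for i b
    unfolding pt_def using that by (simp add: inner_sum_left_Basis)
  have hI: "h \<subseteq> I" by (auto simp: h_def)
  have cell: "(\<forall>b\<in>Basis - {e}. lo i b \<le> pt i \<bullet> b \<and> pt i \<bullet> b \<le> lo i b + \<delta>)" "1 - \<tau> \<le> pt i \<bullet> pt i" "pt i \<bullet> pt i \<le> 1" if i: "i \<in> h" for i
  proof -
    have "pt i \<bullet> pt i = (\<Sum>b\<in>Basis. (real (grid_point m q V (A i) b) / real q)\<^sup>2)"
      by (subst euclidean_inner) (auto intro!: sum.cong simp: ptb power2_eq_square)
    moreover have c: "grid_point m q V (A i) \<in> grid_cell q e (lo i) \<delta> \<tau>" using A(2)[OF i] by (simp only: Q_def)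
    ultimately show "1 - \<tau> \<le> pt i \<bullet> pt i" "pt i \<bullet> pt i \<le> 1"
      unfolding grid_cell_def by auto
    show "(\<forall>b\<in>Basis - {e}. lo i b \<le> pt i \<bullet> b \<and> pt i \<bullet> b \<le> lo i b + \<delta>)"
      using c unfolding grid_cell_def by (auto simp: ptb)
  qed
  have sep: "3 * \<delta> \<le> norm (pt i - pt i')" if i: "i \<in> h" "i' \<in> h" "i \<noteq> i'" for i i'
  proof -
    have "\<exists>b\<in>Basis - {e}. i b \<noteq> i' b"
      using PiE_ext[of i "Basis - {e}" "\<lambda>_. {..<K}" i'] i hI unfolding I_def by blast
    then obtain b where b: "b \<in> Basis - {e}" "i b \<noteq> i' b" by blast
    have "1 \<le> \<bar>real (i b) - real (i' b)\<bar>" using b(2) by linarith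
    then have "4 * \<delta> * 1 \<le> 4 * \<delta> * \<bar>real (i b) - real (i' b)\<bar>" using \<delta> by (intro mult_left_mono) auto
    also have "\<dots> = \<bar>lo i b - lo i' b\<bar>" using \<delta> by (simp add: lo_def right_diff_distrib[symmetric] abs_mult)
    finally have "4 * \<delta> \<le> \<bar>lo i b - lo i' b\<bar>" by simp
    moreover have "lo i b \<le> pt i \<bullet> b" "pt i \<bullet> b \<le> lo i b + \<delta>" "lo i' b \<le> pt i' \<bullet> b" "pt i' \<bullet> b \<le> lo i' b + \<delta>"
      using cell(1) i b by auto
    ultimately have "3 * \<delta> \<le> \<bar>pt i \<bullet> b - pt i' \<bullet> b\<bar>" by linarith
    also have "\<dots> \<le> norm (pt i - pt i')" using Basis_le_norm[of b "pt i - pt i'"] b by (simp add: inner_diff_left)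
    finally show ?thesis .
  qed
  have inj: "inj_on pt h"
  proof (rule inj_onI, rule ccontr)
    fix i i' assume "i \<in> h" "i' \<in> h" "pt i = pt i'" "i \<noteq> i'"
    then show False using sep[of i i'] \<delta> by simp
  qed
  define P where "P = pt ` h"
  define u where "u = (\<lambda>j. \<Sum>c\<in>(Basis :: 'a set). (real (V (j, c)) / real q) *\<^sub>R c)"
  have ub: "u j \<bullet> c = real (V (j, c)) / real q" if "c \<in> Basis" for j c
    unfolding u_def using that by (simp add: inner_sum_left_Basis)
  have "finite P" unfolding P_def using finite_subset[OF hI finI] by simp
  moreover have "K ^ (?n - 1) \<le> 4 * card P"
    using Vhit card_image[OF inj] by (simp add: P_def h_def cardI)
  moreover have "\<forall>p\<in>P. 1 - \<tau> \<le> p \<bullet> p \<and> p \<bullet> p \<le> 1 \<and> 0 \<le> p \<bullet> e \<and> (\<forall>b\<in>Basis - {e}. \<beta> \<le> p \<bullet> b \<and> p \<bullet> b \<le> \<beta> + 4 * \<delta> * real K)"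
  proof
    fix p assume "p \<in> P"
    then obtain i where i: "i \<in> h" "p = pt i" by (auto simp: P_def)
    have "\<beta> \<le> p \<bullet> b \<and> p \<bullet> b \<le> \<beta> + 4 * \<delta> * real K" if b: "b \<in> Basis - {e}" for b
    proof -
      have "lo i b \<le> pt i \<bullet> b \<and> pt i \<bullet> b \<le> lo i b + \<delta>" using cell(1)[OF i(1)] b by blast
      then show ?thesis using lo_range[OF subsetD[OF hI i(1)] b] unfolding i(2) by linarith
    qed
    then show "1 - \<tau> \<le> p \<bullet> p \<and> p \<bullet> p \<le> 1 \<and> 0 \<le> p \<bullet> e \<and> (\<forall>b\<in>Basis - {e}. \<beta> \<le> p \<bullet> b \<and> p \<bullet> b \<le> \<beta> + 4 * \<delta> * real K)"
      using cell(2,3)[OF i(1)] ptb[OF e, of i] by (simp add: i(2))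
  qed
  moreover have "\<forall>p\<in>P. \<forall>p'\<in>P. p \<noteq> p' \<longrightarrow> 3 * \<delta> \<le> norm (p - p')"
    unfolding P_def using sep by auto
  moreover have "\<forall>p\<in>P. \<exists>(a :: nat \<Rightarrow> nat) (b :: 'a \<Rightarrow> nat). (\<forall>i<m. a i \<le> L) \<and> (\<forall>c\<in>Basis. b c \<le> m * L) \<and>
       p = u m + (\<Sum>i<m. real (a i) *\<^sub>R u i) - (\<Sum>c\<in>Basis. real (b c) *\<^sub>R c)"
  proof
    fix p assume "p \<in> P"
    then obtain i where i: "i \<in> h" "p = pt i" by (auto simp: P_def)
    let ?a = "A i"
    define t where "t = (\<lambda>c. V (m, c) + (\<Sum>j<m. ?a j * V (j, c)))"
    define b where "b = (\<lambda>c. t c div q)"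
    have a: "?a j < L" if "j < m" for j using PiE_mem[OF A(1)[OF i(1)], of j] that by simp
    \<comment> \<open>\<open>b\<close> is the integer part lost in the reduction modulo
      \<open>q\<close>; before it, every coordinate is below \<open>(m * L + 1) * q\<close>.\<close>
    have "b c \<le> m * L" if c: "c \<in> Basis" for c
    proof -
      have "(\<Sum>j<m. ?a j * V (j, c)) \<le> (\<Sum>j<m. L * q)"
        using a Vlt c by (intro sum_mono mult_le_mono) (auto intro: less_imp_le)
      then have "t c < q + m * L * q" unfolding t_def using Vlt[of m c] c by simp
      then have "t c < Suc (m * L) * q" by simp
      then have "b c < Suc (m * L)" unfolding b_def by (rule less_mult_imp_div_less)
      then show ?thesis by simp
    qed
    moreover have "p = u m + (\<Sum>j<m. real (?a j) *\<^sub>R u j) - (\<Sum>c\<in>Basis. real (b c) *\<^sub>R c)"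
    proof (rule euclidean_eqI)
      fix c :: 'a assume c: "c \<in> Basis"
      have "real (t c) = real (b c) * real q + real (t c mod q)"
        unfolding b_def of_nat_mult[symmetric] of_nat_add[symmetric] by simp
      then have m: "real (t c mod q) / real q = real (t c) / real q - real (b c)"
        using qpos by (simp add: field_simps)
      have "p \<bullet> c = real (t c mod q) / real q" using c by (simp add: i(2) ptb grid_point_def t_def)
      also have "\<dots> = (real (V (m, c)) + (\<Sum>j<m. real (?a j) * real (V (j, c)))) / real q - real (b c)"
        unfolding m by (simp add: t_def)
      also have "\<dots> = u m \<bullet> c + (\<Sum>j<m. real (?a j) * (u j \<bullet> c)) - real (b c)"
        using c by (simp add: ub add_divide_distrib sum_divide_distrib)
      also have "\<dots> = (u m + (\<Sum>j<m. real (?a j) *\<^sub>R u j) - (\<Sum>c\<in>Basis. real (b c) *\<^sub>R c)) \<bullet> c"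
        using c by (simp add: inner_add_left inner_diff_left inner_sum_left inner_Basis if_distrib sum.delta' cong: if_cong)
      finally show "p \<bullet> c = (u m + (\<Sum>j<m. real (?a j) *\<^sub>R u j) - (\<Sum>c\<in>Basis. real (b c) *\<^sub>R c)) \<bullet> c" .
    qed
    ultimately show "\<exists>(a :: nat \<Rightarrow> nat) (b :: 'a \<Rightarrow> nat). (\<forall>i<m. a i \<le> L) \<and> (\<forall>c\<in>Basis. b c \<le> m * L) \<and>
       p = u m + (\<Sum>i<m. real (a i) *\<^sub>R u i) - (\<Sum>c\<in>Basis. real (b c) *\<^sub>R c)"
      using a by (intro exI[of _ ?a] exI[of _ b]) (auto intro: less_imp_le)
  qed
  moreover have "\<forall>\<nu> \<theta>. norm \<nu> = 1 \<longrightarrow> card {a \<in> PiE ({..<m} <+> Basis) (\<lambda>_. {..<L}).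
       \<bar>(\<Sum>j\<in>{..<m} <+> Basis. real (a j) * (\<nu> \<bullet> case_sum u id j)) - \<theta>\<bar> \<le> \<eta>} \<le> L ^ (?n + d)"
  proof (intro allI impI)
    fix \<nu> :: 'a and \<theta> :: real assume \<nu>: "norm \<nu> = 1"
    let ?S = "{a \<in> PiE ({..<m} <+> Basis) (\<lambda>_. {..<L}).
       \<bar>(\<Sum>j\<in>{..<m} <+> Basis. real (a j) * (\<nu> \<bullet> case_sum u id j)) - \<theta>\<bar> \<le> \<eta>}"
    \<comment> \<open>Splits a coefficient family on the disjoint sum into progression part and
      integer part, to match \<open>resonant\<close>.\<close>
    define F where "F = (\<lambda>a :: nat + 'a \<Rightarrow> nat. ((\<lambda>i\<in>{..<m}. a (Inl i)), (\<lambda>c\<in>(Basis :: 'a set). a (Inr c))))"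
    have "card ?S \<le> card (resonant m q L V \<eta> \<nu> \<theta>)"
    proof (rule card_inj_on_le)
      show "inj_on F ?S"
      proof (rule inj_onI)
        fix a a' assume a: "a \<in> ?S" "a' \<in> ?S" and eq: "F a = F a'"
        have l: "a (Inl i) = a' (Inl i)" if "i < m" for i
        proof -
          have "fst (F a) i = fst (F a') i" by (simp only: eq)
          then show ?thesis using that by (simp add: F_def)
        qed
        have r: "a (Inr c) = a' (Inr c)" if "c \<in> Basis" for c
        proof -
          have "snd (F a) c = snd (F a') c" by (simp only: eq)
          then show ?thesis using that by (simp add: F_def)
        qed
        show "a = a'"
          by (rule PiE_ext[of _ "{..<m} <+> Basis" "\<lambda>_. {..<L}"]) (use a l r in auto)
      qed
      show "F ` ?S \<subseteq> resonant m q L V \<eta> \<nu> \<theta>"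
      proof (rule image_subsetI)
        fix a assume a: "a \<in> ?S"
        have mem: "a j < L" if "j \<in> {..<m} <+> Basis" for j
          using a PiE_mem[of a "{..<m} <+> Basis" "\<lambda>_. {..<L}" j] that by simp
        have "pairing m q (\<lambda>c. \<nu> \<bullet> c) V (\<lambda>i. real ((\<lambda>i\<in>{..<m}. a (Inl i)) i)) = (\<Sum>i<m. real (a (Inl i)) * (\<nu> \<bullet> u i))"
          unfolding pairing_def
        proof (intro sum.cong refl)
          fix i assume "i \<in> {..<m}"
          moreover have "(\<Sum>c\<in>Basis. (\<nu> \<bullet> c) * (real (V (i, c)) / real q)) = \<nu> \<bullet> u i"
            by (subst euclidean_inner[of \<nu> "u i"]) (simp add: ub)
          ultimately show "real ((\<lambda>i\<in>{..<m}. a (Inl i)) i) * (\<Sum>c\<in>Basis. (\<nu> \<bullet> c) * (real (V (i, c)) / real q)) = real (a (Inl i)) * (\<nu> \<bullet> u i)"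
            by simp
        qed
        moreover have "(\<Sum>c\<in>Basis. real ((\<lambda>c\<in>(Basis::'a set). a (Inr c)) c) * (\<nu> \<bullet> c)) = (\<Sum>c\<in>Basis. real (a (Inr c)) * (\<nu> \<bullet> c))"
          by (intro sum.cong) auto
        moreover have "(\<Sum>j\<in>{..<m} <+> Basis. real (a j) * (\<nu> \<bullet> case_sum u id j))
            = (\<Sum>i<m. real (a (Inl i)) * (\<nu> \<bullet> u i)) + (\<Sum>c\<in>Basis. real (a (Inr c)) * (\<nu> \<bullet> c))"
          by (simp add: sum.Plus comp_def)
        ultimately show "F a \<in> resonant m q L V \<eta> \<nu> \<theta>"
          unfolding resonant_def F_def using a mem by (simp add: InlI InrI)
      qed
      show "finite (resonant m q L V \<eta> \<nu> \<theta>)"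
      proof (rule finite_subset)
        show "resonant m q L V \<eta> \<nu> \<theta> \<subseteq> PiE {..<m} (\<lambda>_. {..<L}) \<times> PiE (Basis :: 'a set) (\<lambda>_. {..<L})"
          unfolding resonant_def by (rule subsetI, elim CollectE case_prodE conjE) (simp only:)
        show "finite (PiE {..<m} (\<lambda>_. {..<L}) \<times> PiE (Basis :: 'a set) (\<lambda>_. {..<L}))"
          by (intro finite_cartesian_product finite_PiE) auto
      qed
    qed
    also have "\<dots> \<le> L ^ (?n + d)" using V(2) \<nu> by (simp add: nonresonant_def)
    finally show "card ?S \<le> L ^ (?n + d)" .
  qed
  ultimately show ?thesis by blast
qed

text \<open>Each generator is off an integer by at most \<open>\<epsilon>\<close>, and the absolute
  coefficients sum to at most \<open>m * L + n * (m * L)\<close>.\<close>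

lemma bohr_phase:
  fixes u :: "nat \<Rightarrow> 'a::euclidean_space" and v0 :: 'a
  assumes x: "x \<in> bohr_set ({..<m} <+> Basis) (case_sum u id) \<epsilon>" and \<epsilon>: "0 \<le> \<epsilon>" "16 * real (m * L * (1 + DIM('a))) * \<epsilon> \<le> 1"
    and a: "\<And>i. i < m \<Longrightarrow> a i \<le> L" and b: "\<And>c. c \<in> Basis \<Longrightarrow> b c \<le> m * L"
  shows "\<exists>k::int. \<bar>x \<bullet> (v0 + (\<Sum>i<m. real (a i) *\<^sub>R u i) - (\<Sum>c\<in>Basis. real (b c) *\<^sub>R c)) - x \<bullet> v0 - of_int k\<bar> \<le> 1/16"
proof -
  have "\<exists>k::int. \<bar>x \<bullet> u i - of_int k\<bar> \<le> \<epsilon>" if "i < m" for i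
    using x that unfolding bohr_set_def by (force dest!: bspec[where x = "Inl i"])
  then obtain k :: "nat \<Rightarrow> int" where k: "\<And>i. i < m \<Longrightarrow> \<bar>x \<bullet> u i - of_int (k i)\<bar> \<le> \<epsilon>" by metis
  have "\<exists>l::int. \<bar>x \<bullet> c - of_int l\<bar> \<le> \<epsilon>" if "c \<in> Basis" for c
    using x that unfolding bohr_set_def by (force dest!: bspec[where x = "Inr c"])
  then obtain l :: "'a \<Rightarrow> int" where l: "\<And>c. c \<in> Basis \<Longrightarrow> \<bar>x \<bullet> c - of_int (l c)\<bar> \<le> \<epsilon>" by metis
  define K where "K = (\<Sum>i<m. int (a i) * k i) - (\<Sum>c\<in>Basis. int (b c) * l c)"
  have "x \<bullet> (v0 + (\<Sum>i<m. real (a i) *\<^sub>R u i) - (\<Sum>c\<in>Basis. real (b c) *\<^sub>R c)) - x \<bullet> v0 - of_int K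
      = (\<Sum>i<m. real (a i) * (x \<bullet> u i - of_int (k i))) - (\<Sum>c\<in>Basis. real (b c) * (x \<bullet> c - of_int (l c)))"
    unfolding K_def by (simp add: inner_simps inner_sum_right right_diff_distrib sum_subtractf)
  also have "\<bar>\<dots>\<bar> \<le> (\<Sum>i<m. real L * \<epsilon>) + (\<Sum>c\<in>(Basis::'a set). real (m * L) * \<epsilon>)"
  proof -
    have "\<bar>\<Sum>i<m. real (a i) * (x \<bullet> u i - of_int (k i))\<bar> \<le> (\<Sum>i<m. real L * \<epsilon>)"
    proof (intro order_trans[OF sum_abs] sum_mono)
      fix i assume i: "i \<in> {..<m}"
      then show "\<bar>real (a i) * (x \<bullet> u i - of_int (k i))\<bar> \<le> real L * \<epsilon>"
        unfolding abs_mult using a[of i] k[of i] by (intro mult_mono) auto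
    qed
    moreover have "\<bar>\<Sum>c\<in>Basis. real (b c) * (x \<bullet> c - of_int (l c))\<bar> \<le> (\<Sum>c\<in>(Basis::'a set). real (m * L) * \<epsilon>)"
    proof (intro order_trans[OF sum_abs] sum_mono)
      fix c :: 'a assume c: "c \<in> Basis"
      have "real (b c) \<le> real (m * L)" using b[OF c] by (simp only: of_nat_le_iff)
      then show "\<bar>real (b c) * (x \<bullet> c - of_int (l c))\<bar> \<le> real (m * L) * \<epsilon>"
        unfolding abs_mult using l[OF c] by (intro mult_mono) auto
    qed
    ultimately show ?thesis by linarith
  qed
  also have "\<dots> = real (m * L * (1 + DIM('a))) * \<epsilon>" by (simp add: algebra_simps)
  also have "\<dots> \<le> 1/16" using \<epsilon>(2) by linarith
  finally show ?thesis by blast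
qed

section \<open>Choice of parameters\<close>

text \<open>Scale \<open>k\<close> has \<open>k\<^sup>2\<close> generators with coefficients below \<open>LL k\<close>, and \<open>RR k\<close> exceeds the size
  \<open>2 ^ ((n + 1) * k ^ 4)\<close> of the progression by the factor \<open>2 ^ (k ^ 3)\<close>, which is what makes the union bound work for
  tuples of length \<open>dd k\<close>. All losses are \<open>2 ^ O(k ^ 3)\<close>, hence negligible powers of \<open>RR k\<close>, and so is the
  ratio of consecutive scales.\<close>

locale scales =
  fixes n :: nat
  assumes n2: "2 \<le> n"
begin

text \<open>Each of the dd rows is worth at least \<open>2^(-k^3/2)\<close>, giving
  \<open>2^(-4n(n+1)k^4)\<close> in total, against a net of size about
  \<open>2^(3n(n+1)k^4)\<close>.\<close>

definition dd :: "nat \<Rightarrow> nat" where "dd k = 8 * n * (n + 1) * k"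
definition LL :: "nat \<Rightarrow> nat" where "LL k = 2 ^ ((n + 1) * k\<^sup>2)"
text \<open>Mesh of the direction net; a power of \<open>RR k\<close> high enough that rounding a
  direction changes pairings by at most \<open>\<eta> k\<close>.\<close>

definition ZZ :: "nat \<Rightarrow> nat" where "ZZ k = 2 ^ (3 * (n + 1) * k ^ 4)"
text \<open>Inverse width of the Bohr set, \<open>2^k * LL k\<close>. The surplus \<open>2^k\<close>
  absorbs the polynomial number of coefficients in \<open>bohr_phase\<close>.\<close>

definition NN :: "nat \<Rightarrow> nat" where "NN k = 2 ^ ((n + 1) * k\<^sup>2 + k)"
text \<open>Cells per direction, fitted so that the cells of scale k span exactly
  \<open>\<beta> k / 4\<close>. The subtraction is truncated and is meaningful only under
  \<open>exponent_ev\<close>.\<close>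

definition KK :: "nat \<Rightarrow> nat" where "KK k = 2 ^ (k ^ 4 - (2 * k + n + 6))"
definition RR :: "nat \<Rightarrow> real" where "RR k = 2 ^ ((n + 1) * k ^ 4 + k ^ 3)"
text \<open>Larger than 1/R by \<open>2^k\<close>, which turns the Gaussian tail into
  \<open>exp (- 4^k)\<close>.\<close>

definition \<eta> :: "nat \<Rightarrow> real" where "\<eta> k = 2 ^ k / RR k"
text \<open>The critical radius would be \<open>2^(-k^4)\<close>, with \<open>\<delta>^(n+1)\<close>
  the inverse size of the progression; the surplus \<open>2^k\<close> pays for the small factors in
  \<open>\<tau>\<close>.\<close>

definition \<delta> :: "nat \<Rightarrow> real" where "\<delta> k = 2 ^ k / 2 ^ (k ^ 4)"
definition \<tau> :: "nat \<Rightarrow> real" where "\<tau> k = (1/2) ^ k * (\<delta> k)\<^sup>2 / 120"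
text \<open>Position of the part of the sphere reserved for scale k. It at least halves from one
  scale to the next, which keeps the scales apart.\<close>

definition \<beta> :: "nat \<Rightarrow> real" where "\<beta> k = 1 / 2 ^ (k + n + 2)"

section \<open>Inequalities between the parameters\<close>

lemma of_nat_le_two_power: "real x \<le> 2 ^ x"
  using less_exp[of x] by (metis less_imp_le of_nat_le_iff of_nat_numeral of_nat_power)

lemma eventually_quartic: "\<forall>\<^sub>F k in sequentially. A * k ^ 3 + B * k\<^sup>2 + C * k + D \<le> (k :: nat) ^ 4"
  using eventually_ge_at_top[of "A + B + C + D + 1"]
proof eventually_elim
  case (elim k)
  have k1: "1 \<le> k" using elim by simp
  have "B * k\<^sup>2 \<le> B * k ^ 3" "C * k \<le> C * k ^ 3" "D * 1 \<le> D * k ^ 3"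
    using k1 power_increasing[of 2 3 k] power_increasing[of 1 3 k] by (auto intro!: mult_le_mono2 simp: one_le_power)
  then have "A * k ^ 3 + B * k\<^sup>2 + C * k + D \<le> (A + B + C + D) * k ^ 3"
    unfolding distrib_right by linarith
  also have "\<dots> \<le> k * k ^ 3" using elim by (intro mult_le_mono1) simp
  finally show ?case by (simp add: power_Suc[symmetric] del: power_Suc)
qed

lemma eventually_cubic: "\<forall>\<^sub>F k in sequentially. B * k\<^sup>2 + C * k + D \<le> (k :: nat) ^ 3"
  using eventually_ge_at_top[of "B + C + D + 1"]
proof eventually_elim
  case (elim k)
  have k1: "1 \<le> k" using elim by simp
  have "C * k \<le> C * k\<^sup>2" "D * 1 \<le> D * k\<^sup>2"
    using k1 power_increasing[of 1 2 k] by (auto intro!: mult_le_mono2 simp: one_le_power)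
  then have "B * k\<^sup>2 + C * k + D \<le> (B + C + D) * k\<^sup>2"
    unfolding distrib_right by linarith
  also have "\<dots> \<le> k * k\<^sup>2" using elim by (intro mult_le_mono1) simp
  finally show ?case by (simp add: numeral_3_eq_3 numeral_2_eq_2)
qed

lemma pos: "0 < \<eta> k" "1 \<le> LL k" "0 < \<delta> k" "0 < \<tau> k" "0 < \<beta> k" "1 \<le> RR k" "0 < NN k" "0 < KK k"
  by (simp_all add: \<eta>_def LL_def \<delta>_def \<tau>_def \<beta>_def RR_def NN_def KK_def)

lemma R\<eta>: "RR k * \<eta> k = 2 ^ k"
  using pos(6)[of k] by (simp add: \<eta>_def)

lemma Z_ge: "1 \<le> k \<Longrightarrow> 2 * n \<le> ZZ k"
proof -
  assume k: "1 \<le> k"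
  have "2 * n \<le> 3 * (n + 1) * 1" by simp
  also have "\<dots> \<le> 3 * (n + 1) * k ^ 4" using k by (intro mult_le_mono2) (simp add: one_le_power)
  also have "\<dots> < 2 ^ (3 * (n + 1) * k ^ 4)" by (rule less_exp)
  finally show ?thesis by (simp add: ZZ_def)
qed

lemma fine_ev: "\<forall>\<^sub>F k in sequentially. real n * ((real (k\<^sup>2) + 1) * real (LL k)) / real (ZZ k) \<le> \<eta> k"
  using eventually_quartic[of 1 "n + 2" 0 "n + 1"]
proof eventually_elim
  case (elim k)
  have e: "n + (k\<^sup>2 + 1) + (n + 1) * k\<^sup>2 + ((n + 1) * k ^ 4 + k ^ 3) \<le> 3 * (n + 1) * k ^ 4 + k"
  proof -
    have "k ^ 4 \<le> 2 * (n + 1) * k ^ 4" by simp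
    with elim have "1 * k ^ 3 + (n + 2) * k\<^sup>2 + 0 * k + (n + 1) \<le> 2 * (n + 1) * k ^ 4" by (rule order_trans)
    then show ?thesis by (simp add: algebra_simps)
  qed
  have "real n * ((real (k\<^sup>2) + 1) * real (LL k)) * RR k \<le> 2 ^ n * ((2 ^ (k\<^sup>2 + 1)) * 2 ^ ((n + 1) * k\<^sup>2)) * 2 ^ ((n + 1) * k ^ 4 + k ^ 3)"
    unfolding RR_def LL_def
    using of_nat_le_two_power[of n] of_nat_le_two_power[of "k\<^sup>2 + 1"] by (intro mult_mono) auto
  also have "\<dots> = 2 ^ (n + (k\<^sup>2 + 1) + (n + 1) * k\<^sup>2 + ((n + 1) * k ^ 4 + k ^ 3))"
    by (simp only: power_add mult.assoc)
  also have "\<dots> \<le> 2 ^ (3 * (n + 1) * k ^ 4 + k)" using e by (intro power_increasing) auto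
  also have "\<dots> = real (ZZ k) * 2 ^ k" by (simp add: ZZ_def power_add)
  finally have "real n * ((real (k\<^sup>2) + 1) * real (LL k)) * RR k \<le> real (ZZ k) * 2 ^ k" .
  moreover have "0 < real (ZZ k)" "0 < RR k" by (simp_all add: ZZ_def RR_def)
  ultimately show ?case unfolding \<eta>_def by (simp add: pos_divide_le_eq pos_le_divide_eq mult.commute)
qed

text \<open>The per-row factor y is \<open>2^(A - k^3)\<close> with A quadratic in k, so
  \<open>2A \<le> k^3\<close> eventually and \<open>y^2 \<le> 2^(-k^3)\<close>. Raised to
  \<open>dd k\<close>, it beats the net and leaves \<open>k^4\<close> to spare for the factors
  \<open>2^(k^2)\<close>, \<open>4^n\<close> and 4.\<close>

lemma small_ev: "\<forall>\<^sub>F k in sequentially. real ((2 * ZZ k + 1) ^ n) * 2 ^ (k\<^sup>2) *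
    ((2 * real (LL k)) ^ (k\<^sup>2 + n) * (13 * real n * \<eta> k)) ^ dd k \<le> 1 / 4"
  using eventually_cubic[of "2 * (n + 1) * n + 2" 2 "28 * n"] eventually_quartic[of 0 1 0 "2 * n + 2"]
proof eventually_elim
  case (elim k)
  define y where "y = (2 * real (LL k)) ^ (k\<^sup>2 + n) * (13 * real n * \<eta> k)"
  define A where "A = (n + 1) * n * k\<^sup>2 + k\<^sup>2 + 14 * n + k"
  have A: "2 * A \<le> k ^ 3" using elim(1) unfolding A_def by (simp add: algebra_simps)
  have y0: "0 \<le> y" using pos(1)[of k] by (simp add: y_def)
  have "(2 * real (LL k)) ^ (k\<^sup>2 + n) = 2 ^ (((n + 1) * k\<^sup>2 + 1) * (k\<^sup>2 + n))"
  proof -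
    have "2 * real (LL k) = 2 ^ ((n + 1) * k\<^sup>2 + 1)" by (simp add: LL_def)
    then show ?thesis by (simp only: power_mult)
  qed
  also have "((n + 1) * k\<^sup>2 + 1) * (k\<^sup>2 + n) = (n + 1) * k ^ 4 + ((n + 1) * n * k\<^sup>2 + k\<^sup>2 + n)"
    by (simp add: algebra_simps power2_eq_square power4_eq_xxxx)
  finally have "y = 2 ^ ((n + 1) * k ^ 4) * 2 ^ ((n + 1) * n * k\<^sup>2 + k\<^sup>2 + n) * (real (13 * n) * 2 ^ k) / (2 ^ ((n + 1) * k ^ 4) * 2 ^ (k ^ 3))"
    unfolding y_def \<eta>_def RR_def power_add[of _ "(n + 1) * k ^ 4"] by simp
  also have "\<dots> = 2 ^ ((n + 1) * n * k\<^sup>2 + k\<^sup>2 + n) * (real (13 * n) * 2 ^ k) / 2 ^ (k ^ 3)" by simp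
  also have "\<dots> \<le> 2 ^ ((n + 1) * n * k\<^sup>2 + k\<^sup>2 + n) * (2 ^ (13 * n) * 2 ^ k) / 2 ^ (k ^ 3)"
    using of_nat_le_two_power[of "13 * n"] by (intro divide_right_mono mult_left_mono mult_right_mono) auto
  also have "\<dots> = 2 ^ A / 2 ^ (k ^ 3)"
  proof -
    have "A = ((n + 1) * n * k\<^sup>2 + k\<^sup>2 + n) + (13 * n + k)" by (simp add: A_def)
    then show ?thesis by (simp only: power_add)
  qed
  finally have yA: "y \<le> 2 ^ A / 2 ^ (k ^ 3)" .
  have "y\<^sup>2 \<le> (2 ^ A / 2 ^ (k ^ 3))\<^sup>2" using yA y0 by (intro power_mono) auto
  also have "\<dots> = 2 ^ (2 * A) / (2 ^ (k ^ 3) * 2 ^ (k ^ 3))"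
    by (simp add: power2_eq_square mult_2 power_add)
  also have "\<dots> \<le> 2 ^ (k ^ 3) / (2 ^ (k ^ 3) * 2 ^ (k ^ 3))"
    using A by (intro divide_right_mono power_increasing) auto
  also have "\<dots> = 1 / 2 ^ (k ^ 3)" by simp
  finally have y2: "y\<^sup>2 \<le> 1 / 2 ^ (k ^ 3)" .
  have "y ^ dd k = (y\<^sup>2) ^ (4 * n * (n + 1) * k)"
  proof -
    have "dd k = 2 * (4 * n * (n + 1) * k)" by (simp add: dd_def)
    then show ?thesis by (simp only: power_mult)
  qed
  also have "\<dots> \<le> (1 / 2 ^ (k ^ 3)) ^ (4 * n * (n + 1) * k)" using y2 by (intro power_mono) auto
  also have "\<dots> = 1 / 2 ^ (k ^ 3 * (4 * n * (n + 1) * k))" by (simp add: power_divide power_mult)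
  also have "k ^ 3 * (4 * n * (n + 1) * k) = 4 * n * (n + 1) * k ^ 4"
    by (simp add: power4_eq_xxxx power3_eq_cube)
  finally have yd: "y ^ dd k \<le> 1 / 2 ^ (4 * n * (n + 1) * k ^ 4)" .
  have "2 * ZZ k + 1 \<le> 2 ^ (3 * (n + 1) * k ^ 4 + 2)"
  proof -
    have "1 \<le> ZZ k" by (simp add: ZZ_def)
    then have "2 * ZZ k + 1 \<le> 4 * ZZ k" by simp
    also have "\<dots> = 2 ^ (3 * (n + 1) * k ^ 4 + 2)" by (simp add: ZZ_def power_add)
    finally show ?thesis .
  qed
  then have "(2 * ZZ k + 1) ^ n \<le> (2 ^ (3 * (n + 1) * k ^ 4 + 2)) ^ n" by (rule power_mono) simp
  then have "real ((2 * ZZ k + 1) ^ n) \<le> real ((2 ^ (3 * (n + 1) * k ^ 4 + 2)) ^ n)" by (simp only: of_nat_le_iff)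
  also have "\<dots> = 2 ^ ((3 * (n + 1) * k ^ 4 + 2) * n)" by (simp only: of_nat_power power_mult of_nat_numeral)
  finally have Zn: "real ((2 * ZZ k + 1) ^ n) \<le> 2 ^ ((3 * (n + 1) * k ^ 4 + 2) * n)" .
  have "real ((2 * ZZ k + 1) ^ n) * 2 ^ (k\<^sup>2) * y ^ dd k
      \<le> 2 ^ ((3 * (n + 1) * k ^ 4 + 2) * n) * 2 ^ (k\<^sup>2) * (1 / 2 ^ (4 * n * (n + 1) * k ^ 4))"
    using Zn yd y0 by (intro mult_mono) auto
  also have "\<dots> = 2 ^ ((3 * (n + 1) * k ^ 4 + 2) * n + k\<^sup>2) / 2 ^ (4 * n * (n + 1) * k ^ 4)"
    by (simp add: power_add)
  also have "\<dots> \<le> 1 / 4"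
  proof -
    have "k ^ 4 \<le> n * (n + 1) * k ^ 4" using n2 by simp
    with elim(2) have "1 * k\<^sup>2 + (2 * n + 2) \<le> n * (n + 1) * k ^ 4" by linarith
    then have "((3 * (n + 1) * k ^ 4 + 2) * n + k\<^sup>2) + 2 \<le> 4 * n * (n + 1) * k ^ 4"
      by (simp add: algebra_simps)
    then have le: "(2::real) ^ (((3 * (n + 1) * k ^ 4 + 2) * n + k\<^sup>2) + 2) \<le> 2 ^ (4 * n * (n + 1) * k ^ 4)"
      by (intro power_increasing) auto
    have "(2::real) ^ ((3 * (n + 1) * k ^ 4 + 2) * n + k\<^sup>2) * 4 \<le> 2 ^ (4 * n * (n + 1) * k ^ 4)"
    proof -
      have four: "(2::real) ^ 2 = 4" by simp
      from le show ?thesis unfolding power_add[of 2 _ 2] four .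
    qed
    moreover have "a / b \<le> 1 / 4" if "a * 4 \<le> b" "0 < b" for a b :: real
      using that by (simp add: pos_divide_le_eq)
    ultimately show ?thesis by (metis zero_less_power zero_less_numeral)
  qed
  finally show ?case by (simp add: y_def)
qed

lemma exponent_ev: "\<forall>\<^sub>F k in sequentially. 2 * k + n + 6 \<le> k ^ 4"
  using eventually_quartic[of 0 0 2 "n + 6"] by eventually_elim simp

lemma \<tau>_le: "\<delta> k \<le> 1 \<Longrightarrow> \<tau> k \<le> 1 / 120"
proof -
  assume "\<delta> k \<le> 1"
  then have "(1/2) ^ k * (\<delta> k)\<^sup>2 \<le> 1 * 1"
    using pos(3)[of k] by (intro mult_mono power_le_one) auto
  then show ?thesis by (simp add: \<tau>_def)
qed

lemma cells_fit:
  assumes "2 * k + n + 6 \<le> k ^ 4"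
  shows "4 * \<delta> k * real (KK k) = \<beta> k / 4" "\<delta> k \<le> \<beta> k / 16" "\<delta> k \<le> 1" "\<beta> k + 4 * \<delta> k * real (KK k) \<le> 1 / (2 * real n)"
proof -
  obtain j where j: "k ^ 4 = (2 * k + n + 6) + j" using assms le_Suc_ex by blast
  have Kj: "KK k = 2 ^ j" by (simp add: KK_def j)
  have "k ^ 4 = k + k + (n + 6) + j" using j by simp
  then have "(2::real) ^ (k ^ 4) = 2 ^ k * 2 ^ k * 2 ^ (n + 6) * 2 ^ j" by (simp only: power_add)
  then have "4 * \<delta> k * real (KK k) = 4 * 2 ^ k * 2 ^ j / (2 ^ k * 2 ^ k * 2 ^ (n + 6) * 2 ^ j)"
    unfolding \<delta>_def Kj by simp
  also have "\<dots> = 4 / (2 ^ k * 2 ^ (n + 6))" by simp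
  also have "\<dots> = \<beta> k / 4" by (simp add: \<beta>_def power_add)
  finally show K: "4 * \<delta> k * real (KK k) = \<beta> k / 4" .
  have "4 * \<delta> k * 1 \<le> 4 * \<delta> k * real (KK k)"
    using pos(3,8)[of k] by (intro mult_left_mono) auto
  then show d: "\<delta> k \<le> \<beta> k / 16" using K by simp
  have b1: "\<beta> k \<le> 1"
  proof -
    have "(1::real) \<le> 2 ^ (k + n + 2)" by (rule one_le_power) simp
    then show ?thesis unfolding \<beta>_def by (simp only: divide_le_eq_1) simp
  qed
  then show "\<delta> k \<le> 1" using d by linarith
  have "\<beta> k * (4 * real n) \<le> 1"
  proof -
    have "real n \<le> 2 ^ n" by (rule of_nat_le_two_power)
    also have "(2::real) ^ n \<le> 2 ^ (k + n)" by (intro power_increasing) auto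
    finally show ?thesis unfolding \<beta>_def by (simp add: power_add)
  qed
  then have "\<beta> k \<le> 1 / (4 * real n)" using n2 by (simp add: pos_le_divide_eq)
  moreover have "1 / (2 * real n) = 2 * (1 / (4 * real n))" by simp
  ultimately show "\<beta> k + 4 * \<delta> k * real (KK k) \<le> 1 / (2 * real n)" using K pos(5)[of k] by linarith
qed

text \<open>The powers of \<open>2^(k^4)\<close> cancel. What remains is the surplus
  \<open>2^((n+1)k)\<close> against \<open>2^(n-1) * 2^k * 480\<close>, where 480 = 4 * 120 is below
  \<open>2^9\<close>; hence the bound 9 on k.\<close>

lemma big_enough:
  assumes "9 \<le> k"
  shows "1 \<le> real (LL k) ^ (k\<^sup>2) * ((\<delta> k / 2) ^ (n - 1) * (\<tau> k / 4))"
proof -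
  have Lm: "real (LL k) ^ (k\<^sup>2) = 2 ^ ((n + 1) * k ^ 4)"
  proof -
    have "(n + 1) * k ^ 4 = (n + 1) * k\<^sup>2 * k\<^sup>2"
      unfolding power4_eq_xxxx power2_eq_square by (simp only: mult_ac)
    then show ?thesis unfolding LL_def by (simp only: power_mult of_nat_power of_nat_numeral)
  qed
  have d: "\<delta> k ^ (n + 1) * 2 ^ ((n + 1) * k ^ 4) = 2 ^ ((n + 1) * k)"
  proof -
    have "(2 ^ k / 2 ^ (k ^ 4)) ^ (n + 1) = (2::real) ^ (k * (n + 1)) / 2 ^ (k ^ 4 * (n + 1))"
      by (simp only: power_divide power_mult)
    then show ?thesis unfolding \<delta>_def mult.commute[of "n + 1"] by simp
  qed
  have dn: "\<delta> k ^ (n - 1) * (\<delta> k)\<^sup>2 = \<delta> k ^ (n + 1)"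
    using n2 by (simp add: power_add[symmetric])
  have "real (LL k) ^ (k\<^sup>2) * ((\<delta> k / 2) ^ (n - 1) * (\<tau> k / 4)) = (\<delta> k ^ (n - 1) * (\<delta> k)\<^sup>2) * 2 ^ ((n + 1) * k ^ 4) / (2 ^ (n - 1) * 2 ^ k * 480)"
    unfolding Lm \<tau>_def by (simp add: power_divide mult_ac)
  also have "\<dots> = 2 ^ ((n + 1) * k) / (2 ^ (n - 1) * 2 ^ k * 480)" unfolding dn d ..
  also have "\<dots> \<ge> 1"
  proof -
    have "n * 9 \<le> n * k" using assms by (intro mult_le_mono2)
    then have "(n - 1) + k + 9 \<le> (n + 1) * k" using n2 unfolding distrib_right by linarith
    then have "(2::real) ^ ((n - 1) + k + 9) \<le> 2 ^ ((n + 1) * k)" by (intro power_increasing) auto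
    moreover have "(2::real) ^ (n - 1) * 2 ^ k * 480 \<le> 2 ^ (n - 1) * 2 ^ k * 2 ^ 9" by (intro mult_left_mono) auto
    ultimately have "(2::real) ^ (n - 1) * 2 ^ k * 480 \<le> 2 ^ ((n + 1) * k)" by (simp only: power_add)
    then show ?thesis by (simp only: le_divide_eq_1_pos mult_pos_pos zero_less_power zero_less_numeral)
  qed
  finally show ?thesis .
qed

lemma bohr_width: "3 \<le> k \<Longrightarrow> 8 * real (LL k) * (1 / real (NN k)) \<le> 1"
proof -
  assume "3 \<le> k"
  then have "(2::real) ^ 3 \<le> 2 ^ k" by (intro power_increasing) auto
  then have "8 * (2::real) ^ ((n + 1) * k\<^sup>2) \<le> 2 ^ ((n + 1) * k\<^sup>2 + k)" by (simp add: power_add)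
  then show ?thesis by (simp add: LL_def NN_def)
qed

lemma bohr_phase_ev: "\<forall>\<^sub>F k in sequentially. 16 * real (k\<^sup>2 * LL k * (1 + n)) * (1 / real (NN k)) \<le> 1"
proof -
  have "\<forall>\<^sub>F k in sequentially. 16 * (real k)\<^sup>2 * (1 + real n) \<le> 2 ^ k" by real_asymp
  then show ?thesis
  proof eventually_elim
    case (elim k)
    have "16 * real (k\<^sup>2 * LL k * (1 + n)) = (16 * (real k)\<^sup>2 * (1 + real n)) * real (LL k)"
      by (simp add: algebra_simps)
    also have "\<dots> \<le> 2 ^ k * real (LL k)" using elim by (intro mult_right_mono) auto
    also have "\<dots> = real (NN k)" by (simp add: NN_def LL_def power_add)
    finally show ?case using pos(7)[of k] by simp
  qed
qed

text \<open>\<open>exp (- 4^k)\<close> is doubly exponentially small in k, while the number of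
  frequencies is only exponential in a polynomial of k.\<close>

lemma gauss_tail_ev: "\<forall>\<^sub>F k in sequentially. real (LL k) ^ (k\<^sup>2 + n) * exp (- (RR k * \<eta> k)\<^sup>2) \<le> 1"
proof -
  have "\<forall>\<^sub>F k in sequentially. (real n + 1) * (real k)\<^sup>2 * ((real k)\<^sup>2 + real n) \<le> 4 ^ k" by real_asymp
  then show ?thesis
  proof eventually_elim
    case (elim k)
    have "real (LL k) ^ (k\<^sup>2 + n) = 2 ^ ((n + 1) * k\<^sup>2 * (k\<^sup>2 + n))" by (simp add: LL_def power_mult)
    also have "\<dots> \<le> exp 1 ^ ((n + 1) * k\<^sup>2 * (k\<^sup>2 + n))" using exp_ge_add_one_self[of 1] by (intro power_mono) auto
    also have "\<dots> = exp (real ((n + 1) * k\<^sup>2 * (k\<^sup>2 + n)))" by (simp only: exp_of_nat_mult[symmetric]) simp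
    also have "\<dots> \<le> exp (4 ^ k)" using elim by (simp add: algebra_simps)
    also have "(4::real) ^ k = (RR k * \<eta> k)\<^sup>2" unfolding R\<eta> by (simp add: power_mult[symmetric] power2_eq_square flip: power_mult_distrib)
    finally have "real (LL k) ^ (k\<^sup>2 + n) * exp (- (RR k * \<eta> k)\<^sup>2) \<le> exp ((RR k * \<eta> k)\<^sup>2) * exp (- (RR k * \<eta> k)\<^sup>2)"
      by (intro mult_right_mono) auto
    then show ?case by (simp add: exp_minus)
  qed
qed

definition gain :: "nat \<Rightarrow> real" where
  "gain k = real (KK k) ^ (n - 1) / (2 ^ (k * (k\<^sup>2 + n)) * 4 ^ (k\<^sup>2 + n) * real (LL k) ^ (n + dd k))"

text \<open>In base 2 logarithms the left side is \<open>s(n+1)k^4\<close> and the right side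
  \<open>(n-1)k^4\<close>, both up to \<open>O(k^3)\<close>. Passing from k to k + 1 on the left
  also costs only \<open>O(k^3)\<close>, so every radius between two scales can be served by the
  lower one.\<close>

lemma gain_ev:
  fixes s c :: real
  assumes c: "0 < c" and s: "s * (real n + 1) < real n - 1"
  shows "\<forall>\<^sub>F k in sequentially. RR (Suc k) powr s \<le> c * gain k"
proof -
  define D where "D = (real n - 1) - s * (real n + 1)"
  have D: "0 < D" using s by (simp add: D_def)
  let ?n = "real n"
  \<comment> \<open>The base 2 logarithm of \<open>gain\<close>, written in reals so that
    asymptotics apply.\<close>
  define E where "E = (\<lambda>x::real. (?n - 1) * (x ^ 4 - (2 * x + ?n + 6)) - x * (x\<^sup>2 + ?n) - 2 * (x\<^sup>2 + ?n) - (?n + 1) * x\<^sup>2 * (?n + 8 * ?n * (?n + 1) * x))"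
  have "\<forall>\<^sub>F x in at_top. s * ((?n + 1) * (4 * x ^ 3 + 6 * x\<^sup>2 + 4 * x + 1) + (x + 1) ^ 3) - log 2 c + (?n - 1) * (2 * x + ?n + 6)
      + x * (x\<^sup>2 + ?n) + 2 * (x\<^sup>2 + ?n) + (?n + 1) * x\<^sup>2 * (?n + 8 * ?n * (?n + 1) * x) \<le> D * (x::real) ^ 4"
    using D by real_asymp
  then have "\<forall>\<^sub>F x in at_top. s * ((?n + 1) * (x + 1) ^ 4 + (x + 1) ^ 3) \<le> log 2 c + E x"
    by eventually_elim (simp add: D_def E_def algebra_simps power4_eq_xxxx power3_eq_cube power2_eq_square)
  then have "\<forall>\<^sub>F k in sequentially. s * ((?n + 1) * (real k + 1) ^ 4 + (real k + 1) ^ 3) \<le> log 2 c + E (real k)"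
    by (rule eventually_compose_filterlim) (rule filterlim_real_sequentially)
  with exponent_ev show ?thesis
  proof eventually_elim
    case (elim k)
    have "gain k = 2 powr (E (real k))"
    proof -
      have K: "real (KK k) ^ (n - 1) = 2 powr ((?n - 1) * (real k ^ 4 - (2 * real k + ?n + 6)))"
      proof -
        have "real (KK k) ^ (n - 1) = 2 powr real ((k ^ 4 - (2 * k + n + 6)) * (n - 1))"
          by (subst powr_realpow) (simp_all only: KK_def of_nat_power of_nat_numeral power_mult zero_less_numeral)
        also have "real ((k ^ 4 - (2 * k + n + 6)) * (n - 1)) = (?n - 1) * (real k ^ 4 - (2 * real k + ?n + 6))"
          using elim(1) n2 by (simp add: of_nat_diff)
        finally show ?thesis .
      qed
      have L: "real (LL k) ^ (n + dd k) = 2 powr ((?n + 1) * (real k)\<^sup>2 * (?n + 8 * ?n * (?n + 1) * real k))"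
      proof -
        have "real (LL k) ^ (n + dd k) = 2 powr real ((n + 1) * k\<^sup>2 * (n + dd k))"
          by (subst powr_realpow) (simp_all only: LL_def of_nat_power of_nat_numeral power_mult zero_less_numeral)
        then show ?thesis by (simp add: dd_def algebra_simps)
      qed
      have "(2::real) ^ (k * (k\<^sup>2 + n)) = 2 powr (real k * ((real k)\<^sup>2 + ?n))"
        by (simp add: powr_realpow[symmetric])
      moreover have "(4::real) ^ (k\<^sup>2 + n) = 2 powr (2 * ((real k)\<^sup>2 + ?n))"
      proof -
        have "(4::real) ^ (k\<^sup>2 + n) = (2 ^ 2) ^ (k\<^sup>2 + n)" by simp
        also have "\<dots> = 2 ^ (2 * (k\<^sup>2 + n))" by (rule power_mult[symmetric])
        also have "\<dots> = 2 powr real (2 * (k\<^sup>2 + n))" by (rule powr_realpow[symmetric]) simp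
        finally show ?thesis by simp
      qed
      ultimately show ?thesis unfolding gain_def K L E_def by (simp only: powr_diff powr_add) (simp add: field_simps)
    qed
    moreover have "RR (Suc k) powr s = 2 powr (s * ((?n + 1) * (real k + 1) ^ 4 + (real k + 1) ^ 3))"
    proof -
      have "RR (Suc k) = 2 powr ((?n + 1) * (real k + 1) ^ 4 + (real k + 1) ^ 3)"
        unfolding RR_def by (subst powr_realpow[symmetric]) (simp_all add: algebra_simps)
      then show ?thesis by (simp add: powr_powr mult.commute)
    qed
    moreover have "c = 2 powr (log 2 c)" using c by simp
    ultimately show ?case using elim(2) by (metis powr_add powr_mono one_le_numeral)
  qed
qed

end

section \<open>The counterexample\<close>

theorem corollary5p2:
  assumes "DIM('a::euclidean_space) \<ge> 2"
  shows "\<exists>\<Sigma> :: 'a set. strictly_convex_compact_C2_hypersurface \<Sigma> \<and>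
    (\<forall>\<epsilon>>0. \<exists>R0. \<forall>R\<ge>R0. R > 0 \<longrightarrow>
      (\<exists>(f :: 'a \<Rightarrow> complex) (w :: 'a \<Rightarrow> real).
         L2_on (surface_measure \<Sigma>) f \<and> L2_norm_sq (surface_measure \<Sigma>) f > 0 \<and>
         w \<in> borel_measurable lborel \<and> (\<forall>x. 0 \<le> w x \<and> w x \<le> 1) \<and>
         (\<forall>x. w x \<noteq> 0 \<longrightarrow> x \<in> ball 0 R) \<and> MT_norm w > 0 \<and>
         (LINT x:ball 0 R|lborel. (cmod (extension_op \<Sigma> f x))\<^sup>2 * w x)
           \<ge> R powr ((real DIM('a) - 1) / (real DIM('a) + 1) - \<epsilon>)
              * L2_norm_sq (surface_measure \<Sigma>) f * MT_norm w))"
proof -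
  note dim = assms
  define n where "n = DIM('a)"
  have n2: "2 \<le> n" using dim by (simp add: n_def)
  interpret scales n by unfold_locales (rule n2)
  obtain e :: 'a where e: "e \<in> Basis" using nonempty_Basis by blast
  have "Basis - {e} \<noteq> ({} :: 'a set)"
  proof
    assume "Basis - {e} = ({} :: 'a set)"
    then have "(Basis :: 'a set) \<subseteq> {e}" by auto
    then have "card (Basis :: 'a set) \<le> card {e}" by (intro card_mono) auto
    then show False using dim by simp
  qed
  \<comment> \<open>A direction other than e, along which the scales will be separated.\<close>
  then obtain b0 where b0: "b0 \<in> Basis - {e}" by blast
  have "\<forall>\<^sub>F k in sequentially. 9 \<le> k \<and> real n * ((real (k\<^sup>2) + 1) * real (LL k)) / real (ZZ k) \<le> \<eta> k \<and>
    real ((2 * ZZ k + 1) ^ n) * 2 ^ (k\<^sup>2) * ((2 * real (LL k)) ^ (k\<^sup>2 + n) * (13 * real n * \<eta> k)) ^ dd k \<le> 1 / 4 \<and>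
    2 * k + n + 6 \<le> k ^ 4 \<and> 16 * real (k\<^sup>2 * LL k * (1 + n)) * (1 / real (NN k)) \<le> 1 \<and>
    real (LL k) ^ (k\<^sup>2 + n) * exp (- (RR k * \<eta> k)\<^sup>2) \<le> 1"
    by (intro eventually_conj eventually_ge_at_top fine_ev small_ev exponent_ev bohr_phase_ev gauss_tail_ev)
  then obtain k0 where k0: "\<And>k. k0 \<le> k \<Longrightarrow> 9 \<le> k"
    "\<And>k. k0 \<le> k \<Longrightarrow> real n * ((real (k\<^sup>2) + 1) * real (LL k)) / real (ZZ k) \<le> \<eta> k"
    "\<And>k. k0 \<le> k \<Longrightarrow> real ((2 * ZZ k + 1) ^ n) * 2 ^ (k\<^sup>2) * ((2 * real (LL k)) ^ (k\<^sup>2 + n) * (13 * real n * \<eta> k)) ^ dd k \<le> 1 / 4"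
    "\<And>k. k0 \<le> k \<Longrightarrow> 2 * k + n + 6 \<le> k ^ 4"
    "\<And>k. k0 \<le> k \<Longrightarrow> 16 * real (k\<^sup>2 * LL k * (1 + n)) * (1 / real (NN k)) \<le> 1"
    "\<And>k. k0 \<le> k \<Longrightarrow> real (LL k) ^ (k\<^sup>2 + n) * exp (- (RR k * \<eta> k)\<^sup>2) \<le> 1"
    unfolding eventually_sequentially by blast
  let ?J = "\<lambda>k. {..<k\<^sup>2} <+> (Basis :: 'a set)"
  define good where "good = (\<lambda>k (P :: 'a set) (u :: nat \<Rightarrow> 'a) (v0 :: 'a). finite P \<and> KK k ^ (n - 1) \<le> 4 * card P \<and>
    (\<forall>p\<in>P. 1 - \<tau> k \<le> p \<bullet> p \<and> p \<bullet> p \<le> 1 \<and> 0 \<le> p \<bullet> e \<and> (\<forall>b\<in>Basis - {e}. \<beta> k \<le> p \<bullet> b \<and> p \<bullet> b \<le> \<beta> k + 4 * \<delta> k * real (KK k))) \<and>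
    (\<forall>p\<in>P. \<forall>p'\<in>P. p \<noteq> p' \<longrightarrow> 3 * \<delta> k \<le> norm (p - p')) \<and>
    (\<forall>p\<in>P. \<exists>(a :: nat \<Rightarrow> nat) (b :: 'a \<Rightarrow> nat). (\<forall>i<k\<^sup>2. a i \<le> LL k) \<and> (\<forall>c\<in>Basis. b c \<le> k\<^sup>2 * LL k) \<and>
       p = v0 + (\<Sum>i<k\<^sup>2. real (a i) *\<^sub>R u i) - (\<Sum>c\<in>Basis. real (b c) *\<^sub>R c)) \<and>
    (\<forall>\<nu> \<theta>. norm \<nu> = 1 \<longrightarrow> card {a \<in> PiE (?J k) (\<lambda>_. {..<LL k}).
       \<bar>(\<Sum>j\<in>?J k. real (a j) * (\<nu> \<bullet> case_sum u id j)) - \<theta>\<bar> \<le> \<eta> k} \<le> LL k ^ (n + dd k)))"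
  have "\<exists>P u v0. good k P u v0" if k: "k0 \<le> k" for k
    unfolding good_def
  proof (rule scale_points[OF dim e, folded n_def])
    note fit = cells_fit[OF k0(4)[OF k]]
    show "0 < \<eta> k" "1 \<le> LL k" "0 < \<delta> k" "0 < \<tau> k" "0 < \<beta> k" by (rule pos)+
    show "2 * n \<le> ZZ k" using Z_ge[of k] k0(1)[OF k] by simp
    show "\<tau> k \<le> 1 / 4" using \<tau>_le[OF fit(3)] by simp
    show "real n * ((real (k\<^sup>2) + 1) * real (LL k)) / real (ZZ k) \<le> \<eta> k" by (rule k0(2)[OF k])
    show "real ((2 * ZZ k + 1) ^ n) * 2 ^ k\<^sup>2 * ((2 * real (LL k)) ^ (k\<^sup>2 + n) * (13 * real n * \<eta> k)) ^ dd k \<le> 1 / 4"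
      by (rule k0(3)[OF k])
    show "\<beta> k + 4 * \<delta> k * real (KK k) \<le> 1 / (2 * real n)" by (rule fit(4))
    show "1 \<le> real (LL k) ^ k\<^sup>2 * ((\<delta> k / 2) ^ (n - 1) * (\<tau> k / 4))" by (rule big_enough[OF k0(1)[OF k]])
  qed
  then obtain PP U v0 where good: "\<And>k. k0 \<le> k \<Longrightarrow> good k (PP k) (U k) (v0 k)" by metis
  have finP: "\<And>k. k0 \<le> k \<Longrightarrow> finite (PP k)"
    using good unfolding good_def by blast
  have cardP: "\<And>k. k0 \<le> k \<Longrightarrow> KK k ^ (n - 1) \<le> 4 * card (PP k)"
    using good unfolding good_def by blast
  have cellP: "\<And>k p. k0 \<le> k \<Longrightarrow> p \<in> PP k \<Longrightarrow> 1 - \<tau> k \<le> p \<bullet> p \<and> p \<bullet> p \<le> 1 \<and> 0 \<le> p \<bullet> e \<and> (\<forall>b\<in>Basis - {e}. \<beta> k \<le> p \<bullet> b \<and> p \<bullet> b \<le> \<beta> k + 4 * \<delta> k * real (KK k))"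
    using good unfolding good_def by blast
  have sepP: "\<And>k p p'. k0 \<le> k \<Longrightarrow> p \<in> PP k \<Longrightarrow> p' \<in> PP k \<Longrightarrow> p \<noteq> p' \<Longrightarrow> 3 * \<delta> k \<le> norm (p - p')"
    using good unfolding good_def by blast
  have combP: "\<And>k p. k0 \<le> k \<Longrightarrow> p \<in> PP k \<Longrightarrow> \<exists>(a :: nat \<Rightarrow> nat) (b :: 'a \<Rightarrow> nat). (\<forall>i<k\<^sup>2. a i \<le> LL k) \<and> (\<forall>c\<in>Basis. b c \<le> k\<^sup>2 * LL k) \<and>
       p = v0 k + (\<Sum>i<k\<^sup>2. real (a i) *\<^sub>R U k i) - (\<Sum>c\<in>Basis. real (b c) *\<^sub>R c)"
    using good unfolding good_def by blast
  have cntP: "\<And>k \<nu> \<theta>. k0 \<le> k \<Longrightarrow> norm \<nu> = 1 \<Longrightarrow> card {a \<in> PiE (?J k) (\<lambda>_. {..<LL k}).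
       \<bar>(\<Sum>j\<in>?J k. real (a j) * (\<nu> \<bullet> case_sum (U k) id j)) - \<theta>\<bar> \<le> \<eta> k} \<le> LL k ^ (n + dd k)"
    using good unfolding good_def by blast
  \<comment> \<open>Scales below k0 carry no points; their width 1 in \<open>dl\<close> only keeps
    the hypotheses on widths true.\<close>
  define P where "P = (\<lambda>k. if k0 \<le> k then PP k else {})"
  define dl where "dl = (\<lambda>k. if k0 \<le> k then \<delta> k else 1)"
  note fit = cells_fit[OF k0(4)]
  have strip: "\<beta> k \<le> p \<bullet> b0 \<and> p \<bullet> b0 \<le> 5/4 * \<beta> k" if "k0 \<le> k" "p \<in> PP k" for k p
  proof -
    have "\<beta> k \<le> p \<bullet> b0 \<and> p \<bullet> b0 \<le> \<beta> k + 4 * \<delta> k * real (KK k)" using cellP[OF that] b0 by blast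
    then show ?thesis using fit(1)[OF that(1)] by linarith
  qed
  have \<beta>_half: "\<beta> k' \<le> \<beta> k / 2" if "k < k'" for k k'
  proof -
    have "(2::real) ^ (k + n + 2 + 1) \<le> 2 ^ (k' + n + 2)" using that by (intro power_increasing) auto
    then show ?thesis unfolding \<beta>_def by (simp add: field_simps)
  qed
  \<comment> \<open>In direction b0 scale k occupies heights from \<open>\<beta> k\<close> to
    \<open>5/4 \<beta> k\<close>, all later ones stay below \<open>5/8 \<beta> k\<close>. The gap
    \<open>3/8 \<beta> k\<close> exceeds the radii, which are at most 1/16 of the respective
    \<open>\<beta>\<close>.\<close>
  have far: "\<delta> k \<le> norm (p - p') \<and> \<delta> k' \<le> norm (p - p')" if k: "k0 \<le> k" "k < k'" and p: "p \<in> PP k" "p' \<in> PP k'" for k k' p p'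
  proof -
    have k': "k0 \<le> k'" using k by simp
    have "\<bar>(p - p') \<bullet> b0\<bar> \<le> norm (p - p')" using b0 by (intro Basis_le_norm) auto
    moreover have "3/8 * \<beta> k \<le> (p - p') \<bullet> b0"
      using strip[OF k(1) p(1)] strip[OF k' p(2)] \<beta>_half[OF k(2)] by (simp add: inner_diff_left)
    ultimately show ?thesis using fit(2)[OF k(1)] fit(2)[OF k'] \<beta>_half[OF k(2)] pos(5)[of k] by linarith
  qed
  have "\<exists>\<psi> G H. perturbed_sphere \<psi> G H \<and> (\<forall>k. P k \<subseteq> perturbed_sphere.surf \<psi>)"
  proof (rule surface_through_points[where \<delta> = dl])
    show "finite (P k)" for k using finP by (simp add: P_def)
    show "0 < dl k" "dl k \<le> 1" for k using pos(3)[of k] fit(3) by (auto simp: dl_def)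
    show "2 * dl k \<le> norm (p - p')" if pp: "p \<in> P k" "p' \<in> P k" "p \<noteq> p'" for k p p'
    proof -
      have k: "k0 \<le> k" using pp by (auto simp: P_def split: if_splits)
      have "3 * \<delta> k \<le> norm (p - p')" using sepP[OF k] pp k by (simp add: P_def)
      then show ?thesis using k pos(3)[of k] by (simp add: dl_def)
    qed
    show "dl k' \<le> norm (p - p')" if "k \<noteq> k'" and pp: "p \<in> P k" "p' \<in> P k'" for k k' p p'
    proof -
      have k: "k0 \<le> k" "k0 \<le> k'" using pp by (auto simp: P_def split: if_splits)
      have pp': "p \<in> PP k" "p' \<in> PP k'" using pp k by (auto simp: P_def)
      show ?thesis
      proof (cases "k < k'")
        case True then show ?thesis using far[OF k(1) True pp'] k by (simp add: dl_def)
      next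
        case False
        then have "k' < k" using that(1) by simp
        from far[OF k(2) this pp'(2,1)] show ?thesis using k by (simp add: dl_def norm_minus_commute)
      qed
    qed
    show "\<bar>1 - p \<bullet> p\<bar> \<le> (1/2) ^ k * (dl k)\<^sup>2 / 120" if "p \<in> P k" for k p
    proof -
      have k: "k0 \<le> k" "p \<in> PP k" using that by (auto simp: P_def split: if_splits)
      have "1 - \<tau> k \<le> p \<bullet> p" "p \<bullet> p \<le> 1" using cellP[OF k] by auto
      then have "\<bar>1 - p \<bullet> p\<bar> \<le> \<tau> k" by linarith
      then show ?thesis using k by (simp add: dl_def \<tau>_def)
    qed
  qed
  then obtain \<psi> G H where "perturbed_sphere \<psi> G H" and Psurf: "\<And>k. P k \<subseteq> perturbed_sphere.surf \<psi>" by blast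
  then interpret PS: perturbed_sphere \<psi> G H by simp
  define ubv where "ubv = unit_ball_vol (real (n - 1))"
  have ubv0: "0 < ubv" by (simp add: ubv_def)
  define C0 where "C0 = 10 * measure lborel (ball (0::'a) 2) / gauss_central"
  have C0: "0 < C0" unfolding C0_def using gauss_central_pos by (simp add: content_ball)
  define \<omega> where "\<omega> = unit_ball_vol (real n)"
  have \<omega>0: "0 < \<omega>" by (simp add: \<omega>_def)
  \<comment> \<open>1/16 is 1/4 from the modulus S/2 squared times 1/4 from the proportion of cells
    hit; 512 = 16 * 32 joins the cap radius 1/(16R) to the cap estimate; the last factor is the
    volume of the half-size ball in the pigeonhole bound.\<close>
  define c1 where "c1 = 1/16 * (ubv * (1 / (512 * real n)) ^ (n - 1)) * (\<omega> / 2 ^ n)"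
  have c1: "0 < c1" unfolding c1_def using ubv0 \<omega>0 n2 by simp
  \<comment> \<open>The radius R' is decoupled from \<open>RR k\<close>: the weight of scale k is
    also supported in every larger ball.\<close>
  have scale: "weighted_ratio_ge PS.surf R' (c1 / (2 * C0) * gain k)"
    if k: "k0 \<le> k" and R': "RR k \<le> R'" for k R'
  proof -
    define M where "M = k\<^sup>2 + n"
    define R where "R = RR k"
    define r where "r = 1 / (16 * R)"
    define \<kappa> where "\<kappa> = ubv * (r / (32 * real n)) ^ (n - 1)"
    define MT where "MT = C0 * R * 4 ^ M / real (LL k) ^ M * (real (LL k ^ (n + dd k)) + real (LL k) ^ M * exp (- (R * \<eta> k)\<^sup>2))"
    define Vol where "Vol = measure lborel (ball (0::'a) (R / 2)) / real (NN k) ^ M"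
    have R1: "1 \<le> R" by (simp add: R_def pos)
    have r0: "0 < r" "r \<le> 1/4" using R1 by (auto simp: r_def field_simps)
    have finJ: "finite (?J k)" by simp
    have cardJ: "card (?J k) = M" by (simp add: card_Plus M_def n_def)
    have L0: "0 < real (LL k)" using pos(2)[of k] by simp
    have N0: "0 < real (NN k)" using pos(7)[of k] by simp
    have PPk: "P k = PP k" using k by (simp add: P_def)
    have cPpos: "0 < card (PP k)"
    proof -
      have "0 < KK k ^ (n - 1)" using pos(8)[of k] by simp
      then show ?thesis using cardP[OF k] by (cases "card (PP k)") auto
    qed
    \<comment> \<open>The other coordinates are at most 1/(2n), so their squares sum to at most 1/4,
      and 1 - 1/120 - 1/4 exceeds 9/16.\<close>
    have pe: "3/4 \<le> p \<bullet> e" if p: "p \<in> PP k" for p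
    proof -
      have "p \<bullet> p = (p \<bullet> e) * (p \<bullet> e) + (\<Sum>b\<in>Basis - {e}. (p \<bullet> b) * (p \<bullet> b))"
        by (subst euclidean_inner) (simp add: sum.remove[OF finite_Basis e])
      moreover have "(\<Sum>b\<in>Basis - {e}. (p \<bullet> b) * (p \<bullet> b)) \<le> (\<Sum>b\<in>Basis - {e}. 1 / (2 * real n) * (1 / (2 * real n)))"
      proof (rule sum_mono)
        fix b assume b: "b \<in> Basis - {e}"
        have "0 \<le> p \<bullet> b" "p \<bullet> b \<le> 1 / (2 * real n)"
        proof -
          have "\<beta> k \<le> p \<bullet> b \<and> p \<bullet> b \<le> \<beta> k + 4 * \<delta> k * real (KK k)" using cellP[OF k p] b by blast
          then show "0 \<le> p \<bullet> b" "p \<bullet> b \<le> 1 / (2 * real n)" using fit(4)[OF k] pos(5)[of k] by linarith+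
        qed
        then show "(p \<bullet> b) * (p \<bullet> b) \<le> 1 / (2 * real n) * (1 / (2 * real n))" by (intro mult_mono) auto
      qed
      moreover have "(\<Sum>b\<in>Basis - {e}. 1 / (2 * real n) * (1 / (2 * real n))) \<le> 1 / 4"
      proof -
        have "(\<Sum>b\<in>Basis - {e}. 1 / (2 * real n) * (1 / (2 * real n))) \<le> (\<Sum>b\<in>(Basis :: 'a set). 1 / (2 * real n) * (1 / (2 * real n)))"
          by (intro sum_mono2) auto
        also have "\<dots> = 1 / (4 * real n)" using n2 by (simp add: n_def[symmetric])
        also have "\<dots> \<le> 1 / 4" using n2 by (simp add: field_simps)
        finally show ?thesis .
      qed
      moreover have "1 - 1/120 \<le> p \<bullet> p" using cellP[OF k p] \<tau>_le[OF fit(3)[OF k]] by linarith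
      ultimately have "(3/4)\<^sup>2 \<le> (p \<bullet> e)\<^sup>2" by (simp add: power2_eq_square)
      then show ?thesis using cellP[OF k p] by (intro power2_le_imp_le[of "3/4" "p \<bullet> e"]) auto
    qed
    show ?thesis
    proof (rule scale_estimate[where P = "PP k" and J = "?J k" and u = "case_sum (U k) id" and \<epsilon> = "1 / real (NN k)"
          and r = r and R = R and ?v0.0 = "v0 k" and \<kappa> = \<kappa> and MT = MT and Vol = Vol])
      show "closed PS.surf" by (rule PS.closed_surf)
      show "hausdorff_outer (real (DIM('a) - 1)) PS.surf < top" by (rule PS.hausdorff_surf_finite)
      show "finite (PP k)" by (rule finP[OF k])
      show "PP k \<noteq> {}" using cPpos by auto
      show PS: "PP k \<subseteq> PS.surf" using Psurf[of k] by (simp add: PPk)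
      show "0 < \<kappa>" unfolding \<kappa>_def using ubv0 r0 n2 by simp
      show "ennreal \<kappa> \<le> hausdorff_outer (real (DIM('a) - 1)) (PS.surf \<inter> ball p r)" if p: "p \<in> PP k" for p
        using PS.hausdorff_cap_ge[OF dim e subsetD[OF PS p] pe[OF p] r0] by (simp add: \<kappa>_def ubv_def n_def)
      show "2 * r \<le> norm (p - p')" if pp: "p \<in> PP k" "p' \<in> PP k" "p \<noteq> p'" for p p'
      proof -
        have "1 \<le> R * \<delta> k"
        proof -
          have "(2::real) ^ (k ^ 4) \<le> 2 ^ ((n + 1) * k ^ 4 + k ^ 3 + k)" by (intro power_increasing) auto
          then show ?thesis unfolding R_def RR_def \<delta>_def by (simp add: power_add field_simps)
        qed
        then have "2 * r \<le> 3 * \<delta> k" unfolding r_def using R1 by (simp add: field_simps)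
        then show ?thesis using sepP[OF k pp] by linarith
      qed
      show "0 < R" "R \<le> R'" using R1 R' by (auto simp: R_def)
      show "R * r \<le> 1/16" using R1 by (simp add: r_def)
      show "finite (?J k)" by (rule finJ)
      show "0 < 1 / real (NN k)" using N0 by simp
      show "\<exists>l::int. \<bar>x \<bullet> p - x \<bullet> v0 k - of_int l\<bar> \<le> 1/16"
        if x: "x \<in> bohr_set (?J k) (case_sum (U k) id) (1 / real (NN k))" and p: "p \<in> PP k" for x p
      proof -
        obtain a :: "nat \<Rightarrow> nat" and b :: "'a \<Rightarrow> nat" where ab: "\<And>i. i < k\<^sup>2 \<Longrightarrow> a i \<le> LL k" "\<And>c. c \<in> Basis \<Longrightarrow> b c \<le> k\<^sup>2 * LL k"
          "p = v0 k + (\<Sum>i<k\<^sup>2. real (a i) *\<^sub>R U k i) - (\<Sum>c\<in>Basis. real (b c) *\<^sub>R c)"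
          using combP[OF k p] by blast
        show ?thesis unfolding ab(3)
        proof (rule bohr_phase[OF x _ _ ab(1,2)])
          show "16 * real (k\<^sup>2 * LL k * (1 + DIM('a))) * (1 / real (NN k)) \<le> 1" using k0(5)[OF k] by (simp only: n_def)
        qed simp_all
      qed
      show "emeasure lborel (bohr_set (?J k) (case_sum (U k) id) (1 / real (NN k)) \<inter> ball 0 R \<inter> tube a \<nu>) \<le> ennreal MT"
        if \<nu>: "norm \<nu> = 1" for \<nu> a
      proof -
        have "8 * real (LL k) * (1 / real (NN k)) \<le> 1" using bohr_width[of k] k0(1)[OF k] by simp
        from emeasure_bohr_tube_le[OF finJ \<nu> R1 _ pos(2) this cntP[OF k \<nu>], of a] pos(1)[of k]
        show ?thesis unfolding MT_def cardJ C0_def by simp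
      qed
      show "0 \<le> MT" unfolding MT_def using C0 R1 by simp
      show "0 \<le> Vol" by (simp add: Vol_def)
      show "Vol \<le> measure lborel (bohr_set (?J k) (case_sum (U k) id) (1 / real (NN k)) \<inter> ball 0 R)"
        using measure_bohr_ball_ge[OF finJ pos(7)[of k], of R "case_sum (U k) id"] R1 by (simp add: Vol_def cardJ)
      show "0 \<le> c1 / (2 * C0) * gain k" using c1 C0 by (simp add: gain_def)
      show "c1 / (2 * C0) * gain k * MT \<le> 1/4 * (real (card (PP k)) * \<kappa>) * Vol"
      proof -
        let ?l = "real (LL k)" and ?D = "real (LL k) ^ (n + dd k)"
        have D1: "1 \<le> ?D" using pos(2)[of k] by (intro one_le_power) simp
        \<comment> \<open>The Gaussian tail is at most 1, hence at most the resonance count, which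
          explains the 2 in \<open>c1 / (2 * C0)\<close>.\<close>
        have "MT \<le> C0 * R * 4 ^ M / ?l ^ M * (2 * ?D)"
          unfolding MT_def using k0(6)[OF k] D1 C0 R1 by (intro mult_left_mono) (auto simp: R_def M_def)
        then have "c1 / (2 * C0) * gain k * MT \<le> c1 / (2 * C0) * gain k * (C0 * R * 4 ^ M / ?l ^ M * (2 * ?D))"
          using c1 C0 by (intro mult_left_mono) (auto simp: gain_def)
        also have "\<dots> = c1 * real (KK k) ^ (n - 1) * R / (2 ^ (k * M) * ?l ^ M)"
          unfolding gain_def M_def[symmetric] using C0 L0 by simp
        also have "2 ^ (k * M) * ?l ^ M = real (NN k) ^ M"
        proof -
          have "real (NN k) = 2 ^ k * ?l" by (simp add: NN_def LL_def power_add)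
          then show ?thesis by (simp only: power_mult power_mult_distrib)
        qed
        also have "c1 * real (KK k) ^ (n - 1) * R / real (NN k) ^ M \<le> c1 * (4 * real (card (PP k))) * R / real (NN k) ^ M"
        proof -
          have "real (KK k ^ (n - 1)) \<le> real (4 * card (PP k))" using cardP[OF k] by (simp only: of_nat_le_iff)
          then show ?thesis using c1 R1 by (intro divide_right_mono mult_right_mono mult_left_mono) auto
        qed
        also have "\<dots> = 1/4 * (real (card (PP k)) * \<kappa>) * Vol"
        proof -
          have vol: "measure lborel (ball (0::'a) (R / 2)) = \<omega> * (R / 2) ^ n"
            using R1 by (simp add: content_ball \<omega>_def n_def)
          have Rn: "R ^ n = R ^ (n - 1) * R" using n2 by (cases n) auto
          have k: "\<kappa> * R ^ (n - 1) = ubv * (1 / (512 * real n)) ^ (n - 1)"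
          proof -
            have "(r / (32 * real n)) ^ (n - 1) * R ^ (n - 1) = (r / (32 * real n) * R) ^ (n - 1)"
              by (rule power_mult_distrib[symmetric])
            also have "r / (32 * real n) * R = 1 / (512 * real n)" using R1 n2 by (simp add: r_def field_simps)
            finally show ?thesis by (simp add: \<kappa>_def)
          qed
          \<comment> \<open>The cap mass scales like \<open>R^-(n-1)\<close> and the ball like
            \<open>R^n\<close>; one power of R remains, matching the length of a tube.\<close>
          have "1/4 * (real (card (PP k)) * \<kappa>) * Vol = 1/4 * real (card (PP k)) * (\<kappa> * R ^ (n - 1)) * (\<omega> / 2 ^ n) * R / real (NN k) ^ M"
            unfolding Vol_def vol by (simp add: power_divide Rn mult_ac)
          then show ?thesis unfolding k by (simp add: c1_def mult_ac)
        qed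
        finally show ?thesis .
      qed
    qed
  qed
  show ?thesis
    unfolding weighted_ratio_ge_def[symmetric]
  proof (intro exI[of _ PS.surf] conjI allI impI)
    show "strictly_convex_compact_C2_hypersurface PS.surf" by (rule PS.strictly_convex_surf)
    fix \<epsilon> :: real assume \<epsilon>: "0 < \<epsilon>"
    \<comment> \<open>Cut off at 0 so that the power of R is monotone in R even for large
      \<open>\<epsilon>\<close>.\<close>
    define s where "s = max 0 ((real n - 1) / (real n + 1) - \<epsilon>)"
    have s: "s * (real n + 1) < real n - 1"
    proof -
      have "s < (real n - 1) / (real n + 1)" using \<epsilon> n2 by (simp add: s_def)
      then show ?thesis by (simp add: pos_less_divide_eq)
    qed
    have "\<forall>\<^sub>F k in sequentially. RR (Suc k) powr s \<le> c1 / (2 * C0) * gain k"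
      using c1 C0 s by (intro gain_ev) auto
    then obtain k1 where k1: "\<And>k. k1 \<le> k \<Longrightarrow> RR (Suc k) powr s \<le> c1 / (2 * C0) * gain k"
      unfolding eventually_sequentially by blast
    define k2 where "k2 = max k0 k1"
    have mono: "RR k \<le> RR k'" if "k \<le> k'" for k k'
      unfolding RR_def using that by (intro power_increasing add_mono mult_left_mono power_mono) auto
    have unb: "real k \<le> RR k" for k
    proof -
      have "real k \<le> 2 ^ k" by (rule of_nat_le_two_power)
      also have "\<dots> \<le> RR k" unfolding RR_def
      proof (rule power_increasing)
        have "k \<le> k ^ 3" by (cases "k = 0") (auto simp: self_le_power)
        then show "k \<le> (n + 1) * k ^ 4 + k ^ 3" by simp
      qed simp
      finally show ?thesis .
    qed
    show "\<exists>R0. \<forall>R\<ge>R0. R > 0 \<longrightarrow>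
      weighted_ratio_ge PS.surf R (R powr ((real DIM('a) - 1) / (real DIM('a) + 1) - \<epsilon>))"
    proof (rule exI[of _ "RR k2"], intro allI impI)
      fix R :: real assume R: "RR k2 \<le> R" "0 < R"
      obtain j :: nat where j: "R < real j" using reals_Archimedean2 by blast
      \<comment> \<open>The scale with \<open>RR k \<le> R < RR (Suc k)\<close>; the greatest exists
        because \<open>RR\<close> is at least the identity.\<close>
      define k where "k = (GREATEST k. RR k \<le> R)"
      have bnd: "\<forall>y. RR y \<le> R \<longrightarrow> y \<le> j"
      proof (intro allI impI)
        fix y assume "RR y \<le> R"
        then have "real y < real j" using unb[of y] j by linarith
        then show "y \<le> j" by simp
      qed
      have kR: "RR k \<le> R" unfolding k_def using GreatestI_nat[of "\<lambda>k. RR k \<le> R" k2 j] R(1) bnd by blast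
      have kk: "k2 \<le> k" unfolding k_def using Greatest_le_nat[of "\<lambda>k. RR k \<le> R" k2 j] R(1) bnd by blast
      have Rk: "R < RR (Suc k)"
      proof (rule ccontr)
        assume "\<not> R < RR (Suc k)"
        then have "Suc k \<le> k" unfolding k_def using Greatest_le_nat[of "\<lambda>k. RR k \<le> R" "Suc k" j] bnd
          by (metis k_def not_less)
        then show False by simp
      qed
      have k0k: "k0 \<le> k" "k1 \<le> k" using kk by (auto simp: k2_def)
      have R1: "1 \<le> R" using pos(6)[of k] kR by linarith
      have "R powr ((real n - 1) / (real n + 1) - \<epsilon>) \<le> R powr s"
        using R1 by (intro powr_mono) (auto simp: s_def)
      also have "\<dots> \<le> RR (Suc k) powr s" using R1 Rk by (intro powr_mono2) (auto simp: s_def)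
      also have "\<dots> \<le> c1 / (2 * C0) * gain k" by (rule k1[OF k0k(2)])
      finally have exp_le: "R powr ((real n - 1) / (real n + 1) - \<epsilon>) \<le> c1 / (2 * C0) * gain k" .
      show "weighted_ratio_ge PS.surf R (R powr ((real DIM('a) - 1) / (real DIM('a) + 1) - \<epsilon>))"
        using weighted_ratio_ge_mono[OF scale[OF k0k(1) kR] exp_le] by (simp only: n_def)
    qed
  qed
qed

end
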